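(* Let $(\Omega,\mathcal{F},\mathbb{P})$ be a probability space with filtration $\{\mathcal{F}_t\}_{t\ge0}$ supporting a standard Brownian motion $W$. Let $\alpha\in\mathbb{R}$, $\gamma,\sigma>0$, $x\ge0$, and let $Y$ be the one-sided reflected Ornstein–Uhlenbeck process solving \[ \mathrm{d}Y_t=(\alpha-\gamma Y_t)\,\mathrm{d}t+\sigma\,\mathrm{d}W_t+\mathrm{d}L_t,\qquad Y_0=x, \] where $L$ is the minimal nondecreasing process such that $Y_t\ge0$ for all $t\ge0$ (so $\int_{[0,\infty)}\mathbf{1}_{\{Y_t>0\}}\,\mathrm{d}L_t=0$). Let $p_Y$ be the invariant density of $Y$, \[ p_Y(y)=\frac{1}{\Phi\!\left(\frac{\alpha}{\sqrt{\sigma^2\gamma/2}}\right)\sqrt{\pi\sigma^2/\gamma}}\exp\!\left(-\frac{\gamma}{\sigma^2}\Big(y-\frac{\alpha}{\gamma}\Big)^2\right),\quad y\ge0, \] ($\Phi$ the standard normal distribution function), let $q_L:=\frac{\sigma^2}{2}p_Y(0)$, and let $h$ be the unique $C^2$ solution of $(\alpha-\gamma x)h'(x)+\frac{\sigma^2}{2}h''(x)=-q_L$ for $x\ge0$ with $h(0)=0$, $h'(0)=1$, namely $h(x)=\int_0^x \frac{1}{W(u)}\big(1-\frac{2q_L}{\sigma^2}\int_0^u W(v)\,\mathrm{d}v\big)\mathrm{d}u$ with $W(v)=\exp\left(\frac{2\alpha v}{\sigma^2}-\frac{\gamma v^2}{\sigma^2}\right)$. Then $\frac{L_t-q_Lt}{\sqrt{t}}$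 converges weakly, as $t\to\infty$, to $N(0,\tau^2)$, where $\tau^2=\sigma^2\int_0^\infty h'(x)^2p_Y(x)\,\mathrm{d}x<\infty$. *)

theory Defs
  imports "HOL-Probability.Probability"
begin

definition Phi :: "real \<Rightarrow> real" where
  "Phi x = (\<integral>y\<in>{..x}. std_normal_density y \<partial>lborel)"

definition std_brownian_motion ::
  "'a measure \<Rightarrow> (real \<Rightarrow> 'a measure) \<Rightarrow> (real \<Rightarrow> 'a \<Rightarrow> real) \<Rightarrow> bool" where
  "std_brownian_motion M F W \<longleftrightarrow>
     prob_space M \<and> filtration (space M) F \<and> (\<forall>t. subalgebra M (F t)) \<and>
     (\<forall>t\<ge>0. W t \<in> borel_measurable (F t)) \<and>
     (\<forall>\<omega>\<in>space M. W 0 \<omega> = 0 \<and> continuous_on {0..} (\<lambda>t. W t \<omega>)) \<and>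
     (\<forall>s t. 0 \<le> s \<longrightarrow> s < t \<longrightarrow>
        distributed M lborel (\<lambda>\<omega>. W t \<omega> - W s \<omega>) (normal_density 0 (sqrt (t - s))) \<and>
        prob_space.indep_set M (sets (F s))
          {(\<lambda>\<omega>. W t \<omega> - W s \<omega>) -` A \<inter> space M | A. A \<in> sets borel})"

definition reflected_OU ::
  "'a measure \<Rightarrow> (real \<Rightarrow> 'a measure) \<Rightarrow> (real \<Rightarrow> 'a \<Rightarrow> real) \<Rightarrow> real \<Rightarrow> real \<Rightarrow> real \<Rightarrow> real
     \<Rightarrow> (real \<Rightarrow> 'a \<Rightarrow> real) \<Rightarrow> (real \<Rightarrow> 'a \<Rightarrow> real) \<Rightarrow> bool" where
  "reflected_OU M F W \<alpha> \<gamma> \<sigma> x Y L \<longleftrightarrow>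
     (\<forall>t\<ge>0. Y t \<in> borel_measurable (F t) \<and> L t \<in> borel_measurable (F t)) \<and>
     (AE \<omega> in M.
        continuous_on {0..} (\<lambda>t. Y t \<omega>) \<and> continuous_on {0..} (\<lambda>t. L t \<omega>) \<and>
        L 0 \<omega> = 0 \<and> mono_on {0..} (\<lambda>t. L t \<omega>) \<and>
        (\<forall>t\<ge>0. Y t \<omega> \<ge> 0) \<and>
        (\<forall>t\<ge>0. Y t \<omega> = x + (LBINT s=0..t. \<alpha> - \<gamma> * Y s \<omega>) + \<sigma> * W t \<omega> + L t \<omega>) \<and>
        (\<forall>s t. 0 \<le> s \<longrightarrow> s \<le> t \<longrightarrow> (\<forall>u\<in>{s..t}. Y u \<omega> > 0) \<longrightarrow> L s \<omega> = L t \<omega>))"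

(* invariant density of Y (used for y \<ge> 0) *)
definition pY :: "real \<Rightarrow> real \<Rightarrow> real \<Rightarrow> real \<Rightarrow> real" where
  "pY \<alpha> \<gamma> \<sigma> y =
     1 / (Phi (\<alpha> / sqrt (\<sigma>\<^sup>2 * \<gamma> / 2)) * sqrt (pi * \<sigma>\<^sup>2 / \<gamma>)) *
     exp (- (\<gamma> / \<sigma>\<^sup>2) * (y - \<alpha> / \<gamma>)\<^sup>2)"

definition qL :: "real \<Rightarrow> real \<Rightarrow> real \<Rightarrow> real" where
  "qL \<alpha> \<gamma> \<sigma> = \<sigma>\<^sup>2 / 2 * pY \<alpha> \<gamma> \<sigma> 0"

definition Wsc :: "real \<Rightarrow> real \<Rightarrow> real \<Rightarrow> real \<Rightarrow> real" where
  "Wsc \<alpha> \<gamma> \<sigma> v = exp (2 * \<alpha> * v / \<sigma>\<^sup>2 - \<gamma> * v\<^sup>2 / \<sigma>\<^sup>2)"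

definition hfun :: "real \<Rightarrow> real \<Rightarrow> real \<Rightarrow> real \<Rightarrow> real" where
  "hfun \<alpha> \<gamma> \<sigma> x = (LBINT u=0..x. (1 / Wsc \<alpha> \<gamma> \<sigma> u) *
       (1 - 2 * qL \<alpha> \<gamma> \<sigma> / \<sigma>\<^sup>2 * (LBINT v=0..u. Wsc \<alpha> \<gamma> \<sigma> v)))"

definition tau2 :: "real \<Rightarrow> real \<Rightarrow> real \<Rightarrow> real" where
  "tau2 \<alpha> \<gamma> \<sigma> = \<sigma>\<^sup>2 * (\<integral>x\<in>{0..}. (deriv (hfun \<alpha> \<gamma> \<sigma>) x)\<^sup>2 * pY \<alpha> \<gamma> \<sigma> x \<partial>lborel)"

definition weak_conv_at_top :: "(real \<Rightarrow> real measure) \<Rightarrow> real measure \<Rightarrow> bool" where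
  "weak_conv_at_top \<mu> \<nu> \<longleftrightarrow>
     (\<forall>f :: real \<Rightarrow> real. continuous_on UNIV f \<longrightarrow> bounded (range f) \<longrightarrow>
        ((\<lambda>t. \<integral>y. f y \<partial>(\<mu> t)) \<longlongrightarrow> (\<integral>y. f y \<partial>\<nu>)) at_top)"

end

theory Submission
  imports Defs
begin

text \<open>
  Let \<open>G\<close> be the generator of the Ornstein--Uhlenbeck process. As \<open>h'(0) = 1\<close> and \<open>L\<close> grows only while
  \<open>Y = 0\<close>, the process \<open>L\<^sub>t - q t - h(Y\<^sub>t)\<close> is a martingale with bracket \<open>\<sigma>\<^sup>2 \<integral> h'(Y)\<^sup>2 ds\<close>. The
  ergodic theorem for the bracket is replaced by a second corrector \<open>k\<close> with \<open>G k = \<sigma>\<^sup>2 h'\<^sup>2 - \<tau>\<^sup>2\<close>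
  and \<open>k'(0) = 0\<close>: with \<open>u = \<theta> / \<surd>T\<close>, the expectation of
  \<open>exp (i u (L\<^sub>t - q t - h(Y\<^sub>t)) + u\<^sup>2 \<tau>\<^sup>2 t / 2) (1 + u\<^sup>2 k(Y\<^sub>t) / 2)\<close> varies by only \<open>O(1/\<surd>T)\<close> on \<open>[0, T]\<close>. Since
  \<open>E Y\<^sub>t = O(\<surd>T)\<close> and \<open>h\<close> grows logarithmically, the characteristic function of \<open>(L\<^sub>T - q T) / \<surd>T\<close>
  tends to \<open>exp (- \<theta>\<^sup>2 \<tau>\<^sup>2 / 2)\<close>. No stochastic integral is needed: Dynkin's formula is the limit of
  Taylor expansions along dyadic partitions, the boundary term vanishing because \<open>L\<close> increases over an
  interval only if \<open>Y\<close> has a zero there.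
\<close>

section \<open>Pathwise second-order expansion\<close>

text \<open>Why one corrector is not enough: exp (i u (L - q t - h(Y))) has a drift of order u^2,
  proportional to \<sigma>^2 h'(Y)^2, and over a time span T = \<theta>^2 / u^2 this does not vanish
  but only averages out. The factor 1 + u^2 k / 2 cancels the deviation from the average at order
  u^2 exactly. What is left has orders u^4 k and u^3 h' k', and both T u^4 E Y and T u^3 are O(1 /
  sqrt T). Crude moment bounds that grow with time therefore suffice. The obstacle is the unbounded
  drift \<alpha> - \<gamma> y. First derivatives must decay like 1 / (1 + y), both to keep second
  derivatives bounded and to keep the growth of h logarithmic. A solution of a Poisson equation
  decays in this way when its slope at 0 matches the integral of the right-hand side against the
  Gaussian weight. For slope 1 this condition is the value of q, for slope 0 it is the value of
  \<tau>^2.\<close>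

lemma vector_taylor2_bound:
  fixes f f' f'' :: "real \<Rightarrow> complex"
  assumes f: "\<And>z. (f has_vector_derivative f' z) (at z)"
    and f': "\<And>z. (f' has_vector_derivative f'' z) (at z)"
    and B: "\<And>z. z \<in> closed_segment a b \<Longrightarrow> cmod (f'' z - f'' a) \<le> e"
  shows "cmod (f b - f a - (b - a) *\<^sub>R f' a - ((b - a)\<^sup>2 / 2) *\<^sub>R f'' a) \<le> e * (b - a)\<^sup>2"
proof -
  let ?S = "closed_segment a b"
  have len: "\<bar>z - a\<bar> \<le> \<bar>b - a\<bar>" if "z \<in> ?S" for z
    using that by (auto simp: closed_segment_eq_real_ivl split: if_splits)
  have sub: "closed_segment a z \<subseteq> ?S" if "z \<in> ?S" for z
    using that by (simp add: subset_closed_segment)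
  have e0: "0 \<le> e"
    using B[of a] by simp
  have d1: "cmod (f' z - f' a - (z - a) *\<^sub>R f'' a) \<le> \<bar>b - a\<bar> * e" if "z \<in> ?S" for z
  proof -
    have "cmod (f' z - f' a - (z - a) *\<^sub>R f'' a) \<le> norm (z - a) * e"
      by (rule vector_differentiable_bound_linearization[where S="?S"])
         (use B sub[OF that] in \<open>auto intro: has_vector_derivative_at_within f'\<close>)
    also have "\<dots> \<le> \<bar>b - a\<bar> * e"
      using len[OF that] e0 by (simp add: mult_right_mono)
    finally show ?thesis .
  qed
  \<comment> \<open>Subtracting the quadratic makes \<open>d1\<close> the bound for
    \<open>g' z - g' a\<close>, so a second use of the linear estimate finishes. Only the
    oscillation of \<open>f''\<close> enters, since no third derivative is available.\<close>
  define g where "g z = f z - ((z - a)\<^sup>2 / 2) *\<^sub>R f'' a" for z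
  define g' where "g' z = f' z - (z - a) *\<^sub>R f'' a" for z
  have g: "(g has_vector_derivative g' z) (at z)" for z
    unfolding g_def g'_def
    by (rule has_vector_derivative_diff[OF f])
       (auto intro!: derivative_eq_intros simp: has_real_derivative_iff_has_vector_derivative[symmetric])
  have g'a: "g' a = f' a"
    by (simp add: g'_def)
  have "cmod (g b - g a - (b - a) *\<^sub>R g' a) \<le> norm (b - a) * (\<bar>b - a\<bar> * e)"
  proof (rule vector_differentiable_bound_linearization[where S="?S"])
    show "(g has_vector_derivative g' z) (at z within ?S)" for z
      by (rule has_vector_derivative_at_within[OF g])
    show "cmod (g' z - g' a) \<le> \<bar>b - a\<bar> * e" if "z \<in> ?S" for z
      using d1[OF that] unfolding g'a by (simp add: g'_def algebra_simps)
  qed auto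
  moreover have "norm (b - a) * (\<bar>b - a\<bar> * e) = e * (b - a)\<^sup>2"
    by (simp add: power2_eq_square mult_ac flip: abs_mult)
  moreover have "g b - g a - (b - a) *\<^sub>R g' a = f b - f a - (b - a) *\<^sub>R f' a - ((b - a)\<^sup>2 / 2) *\<^sub>R f'' a"
    by (simp add: g_def g'a)
  ultimately show ?thesis by metis
qed

lemma exp_remainder_bounds:
  fixes z :: complex
  assumes "cmod z \<le> 1"
  shows "cmod (exp z - 1 - z) \<le> 3 * (cmod z)\<^sup>2" "cmod (exp z - 1) \<le> 4 * cmod z"
proof -
  have "cmod (exp z - (\<Sum>i\<le>1. z ^ i / fact i)) \<le> exp (cmod z) * cmod z ^ Suc 1 / fact 1"
    by (rule Taylor_exp_field)
  then have "cmod (exp z - 1 - z) \<le> exp (cmod z) * (cmod z)\<^sup>2"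
    by (simp add: power2_eq_square algebra_simps)
  also have "\<dots> \<le> 3 * (cmod z)\<^sup>2"
    using exp_le assms order_trans[of "exp (cmod z)" "exp 1" 3] by (intro mult_right_mono) auto
  finally show 1: "cmod (exp z - 1 - z) \<le> 3 * (cmod z)\<^sup>2" .
  have "cmod (exp z - 1) \<le> cmod (exp z - 1 - z) + cmod z"
    using norm_triangle_ineq[of "exp z - 1 - z" z] by simp
  also have "\<dots> \<le> 3 * (cmod z)\<^sup>2 + cmod z" using 1 by simp
  also have "(cmod z)\<^sup>2 \<le> cmod z"
    using assms by (simp add: power2_eq_square mult_left_le)
  finally show "cmod (exp z - 1) \<le> 4 * cmod z" by simp
qed

lemma uniform_modulus:
  fixes g :: "real \<Rightarrow> 'b::real_normed_vector"
  assumes "continuous_on {0..T} g" "e > 0"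
  obtains \<eta> where "\<eta> > 0" "\<And>s t. s \<in> {0..T} \<Longrightarrow> t \<in> {0..T} \<Longrightarrow> \<bar>s - t\<bar> < \<eta> \<Longrightarrow> norm (g s - g t) \<le> e"
proof -
  have "uniformly_continuous_on {0..T} g"
    using assms(1) by (intro compact_uniformly_continuous) auto
  then obtain \<eta> where "\<eta> > 0" "\<forall>x\<in>{0..T}. \<forall>x'\<in>{0..T}. dist x' x < \<eta> \<longrightarrow> dist (g x') (g x) < e"
    using assms(2) unfolding uniformly_continuous_on_def by metis
  then show thesis
    by (intro that[of \<eta>]) (auto simp: dist_norm dist_real_def less_imp_le)
qed

lemma continuous_on_bounded_Icc:
  fixes g :: "real \<Rightarrow> 'b::real_normed_vector"
  assumes "continuous_on {0..T} g"
  obtains B where "\<And>t. t \<in> {0..T} \<Longrightarrow> norm (g t) \<le> B"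
proof -
  have "bounded (g ` {0..T})"
    using assms by (intro compact_imp_bounded compact_continuous_image) auto
  then show thesis
    using that unfolding bounded_iff by blast
qed

text \<open>One step of Ito's formula as a statement about numbers. \<open>K\<close> bounds every
  size and \<open>e\<close> every oscillation; \<open>D\<close> is the drift integral and
  \<open>d\<close> its integrand at the left end. Each leftover of the second-order expansion is
  \<open>e\<close> times a first-order quantity, so over a partition the errors add up to
  \<open>e\<close> times time plus local time plus quadratic variation.\<close>

lemma ito_remainder_algebra:
  fixes E0 E1 f0 f1 f0' f0'' a :: complex and u \<sigma> d \<delta> \<Delta>w \<Delta>l D e K :: real
  assumes K: "1 \<le> K" and e: "0 < e" "e \<le> 1" "2 * K * e \<le> 1"
    and bE: "cmod E0 \<le> K" and bf: "cmod f0 \<le> K" "cmod f0' \<le> K" "cmod f0'' \<le> K"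
    and ba: "cmod a + \<bar>u\<bar> \<le> K" and bs: "\<bar>\<sigma>\<bar> \<le> K"
    and pos: "0 \<le> \<delta>" "0 \<le> \<Delta>l" and small: "\<delta> \<le> e" "\<Delta>l \<le> e" "\<bar>\<Delta>w\<bar> \<le> e"
    and D: "\<bar>D\<bar> \<le> K * \<delta>" "\<bar>D - d * \<delta>\<bar> \<le> e * \<delta>"
    and f1: "cmod (f1 - f0) \<le> e"
    and taylor: "cmod (f1 - f0 - (D + \<sigma> * \<Delta>w + \<Delta>l) *\<^sub>R f0' - ((D + \<sigma> * \<Delta>w + \<Delta>l)\<^sup>2 / 2) *\<^sub>R f0'')
                  \<le> e * (D + \<sigma> * \<Delta>w + \<Delta>l)\<^sup>2"
    and bdry: "cmod ((f0' + \<i> * u * f0) * \<Delta>l) \<le> e * \<Delta>l"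
    and E1: "E1 = E0 * exp (a * \<delta> + \<i> * u * \<Delta>l)"
  shows "cmod (E1 * f1 - E0 * f0 - E0 * (a * f0 * of_real \<delta> + f0' * of_real (d * \<delta>) + f0' * of_real (\<sigma> * \<Delta>w) + f0'' * of_real (\<sigma>\<^sup>2 / 2 * \<Delta>w\<^sup>2)))
      \<le> 30 * K^4 * e * (\<delta> + \<Delta>l + \<Delta>w\<^sup>2)"
proof -
  \<comment> \<open>\<open>m\<close> gathers the increments of finite variation; \<open>v\<close>
    adds the quadratic variation.\<close>
  define m where "m = \<delta> + \<Delta>l"
  define v where "v = \<delta> + \<Delta>l + \<Delta>w\<^sup>2"
  define q where "q = D + \<Delta>l"
  define dy where "dy = D + \<sigma> * \<Delta>w + \<Delta>l"
  define z where "z = a * \<delta> + \<i> * u * \<Delta>l"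
  have m: "0 \<le> m" "m \<le> 2 * e" and v: "m \<le> v" "0 \<le> v" "\<Delta>w\<^sup>2 \<le> v"
    using pos small by (auto simp: m_def v_def)
  have q: "\<bar>q\<bar> \<le> K * m"
  proof -
    have "\<bar>q\<bar> \<le> K * \<delta> + 1 * \<Delta>l" using D(1) pos by (auto simp: q_def)
    also have "\<dots> \<le> K * m" unfolding m_def distrib_left using K pos by (intro add_mono mult_right_mono) auto
    finally show ?thesis .
  qed
  have z: "cmod z \<le> K * m"
  proof -
    have "cmod z \<le> cmod a * \<delta> + \<bar>u\<bar> * \<Delta>l"
      unfolding z_def by (rule order_trans[OF norm_triangle_ineq]) (use pos in \<open>simp add: norm_mult\<close>)
    also have "\<dots> \<le> K * \<delta> + K * \<Delta>l"
      using ba pos norm_ge_zero[of a] by (intro add_mono mult_right_mono) linarith+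
    finally show ?thesis by (simp add: m_def distrib_left)
  qed
  have Km: "K * m \<le> 2 * K * e" using m K by simp
  have z1: "cmod z \<le> 1" using z Km e by linarith
  note ex = exp_remainder_bounds[OF z1]
  have pK: "1 \<le> K^2" "1 \<le> K^3" "K \<le> K^4" "K^2 \<le> K^4" "K^3 \<le> K^4"
    using K power_increasing[of 1 4 K] power_increasing[of 2 4 K] power_increasing[of 3 4 K] by simp_all
  have ev: "0 \<le> e * v" using e v by simp
  have em: "e * m \<le> e * v" using e v by simp
  \<comment> \<open>The sources of error: Taylor remainder (\<open>R1\<close>), drift frozen at the
    left end (\<open>R2\<close>), boundary term (\<open>R3\<close>), all of the squared increment
    except its Brownian part (\<open>R4\<close>), higher orders of the exponential
    (\<open>R5\<close>), product of the two increments (\<open>R6\<close>). \<open>R3\<close> joins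
    the \<Delta>l terms of the function and of the weight.\<close>
  define R1 where "R1 = f1 - f0 - dy *\<^sub>R f0' - (dy\<^sup>2 / 2) *\<^sub>R f0''"
  define R2 where "R2 = f0' * (D - d * \<delta>)"
  define R3 where "R3 = (f0' + \<i> * u * f0) * \<Delta>l"
  define R4 where "R4 = f0'' * ((dy\<^sup>2 - \<sigma>\<^sup>2 * \<Delta>w\<^sup>2) / 2)"
  define R5 where "R5 = E0 * (exp z - 1 - z) * f0"
  define R6 where "R6 = E0 * (exp z - 1) * (f1 - f0)"
  have id: "E1 * f1 - E0 * f0 - E0 * (a * f0 * of_real \<delta> + f0' * of_real (d * \<delta>) + f0' * of_real (\<sigma> * \<Delta>w) + f0'' * of_real (\<sigma>\<^sup>2 / 2 * \<Delta>w\<^sup>2))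
    = E0 * (R1 + R2 + R3 + R4) + R5 + R6"
    unfolding E1 R1_def R2_def R3_def R4_def R5_def R6_def z_def[symmetric]
    by (simp add: dy_def z_def scaleR_conv_of_real power2_eq_square field_simps)
  have dy2: "dy\<^sup>2 \<le> 4 * K^2 * v"
  proof -
    have "dy\<^sup>2 \<le> 2 * q\<^sup>2 + 2 * (\<sigma> * \<Delta>w)\<^sup>2"
      using sum_squares_bound[of q "\<sigma> * \<Delta>w"] by (simp add: dy_def q_def power2_eq_square algebra_simps)
    moreover have "q\<^sup>2 \<le> K^2 * m * 2"
    proof -
      have "q\<^sup>2 \<le> (K * m)\<^sup>2" using q by (rule abs_le_square_iff[THEN iffD1, OF order_trans[OF _ abs_ge_self]])
      also have "\<dots> = K^2 * m * m" by (simp add: power2_eq_square)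
      also have "\<dots> \<le> K^2 * m * 2" using m e by (intro mult_left_mono) auto
      finally show ?thesis .
    qed
    moreover have "(\<sigma> * \<Delta>w)\<^sup>2 \<le> K^2 * \<Delta>w\<^sup>2"
      using bs by (auto simp: power_mult_distrib intro!: mult_right_mono abs_le_square_iff[THEN iffD1])
    moreover have "0 \<le> K^2 * \<Delta>w\<^sup>2" by simp
    ultimately have "dy\<^sup>2 \<le> 4 * (K^2 * m) + 4 * (K^2 * \<Delta>w\<^sup>2)" by linarith
    then show ?thesis by (simp add: v_def m_def algebra_simps)
  qed
  have R1: "cmod R1 \<le> 4 * K^2 * (e * v)"
  proof -
    have "cmod R1 \<le> e * dy\<^sup>2" using taylor by (simp add: R1_def dy_def)
    also have "\<dots> \<le> e * (4 * K^2 * v)" using dy2 e by (intro mult_left_mono) auto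
    finally show ?thesis by (simp add: mult_ac)
  qed
  have R2: "cmod R2 \<le> K * (e * v)"
  proof -
    have "cmod R2 = cmod f0' * \<bar>D - d * \<delta>\<bar>" by (simp add: R2_def norm_mult flip: of_real_mult of_real_diff)
    also have "\<dots> \<le> K * (e * \<delta>)" using bf D K by (intro mult_mono) auto
    also have "\<dots> \<le> K * (e * v)" using K e pos by (intro mult_left_mono) (auto simp: v_def)
    finally show ?thesis .
  qed
  have R3: "cmod R3 \<le> e * v"
  proof -
    have "cmod R3 \<le> e * \<Delta>l" using bdry by (simp add: R3_def)
    also have "\<dots> \<le> e * v" using e pos by (intro mult_left_mono) (auto simp: v_def)
    finally show ?thesis .
  qed
  \<comment> \<open>The Brownian square cancels, and the rest is a product of \<open>q\<close>, of
    order \<open>m\<close>, with a factor of order \<open>e\<close>.\<close>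
  have R4: "cmod R4 \<le> 2 * K^3 * (e * v)"
  proof -
    have "dy\<^sup>2 - \<sigma>\<^sup>2 * \<Delta>w\<^sup>2 = q * (q + 2 * \<sigma> * \<Delta>w)" by (simp add: dy_def q_def power2_eq_square algebra_simps)
    moreover have "\<bar>q + 2 * \<sigma> * \<Delta>w\<bar> \<le> 4 * K * e"
    proof -
      have "\<bar>2 * \<sigma> * \<Delta>w\<bar> \<le> 2 * (K * e)" using bs small K by (simp add: abs_mult mult_mono)
      then show ?thesis using q Km by linarith
    qed
    ultimately have "\<bar>dy\<^sup>2 - \<sigma>\<^sup>2 * \<Delta>w\<^sup>2\<bar> \<le> (K * m) * (4 * K * e)"
      using q K m by (simp add: abs_mult mult_mono)
    then have "cmod (complex_of_real ((dy\<^sup>2 - \<sigma>\<^sup>2 * \<Delta>w\<^sup>2) / 2)) \<le> (K * m) * (4 * K * e) / 2"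
      unfolding norm_of_real abs_divide abs_numeral by (rule divide_right_mono) simp
    then have "cmod R4 \<le> K * ((K * m) * (4 * K * e) / 2)"
      unfolding R4_def norm_mult[of f0''] using bf K by (intro mult_mono) simp_all
    also have "\<dots> = 2 * K^3 * (e * m)" by (simp add: power3_eq_cube mult_ac)
    also have "\<dots> \<le> 2 * K^3 * (e * v)" by (rule mult_left_mono[OF em]) (use K in simp)
    finally show ?thesis .
  qed
  have R5: "cmod R5 \<le> 6 * K^4 * (e * v)"
  proof -
    have "(cmod z)\<^sup>2 \<le> (K * m) * (2 * K * e)"
      unfolding power2_eq_square using z order_trans[OF z Km] K m by (intro mult_mono) auto
    then have "cmod (exp z - 1 - z) \<le> 3 * ((K * m) * (2 * K * e))" using ex(1) by linarith
    then have "cmod R5 \<le> K * (3 * ((K * m) * (2 * K * e))) * K"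
      unfolding R5_def norm_mult using bE bf K m e by (intro mult_mono) auto
    also have "\<dots> = 6 * K^4 * (e * m)" by (simp add: power4_eq_xxxx)
    also have "\<dots> \<le> 6 * K^4 * (e * v)" by (rule mult_left_mono[OF em]) (use K in simp)
    finally show ?thesis .
  qed
  have R6: "cmod R6 \<le> 4 * K^2 * (e * v)"
  proof -
    have "cmod (exp z - 1) \<le> 4 * (K * m)" using ex(2) z by linarith
    then have "cmod R6 \<le> K * (4 * (K * m)) * e"
      unfolding R6_def norm_mult using bE f1 K m e by (intro mult_mono) auto
    also have "\<dots> = 4 * K^2 * (e * m)" by (simp add: power2_eq_square)
    also have "\<dots> \<le> 4 * K^2 * (e * v)" by (rule mult_left_mono[OF em]) (use K in simp)
    finally show ?thesis .
  qed
  have "cmod (R1 + R2 + R3 + R4) \<le> 4 * K^2 * (e * v) + K * (e * v) + e * v + 2 * K^3 * (e * v)"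
    using R1 R2 R3 R4 by (intro order_trans[OF norm_triangle_ineq] add_mono)
  then have "cmod (E0 * (R1 + R2 + R3 + R4)) \<le> K * (4 * K^2 * (e * v) + K * (e * v) + e * v + 2 * K^3 * (e * v))"
    unfolding norm_mult using bE K by (intro mult_mono) auto
  also have "\<dots> = (4 * K^3 + K^2 + K + 2 * K^4) * (e * v)" by (simp add: power2_eq_square power3_eq_cube power4_eq_xxxx algebra_simps)
  also have "\<dots> \<le> (8 * K^4) * (e * v)" using pK ev by (intro mult_right_mono) auto
  finally have "cmod (E0 * (R1 + R2 + R3 + R4)) \<le> 8 * K^4 * (e * v)" .
  moreover have "4 * K^2 * (e * v) \<le> 4 * K^4 * (e * v)"
    using pK ev by (intro mult_right_mono) auto
  moreover have "cmod (E0 * (R1 + R2 + R3 + R4) + R5 + R6) \<le> cmod (E0 * (R1 + R2 + R3 + R4)) + cmod R5 + cmod R6"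
    by (intro order_trans[OF norm_triangle_ineq] add_mono) auto
  moreover have "0 \<le> K^4 * (e * v)" using ev by simp
  \<comment> \<open>The three contributions carry the constants 8, 6 and 4; 30 is a generous
    total.\<close>
  ultimately have "cmod (E0 * (R1 + R2 + R3 + R4) + R5 + R6) \<le> 30 * (K^4 * (e * v))"
    using R5 R6 by linarith
  then show ?thesis unfolding id v_def by (simp add: mult_ac)
qed

text \<open>Deterministic, one path at a time: compactness of [0,T] turns continuity into the
  uniform smallness that the algebraic estimate asks for. That \<eta> depends on the path is
  harmless, because only almost sure convergence is drawn from it.\<close>

lemma ito_remainder_path:
  fixes f f' f'' :: "real \<Rightarrow> complex" and y w l d :: "real \<Rightarrow> real" and a :: complex and u \<sigma> T \<epsilon> :: real
  assumes f: "\<And>z. (f has_vector_derivative f' z) (at z)"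
    and f': "\<And>z. (f' has_vector_derivative f'' z) (at z)"
    and f'': "continuous_on UNIV f''"
    and cont: "continuous_on {0..T} y" "continuous_on {0..T} w" "continuous_on {0..T} l" "continuous_on {0..T} d"
    and mono: "\<And>s t. 0 \<le> s \<Longrightarrow> s \<le> t \<Longrightarrow> t \<le> T \<Longrightarrow> l s \<le> l t"
    and eq: "\<And>s t. 0 \<le> s \<Longrightarrow> s \<le> t \<Longrightarrow> t \<le> T \<Longrightarrow>
               y t - y s = integral {s..t} d + \<sigma> * (w t - w s) + (l t - l s)"
    and flat: "\<And>s t. 0 \<le> s \<Longrightarrow> s \<le> t \<Longrightarrow> t \<le> T \<Longrightarrow> (\<forall>v\<in>{s..t}. y v \<noteq> 0) \<Longrightarrow> l s = l t"
    and bdry: "f' 0 + \<i> * u * f 0 = 0"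
    and \<epsilon>: "\<epsilon> > 0"
  obtains \<eta> where "\<eta> > 0"
    "\<And>s t. 0 \<le> s \<Longrightarrow> s \<le> t \<Longrightarrow> t \<le> T \<Longrightarrow> t - s < \<eta> \<Longrightarrow>
      cmod (exp (a * t + \<i> * u * l t) * f (y t) - exp (a * s + \<i> * u * l s) * f (y s)
        - exp (a * s + \<i> * u * l s) * (a * f (y s) * of_real (t - s) + f' (y s) * of_real (d s * (t - s))
            + f' (y s) * of_real (\<sigma> * (w t - w s)) + f'' (y s) * of_real (\<sigma>\<^sup>2 / 2 * (w t - w s)\<^sup>2)))
      \<le> \<epsilon> * ((t - s) + (l t - l s) + (w t - w s)\<^sup>2)"
proof -
  have cf: "continuous_on UNIV f" "continuous_on UNIV f'"
    using f f' by (auto intro!: continuous_at_imp_continuous_on has_vector_derivative_continuous)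
  have comp: "continuous_on {0..T} (\<lambda>t. g (y t))" if "continuous_on UNIV g" for g :: "real \<Rightarrow> complex"
    by (rule continuous_on_compose2[OF that cont(1)]) auto
  note cfy = comp[OF cf(1)] comp[OF cf(2)] comp[OF f'']
  have cE: "continuous_on {0..T} (\<lambda>t. exp (a * t + \<i> * u * l t))"
    by (intro continuous_intros cont)
  have cg: "continuous_on {0..T} (\<lambda>t. f' (y t) + \<i> * u * f (y t))"
    by (intro continuous_intros cfy)
  \<comment> \<open>One tuple for all coefficient functions: a norm bound and a modulus for the
    tuple serve every component at once.\<close>
  define G where "G t = (w t, l t, d t, f (y t), f' (y t), f'' (y t), exp (a * t + \<i> * u * l t))" for t
  have cG: "continuous_on {0..T} G"
    unfolding G_def by (intro continuous_on_Pair cont cfy cE)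
  have components: "norm c1 \<le> N" "norm c2 \<le> N" "norm c3 \<le> N" "norm c4 \<le> N" "norm c5 \<le> N" "norm c6 \<le> N" "norm c7 \<le> N"
    if "norm (c1, c2, c3, c4, c5, c6, c7) \<le> N"
    for c1 c2 c3 N :: real and c4 c5 c6 c7 :: complex
    using that norm_fst_le norm_snd_le by (meson order_trans)+
  obtain B where B: "\<And>t. t \<in> {0..T} \<Longrightarrow> norm (G t) \<le> B"
    using continuous_on_bounded_Icc[OF cG] by blast
  note bounds = components[OF B[unfolded G_def]]
  define K where "K = Max {1, B, cmod a + \<bar>u\<bar>, \<bar>\<sigma>\<bar>}"
  have K: "1 \<le> K" "B \<le> K" "cmod a + \<bar>u\<bar> \<le> K" "\<bar>\<sigma>\<bar> \<le> K"
    unfolding K_def by (rule Max_ge; simp)+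
  \<comment> \<open>The first entry gives 2 K e <= 1, which keeps the exponent in the range of
    \<open>exp_remainder_bounds\<close>; the second absorbs the constant
    \<open>30 * K^4\<close>.\<close>
  define e where "e = min (1 / (2 * K)) (\<epsilon> / (30 * K^4))"
  have e0: "e > 0" using \<epsilon> K(1) by (auto simp: e_def)
  have e2: "2 * K * e \<le> 1"
  proof -
    have "2 * K * e \<le> 2 * K * (1 / (2 * K))" using K(1) by (intro mult_left_mono) (auto simp: e_def)
    then show ?thesis using K(1) by simp
  qed
  have e1: "e \<le> 1"
  proof -
    have "1 * e \<le> 2 * K * e" using K(1) e0 by (intro mult_right_mono) auto
    then show ?thesis using e2 by simp
  qed
  have e3: "30 * K^4 * e \<le> \<epsilon>"
  proof -
    have "30 * K^4 * e \<le> 30 * K^4 * (\<epsilon> / (30 * K^4))" using K(1) by (intro mult_left_mono) (auto simp: e_def)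
    then show ?thesis using K(1) by simp
  qed
  obtain h1 where h1: "h1 > 0" "\<And>s t. s \<in> {0..T} \<Longrightarrow> t \<in> {0..T} \<Longrightarrow> \<bar>s - t\<bar> < h1 \<Longrightarrow> norm (G s - G t) \<le> e"
    using uniform_modulus[OF cG e0] by blast
  note moduli = components[OF h1(2)[unfolded G_def diff_Pair]]
  obtain h6 where h6: "h6 > 0" "\<And>s t. s \<in> {0..T} \<Longrightarrow> t \<in> {0..T} \<Longrightarrow> \<bar>s - t\<bar> < h6 \<Longrightarrow>
      norm ((f' (y s) + \<i> * u * f (y s)) - (f' (y t) + \<i> * u * f (y t))) \<le> e"
    using uniform_modulus[OF cg e0] by blast
  define h where "h = min h1 (min h6 e)"
  have h: "h > 0" "h \<le> h1" "h \<le> h6" "h \<le> e"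
    using h1(1) h6(1) e0 by (auto simp: h_def)
  show thesis
  proof (rule that[OF h(1)])
    fix s t :: real
    assume st: "0 \<le> s" "s \<le> t" "t \<le> T" "t - s < h"
    have in_T: "v \<in> {0..T}" "\<bar>v - s\<bar> < h" "\<bar>s - v\<bar> < h" if "v \<in> {s..t}" for v
      using that st by auto
    have sT: "s \<in> {0..T}" and tT: "t \<in> {0..T}" and ts: "\<bar>t - s\<bar> < h" using st by auto
    define D where "D = integral {s..t} d"
    have cd: "continuous_on {s..t} d" by (rule continuous_on_subset[OF cont(4)]) (use st in auto)
    have di: "d integrable_on {s..t}" by (rule integrable_continuous_interval[OF cd])
    have D1: "\<bar>D\<bar> \<le> K * (t - s)"
    proof -
      have "norm (d v) \<le> K" if "v \<in> {s..t}" for v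
        using bounds(3)[OF in_T(1)[OF that]] K(2) by simp
      from integral_bound[OF st(2) cd this] show ?thesis by (simp add: D_def)
    qed
    have D2: "\<bar>D - d s * (t - s)\<bar> \<le> e * (t - s)"
    proof -
      have "norm (integral {s..t} (\<lambda>v. d v - d s)) \<le> e * (t - s)"
      proof (rule integral_bound[OF st(2)])
        show "continuous_on {s..t} (\<lambda>v. d v - d s)" by (intro continuous_intros cd)
        show "norm (d v - d s) \<le> e" if "v \<in> {s..t}" for v
          using moduli(3)[of v s] in_T[OF that] sT h(2) by auto
      qed
      moreover have "integral {s..t} (\<lambda>v. d v - d s) = D - d s * (t - s)"
      proof -
        have "integral {s..t} (\<lambda>v. d v - d s) = integral {s..t} d - integral {s..t} (\<lambda>v. d s)"
          by (rule Henstock_Kurzweil_Integration.integral_diff[OF di]) (rule integrable_const_ivl)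
        then show ?thesis using st(2) by (simp add: D_def mult.commute)
      qed
      ultimately show ?thesis by simp
    qed
    have dy: "y t - y s = D + \<sigma> * (w t - w s) + (l t - l s)"
      using eq[OF st(1-3)] by (simp add: D_def)
    \<comment> \<open>Taylor needs \<open>f''\<close> at all values between \<open>y s\<close> and
      \<open>y t\<close>. By the intermediate value theorem each is attained at a time in [s,t],
      where the modulus of \<open>f''\<close> along the path applies.\<close>
    have seg: "\<exists>v\<in>{s..t}. y v = z" if "z \<in> closed_segment (y s) (y t)" for z
    proof -
      have cy: "continuous_on {s..t} y" by (rule continuous_on_subset[OF cont(1)]) (use st in auto)
      show ?thesis
      proof (cases "y s \<le> y t")
        case True
        then have "y s \<le> z" "z \<le> y t" using that by (auto simp: closed_segment_eq_real_ivl)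
        from IVT'[OF this st(2) cy] show ?thesis by auto
      next
        case False
        then have "y t \<le> z" "z \<le> y s" using that by (auto simp: closed_segment_eq_real_ivl)
        from IVT2'[OF this st(2) cy] show ?thesis by auto
      qed
    qed
    have taylor: "cmod (f (y t) - f (y s) - (y t - y s) *\<^sub>R f' (y s) - ((y t - y s)\<^sup>2 / 2) *\<^sub>R f'' (y s)) \<le> e * (y t - y s)\<^sup>2"
    proof (rule vector_taylor2_bound[OF f f'])
      fix z assume "z \<in> closed_segment (y s) (y t)"
      then obtain v where v: "v \<in> {s..t}" "y v = z" using seg by blast
      then show "cmod (f'' z - f'' (y s)) \<le> e"
        using moduli(6)[of v s] in_T[OF v(1)] sT h(2) by auto
    qed
    \<comment> \<open>Without a zero of \<open>y\<close> the increment of \<open>l\<close> vanishes.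
      With a zero at time \<open>v\<close>, the boundary condition makes f' + i u f vanish at
      \<open>y v\<close>, and the modulus carries the smallness back to \<open>s\<close>.\<close>
    have bd: "cmod ((f' (y s) + \<i> * u * f (y s)) * (l t - l s)) \<le> e * (l t - l s)"
    proof (cases "\<forall>v\<in>{s..t}. y v \<noteq> 0")
      case True
      then show ?thesis using flat[OF st(1-3)] by simp
    next
      case False
      then obtain v where v: "v \<in> {s..t}" "y v = 0" by blast
      have "cmod ((f' (y s) + \<i> * u * f (y s)) - (f' (y v) + \<i> * u * f (y v))) \<le> e"
        using h6(2)[of s v] in_T[OF v(1)] sT h(3) by auto
      then have "cmod (f' (y s) + \<i> * u * f (y s)) \<le> e" by (simp add: v(2) bdry)
      moreover have "cmod (complex_of_real (l t) - complex_of_real (l s)) = l t - l s"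
        using mono[OF st(1-3)] by (simp flip: of_real_diff)
      ultimately show ?thesis using mono[OF st(1-3)] unfolding norm_mult by (simp add: mult_right_mono)
    qed
    have E: "exp (a * t + \<i> * u * l t) = exp (a * s + \<i> * u * l s) * exp (a * (t - s) + \<i> * u * (l t - l s))"
      by (simp add: algebra_simps flip: exp_add)
    let ?r = "cmod (exp (a * t + \<i> * u * l t) * f (y t) - exp (a * s + \<i> * u * l s) * f (y s)
        - exp (a * s + \<i> * u * l s) * (a * f (y s) * of_real (t - s) + f' (y s) * of_real (d s * (t - s))
            + f' (y s) * of_real (\<sigma> * (w t - w s)) + f'' (y s) * of_real (\<sigma>\<^sup>2 / 2 * (w t - w s)\<^sup>2)))"
    have "?r \<le> 30 * K^4 * e * ((t - s) + (l t - l s) + (w t - w s)\<^sup>2)"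
    proof (rule ito_remainder_algebra[where D = D])
      show "cmod (exp (a * s + \<i> * u * l s)) \<le> K" using order_trans[OF bounds(7)[OF sT] K(2)] .
      show "cmod (f (y s)) \<le> K" using order_trans[OF bounds(4)[OF sT] K(2)] .
      show "cmod (f' (y s)) \<le> K" using order_trans[OF bounds(5)[OF sT] K(2)] .
      show "cmod (f'' (y s)) \<le> K" using order_trans[OF bounds(6)[OF sT] K(2)] .
      show "t - s \<le> e" using st h by simp
      show "l t - l s \<le> e" using moduli(2)[OF tT sT] ts h(2) by auto
      show "\<bar>w t - w s\<bar> \<le> e" using moduli(1)[OF tT sT] ts h(2) by auto
      show "cmod (f (y t) - f (y s)) \<le> e" using moduli(4)[OF tT sT] ts h(2) by auto
      show "cmod (f (y t) - f (y s) - (D + \<sigma> * (w t - w s) + (l t - l s)) *\<^sub>R f' (y s)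
          - ((D + \<sigma> * (w t - w s) + (l t - l s))\<^sup>2 / 2) *\<^sub>R f'' (y s)) \<le> e * (D + \<sigma> * (w t - w s) + (l t - l s))\<^sup>2"
        using taylor unfolding dy .
      show "cmod ((f' (y s) + \<i> * u * f (y s)) * complex_of_real (l t - l s)) \<le> e * (l t - l s)"
        using bd by simp
      show "exp (a * t + \<i> * u * l t) = exp (a * s + \<i> * u * l s) * exp (a * complex_of_real (t - s) + \<i> * u * complex_of_real (l t - l s))"
        using E by simp
      show "0 \<le> t - s" "0 \<le> l t - l s" using st(2) mono[OF st(1-3)] by simp_all
    qed (fact K(1) e0 e1 e2 K(3) K(4) D1 D2)+
    also have "\<dots> \<le> \<epsilon> * ((t - s) + (l t - l s) + (w t - w s)\<^sup>2)"
      using e3 st mono[OF st(1-3)] by (intro mult_right_mono) auto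
    finally show "?r \<le> \<epsilon> * ((t - s) + (l t - l s) + (w t - w s)\<^sup>2)" .
  qed
qed

section \<open>Discrete martingale transforms\<close>

abbreviation preimages :: "'a measure \<Rightarrow> ('a \<Rightarrow> 'b::topological_space) \<Rightarrow> 'a set set" where
  "preimages M X \<equiv> {X -` A \<inter> space M | A. A \<in> sets borel}"

text \<open>Independence of increments is given on plain preimages. Both families are closed under
  intersection, so it extends to the generated \<sigma>-algebras that \<open>indep_var\<close>
  refers to.\<close>

lemma (in prob_space) indep_set_imp_indep_var:
  fixes Z \<eta> :: "'a \<Rightarrow> 'b::topological_space"
  assumes sub: "subalgebra M G" and Z: "Z \<in> borel_measurable G" and \<eta>: "\<eta> \<in> borel_measurable M"
    and ind: "indep_set (sets G) (preimages M \<eta>)"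
  shows "indep_var borel Z borel \<eta>"
proof -
  have sp: "space G = space M" and le: "sets G \<subseteq> sets M"
    using sub by (auto simp: subalgebra_def)
  have ZM: "Z \<in> borel_measurable M"
    using measurable_from_subalg[OF sub Z] .
  have "indep_set (sigma_sets (space M) (sets G)) (sigma_sets (space M) (preimages M \<eta>))"
  proof (rule indep_set_sigma_sets[OF ind])
    show "Int_stable (sets G)" by (auto simp: Int_stable_def)
    show "Int_stable (preimages M \<eta>)"
    proof (rule Int_stableI)
      fix a b assume "a \<in> preimages M \<eta>" "b \<in> preimages M \<eta>"
      then obtain A B where "a = \<eta> -` A \<inter> space M" "b = \<eta> -` B \<inter> space M" "A \<in> sets borel" "B \<in> sets borel" by blast
      then show "a \<inter> b \<in> preimages M \<eta>"
        by (intro CollectI exI[of _ "A \<inter> B"]) auto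
    qed
  qed
  moreover have "sigma_sets (space M) (preimages M Z) \<subseteq> sigma_sets (space M) (sets G)"
    using measurable_sets[OF Z] sp by (intro sigma_sets_mono') auto
  ultimately have "indep_set (sigma_sets (space M) (preimages M Z))
      (sigma_sets (space M) (preimages M \<eta>))"
    unfolding indep_sets2_eq by blast
  then show ?thesis
    unfolding indep_var_eq using ZM \<eta> by blast
qed

lemma (in prob_space) indep_set_vimage_compose:
  fixes \<xi> :: "'a \<Rightarrow> 'b::topological_space" and g :: "'b \<Rightarrow> 'c::topological_space"
  assumes ind: "indep_set \<A> (preimages M \<xi>)" and g: "g \<in> borel_measurable borel"
  shows "indep_set \<A> (preimages M (\<lambda>\<omega>. g (\<xi> \<omega>)))"
proof -
  have sub: "preimages M (\<lambda>\<omega>. g (\<xi> \<omega>)) \<subseteq> preimages M \<xi>"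
    (is "?B \<subseteq> ?C")
  proof
    fix X assume "X \<in> ?B"
    then obtain A where A: "X = (\<lambda>\<omega>. g (\<xi> \<omega>)) -` A \<inter> space M" "A \<in> sets borel" by blast
    have "g -` A \<in> sets borel" using measurable_sets[OF g A(2)] by simp
    moreover have "X = \<xi> -` (g -` A) \<inter> space M" unfolding A(1) by (simp only: vimage_def mem_Collect_eq)
    ultimately show "X \<in> ?C" by (intro CollectI exI[of _ "g -` A"] conjI)
  qed
  have ind': "\<A> \<subseteq> events" "?C \<subseteq> events" "\<And>a b. a \<in> \<A> \<Longrightarrow> b \<in> ?C \<Longrightarrow> prob (a \<inter> b) = prob a * prob b"
    using ind by (simp_all only: indep_sets2_eq) 
  show ?thesis unfolding indep_sets2_eq
    using ind'(1) order_trans[OF sub ind'(2)] ind'(3)[OF _ subsetD[OF sub]] by (intro conjI ballI)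
qed

lemma (in prob_space) expectation_indep_mult:
  fixes Z :: "'a \<Rightarrow> 'b::{real_normed_field, banach, second_countable_topology}" and \<eta> :: "'a \<Rightarrow> real"
  assumes sub: "subalgebra M G" and Z: "Z \<in> borel_measurable G" "integrable M Z" and \<eta>: "integrable M \<eta>"
    and ind: "indep_set (sets G) (preimages M \<eta>)"
  shows "integrable M (\<lambda>\<omega>. Z \<omega> * of_real (\<eta> \<omega>))"
    and "expectation (\<lambda>\<omega>. Z \<omega> * of_real (\<eta> \<omega>)) = expectation Z * of_real (expectation \<eta>)"
proof -
  have ie: "integrable M (\<lambda>\<omega>. of_real (\<eta> \<omega>) :: 'b)" using \<eta> by (rule integrable_of_real)
  have "indep_var borel Z borel (\<lambda>\<omega>. of_real (\<eta> \<omega>) :: 'b)"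
  proof (rule indep_set_imp_indep_var[OF sub Z(1)])
    show "(\<lambda>\<omega>. of_real (\<eta> \<omega>) :: 'b) \<in> borel_measurable M" using ie by simp
    show "indep_set (sets G) (preimages M (\<lambda>\<omega>. of_real (\<eta> \<omega>) :: 'b))"
      by (rule indep_set_vimage_compose[OF ind]) simp
  qed
  from indep_var_lebesgue_integral[OF this Z(2) ie] indep_var_integrable[OF this Z(2) ie]
  show "integrable M (\<lambda>\<omega>. Z \<omega> * of_real (\<eta> \<omega>))"
    "expectation (\<lambda>\<omega>. Z \<omega> * of_real (\<eta> \<omega>)) = expectation Z * of_real (expectation \<eta>)"
    using \<eta> by simp_all
qed

lemma (in prob_space) integrable_square_bound:
  fixes X :: "'a \<Rightarrow> 'b::{banach, second_countable_topology}"
  assumes "X \<in> borel_measurable M" "integrable M (\<lambda>\<omega>. (norm (X \<omega>))\<^sup>2)"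
  shows "integrable M X"
proof (rule Bochner_Integration.integrable_bound[where f = "\<lambda>\<omega>. 1 + (norm (X \<omega>))\<^sup>2"])
  show "AE \<omega> in M. norm (X \<omega>) \<le> norm (1 + (norm (X \<omega>))\<^sup>2)"
  proof (intro AE_I2)
    fix \<omega>
    have "2 * norm (X \<omega>) \<le> (norm (X \<omega>))\<^sup>2 + 1" using sum_squares_bound[of "norm (X \<omega>)" 1] by simp
    then have "norm (X \<omega>) \<le> 1 + (norm (X \<omega>))\<^sup>2" using zero_le_power2[of "norm (X \<omega>)"] by linarith
    then show "norm (X \<omega>) \<le> norm (1 + (norm (X \<omega>))\<^sup>2)" by simp
  qed
qed (use assms in auto)

text \<open>Orthogonality of martingale differences. The past sum and the coefficient are known at
  step n, so the cross term is a \<open>G n\<close>-measurable factor times a centred independent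
  one, while the mean of the square term factorises. It is applied with \<eta> a Brownian increment
  and with \<eta> its centred square.\<close>

lemma (in prob_space) martingale_transform_L2:
  fixes X :: "nat \<Rightarrow> 'a \<Rightarrow> complex" and \<eta> :: "nat \<Rightarrow> 'a \<Rightarrow> real"
  assumes sub: "\<And>i. subalgebra M (G i)" and G_mono: "\<And>i. sets (G i) \<subseteq> sets (G (Suc i))"
    and X: "\<And>i. X i \<in> borel_measurable (G i)" and \<eta>: "\<And>i. \<eta> i \<in> borel_measurable (G (Suc i))"
    and ind: "\<And>i. indep_set (sets (G i)) (preimages M (\<eta> i))"
    and X2: "\<And>i. integrable M (\<lambda>\<omega>. (cmod (X i \<omega>))\<^sup>2)"
    and \<eta>2: "\<And>i. integrable M (\<lambda>\<omega>. (\<eta> i \<omega>)\<^sup>2)"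
    and \<eta>_mean: "\<And>i. expectation (\<eta> i) = 0" and \<eta>_var: "\<And>i. expectation (\<lambda>\<omega>. (\<eta> i \<omega>)\<^sup>2) = v"
  shows "integrable M (\<lambda>\<omega>. (cmod (\<Sum>i<n. X i \<omega> * \<eta> i \<omega>))\<^sup>2)" (is ?int)
    and "expectation (\<lambda>\<omega>. \<Sum>i<n. X i \<omega> * \<eta> i \<omega>) = 0" (is ?mean)
    and "expectation (\<lambda>\<omega>. (cmod (\<Sum>i<n. X i \<omega> * \<eta> i \<omega>))\<^sup>2) = v * (\<Sum>i<n. expectation (\<lambda>\<omega>. (cmod (X i \<omega>))\<^sup>2))" (is ?var)
proof -
  define S where "S n \<omega> = (\<Sum>i<n. X i \<omega> * \<eta> i \<omega>)" for n \<omega>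
  have sp: "space (G i) = space M" for i using sub by (auto simp: subalgebra_def)
  have Gle: "sets (G i) \<subseteq> sets (G j)" if "i \<le> j" for i j
    using G_mono that by (rule lift_Suc_mono_le)
  have up: "f \<in> borel_measurable (G j)" if "f \<in> borel_measurable (G i)" "i \<le> j" for f :: "'a \<Rightarrow> 'b::topological_space" and i j
    using that(1) Gle[OF that(2)] sp by (auto simp: measurable_def)
  have [measurable]: "X i \<in> borel_measurable M" "\<eta> i \<in> borel_measurable M" for i
    using measurable_from_subalg[OF sub X] measurable_from_subalg[OF sub \<eta>] by auto
  have SG: "S n \<in> borel_measurable (G n)" for n
  proof -
    have "(\<lambda>\<omega>. X i \<omega> * \<eta> i \<omega>) \<in> borel_measurable (G n)" if "i < n" for i
    proof -
      have [measurable]: "X i \<in> borel_measurable (G n)" "\<eta> i \<in> borel_measurable (G n)"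
        using up[OF X, of i n] up[OF \<eta>, of i n] that by auto
      show ?thesis by measurable
    qed
    then show ?thesis unfolding S_def by (intro borel_measurable_sum) auto
  qed
  have [measurable]: "S n \<in> borel_measurable M" for n
    using measurable_from_subalg[OF sub SG] .
  have \<eta>i: "integrable M (\<eta> i)" for i
    by (rule integrable_square_bound) (use \<eta>2 in auto)
  have Xi: "integrable M (X i)" for i
    by (rule integrable_square_bound) (use X2 in auto)
  have main: "integrable M (\<lambda>\<omega>. (cmod (S n \<omega>))\<^sup>2) \<and> expectation (\<lambda>\<omega>. S n \<omega>) = 0 \<and>
      expectation (\<lambda>\<omega>. (cmod (S n \<omega>))\<^sup>2) = v * (\<Sum>i<n. expectation (\<lambda>\<omega>. (cmod (X i \<omega>))\<^sup>2))"
  proof (induction n)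
    case 0
    then show ?case by (simp add: S_def)
  next
    case (Suc n)
    \<comment> \<open>As a real inner product the cross term stays a known real factor times
      \<open>\<eta> n\<close>; Cauchy-Schwarz makes that factor integrable from second moments
      alone.\<close>
    let ?i = "\<lambda>\<omega>. inner (S n \<omega>) (X n \<omega>)"
    have S_Suc: "S (Suc n) \<omega> = S n \<omega> + X n \<omega> * \<eta> n \<omega>" for \<omega> by (simp add: S_def)
    have sq: "(cmod (S (Suc n) \<omega>))\<^sup>2 = (cmod (S n \<omega>))\<^sup>2 + 2 * (?i \<omega> * \<eta> n \<omega>) + (cmod (X n \<omega>))\<^sup>2 * (\<eta> n \<omega>)\<^sup>2" for \<omega>
    proof -
      have "X n \<omega> * \<eta> n \<omega> = \<eta> n \<omega> *\<^sub>R X n \<omega>" by (simp add: scaleR_conv_of_real)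
      then have "(cmod (S (Suc n) \<omega>))\<^sup>2 = inner (S n \<omega> + \<eta> n \<omega> *\<^sub>R X n \<omega>) (S n \<omega> + \<eta> n \<omega> *\<^sub>R X n \<omega>)"
        unfolding S_Suc by (simp only: power2_norm_eq_inner)
      also have "\<dots> = inner (S n \<omega>) (S n \<omega>) + 2 * (?i \<omega> * \<eta> n \<omega>) + inner (X n \<omega>) (X n \<omega>) * (\<eta> n \<omega>)\<^sup>2"
        by (simp add: inner_add_left inner_add_right inner_commute) (simp add: power2_eq_square algebra_simps)
      finally show ?thesis by (simp only: power2_norm_eq_inner)
    qed
    have ii: "integrable M ?i"
    proof (rule Bochner_Integration.integrable_bound)
      show "integrable M (\<lambda>\<omega>. (cmod (S n \<omega>))\<^sup>2 + (cmod (X n \<omega>))\<^sup>2)" using Suc X2 by auto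
      show "AE \<omega> in M. norm (?i \<omega>) \<le> norm ((cmod (S n \<omega>))\<^sup>2 + (cmod (X n \<omega>))\<^sup>2)"
      proof (intro AE_I2)
        fix \<omega>
        have "\<bar>?i \<omega>\<bar> \<le> cmod (S n \<omega>) * cmod (X n \<omega>)" by (rule Cauchy_Schwarz_ineq2)
        also have "\<dots> \<le> (cmod (S n \<omega>))\<^sup>2 + (cmod (X n \<omega>))\<^sup>2"
          using sum_squares_bound[of "cmod (S n \<omega>)" "cmod (X n \<omega>)"] mult_nonneg_nonneg[OF norm_ge_zero norm_ge_zero, of "S n \<omega>" "X n \<omega>"] by linarith
        finally show "norm (?i \<omega>) \<le> norm ((cmod (S n \<omega>))\<^sup>2 + (cmod (X n \<omega>))\<^sup>2)" by simp
      qed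
    qed auto
    have iG: "?i \<in> borel_measurable (G n)" using SG X by measurable
    note A = expectation_indep_mult[OF sub iG ii \<eta>i ind, simplified]
    have xG: "(\<lambda>\<omega>. (cmod (X n \<omega>))\<^sup>2) \<in> borel_measurable (G n)" using X by measurable
    have ind2: "indep_set (sets (G n)) (preimages M (\<lambda>\<omega>. (\<eta> n \<omega>)\<^sup>2))"
      using indep_set_vimage_compose[OF ind, of "\<lambda>x. x\<^sup>2" n] by simp
    note B = expectation_indep_mult[OF sub xG X2 \<eta>2 ind2, simplified]
    note C = expectation_indep_mult[OF sub X Xi \<eta>i ind, simplified]
    have Si: "integrable M (S n)" by (rule integrable_square_bound) (use Suc in auto)
    have IH: "integrable M (\<lambda>\<omega>. (cmod (S n \<omega>))\<^sup>2)" "expectation (\<lambda>\<omega>. S n \<omega>) = 0"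
      "expectation (\<lambda>\<omega>. (cmod (S n \<omega>))\<^sup>2) = v * (\<Sum>i<n. expectation (\<lambda>\<omega>. (cmod (X i \<omega>))\<^sup>2))"
      using Suc by auto
    have "integrable M (\<lambda>\<omega>. (cmod (S (Suc n) \<omega>))\<^sup>2)"
      unfolding sq using IH A B by (intro Bochner_Integration.integrable_add integrable_mult_right) auto
    moreover have "expectation (\<lambda>\<omega>. S (Suc n) \<omega>) = 0"
      unfolding S_Suc using IH C \<eta>_mean[of n] Si by (subst Bochner_Integration.integral_add) auto
    moreover have "expectation (\<lambda>\<omega>. (cmod (S (Suc n) \<omega>))\<^sup>2) = v * (\<Sum>i<Suc n. expectation (\<lambda>\<omega>. (cmod (X i \<omega>))\<^sup>2))"
      unfolding sq using IH A B \<eta>_mean[of n] \<eta>_var[of n]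
      by (subst Bochner_Integration.integral_add, simp, simp)+ (simp add: distrib_left)
    ultimately show ?case by (intro conjI)
  qed
  then show ?int ?mean ?var unfolding S_def by blast+
qed

text \<open>The inputs of \<open>martingale_transform_L2\<close> for \<xi> and for \<xi>^2 -
  \<delta>. The last variance is 3 \<delta>^2 - 2 \<delta>^2 + \<delta>^2, from the Gaussian fourth
  moment.\<close>

lemma (in prob_space) normal_increment_moments:
  assumes D: "distributed M lborel \<xi> (normal_density 0 (sqrt \<delta>))" and \<delta>: "\<delta> > 0"
  shows "integrable M (\<lambda>\<omega>. (\<xi> \<omega>)\<^sup>2)" "expectation \<xi> = 0" "expectation (\<lambda>\<omega>. (\<xi> \<omega>)\<^sup>2) = \<delta>"
    "integrable M (\<lambda>\<omega>. ((\<xi> \<omega>)\<^sup>2 - \<delta>)\<^sup>2)" "expectation (\<lambda>\<omega>. (\<xi> \<omega>)\<^sup>2 - \<delta>) = 0"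
    "expectation (\<lambda>\<omega>. ((\<xi> \<omega>)\<^sup>2 - \<delta>)\<^sup>2) = 2 * \<delta>\<^sup>2"
proof -
  have s: "sqrt \<delta> > 0" using \<delta> by simp
  have int: "integrable M (\<lambda>\<omega>. (\<xi> \<omega>)^k)" for k
    using distributed_integrable[OF D, of "\<lambda>x. x^k"] integrable_normal_moment[OF s, of 0 k] by simp
  have ex: "expectation (\<lambda>\<omega>. (\<xi> \<omega>)^k) = (\<integral>x. normal_density 0 (sqrt \<delta>) x * x^k \<partial>lborel)" for k
    using distributed_integral[OF D, of "\<lambda>x. x^k"] by simp
  have e1: "expectation \<xi> = 0"
    using ex[of 1] integral_normal_moment_odd[OF s, of 0 0] by simp
  have e2: "expectation (\<lambda>\<omega>. (\<xi> \<omega>)\<^sup>2) = \<delta>"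
    using ex[of 2] integral_normal_moment_even[OF s, of 0 1] \<delta> by simp
  have e4: "expectation (\<lambda>\<omega>. (\<xi> \<omega>)^4) = 3 * \<delta>\<^sup>2"
    using ex[of 4] integral_normal_moment_even[OF s, of 0 2] \<delta> by (simp add: fact_numeral power2_eq_square)
  have sq: "((\<xi> \<omega>)\<^sup>2 - \<delta>)\<^sup>2 = (\<xi> \<omega>)^4 - 2 * \<delta> * (\<xi> \<omega>)\<^sup>2 + \<delta>\<^sup>2" for \<omega>
    by (simp add: power2_eq_square power4_eq_xxxx algebra_simps)
  show "integrable M (\<lambda>\<omega>. (\<xi> \<omega>)\<^sup>2)" by (rule int)
  show "expectation \<xi> = 0" "expectation (\<lambda>\<omega>. (\<xi> \<omega>)\<^sup>2) = \<delta>" by fact+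
  show "integrable M (\<lambda>\<omega>. ((\<xi> \<omega>)\<^sup>2 - \<delta>)\<^sup>2)" unfolding sq using int by simp
  show "expectation (\<lambda>\<omega>. (\<xi> \<omega>)\<^sup>2 - \<delta>) = 0" using int e2 by (simp add: prob_space)
  show "expectation (\<lambda>\<omega>. ((\<xi> \<omega>)\<^sup>2 - \<delta>)\<^sup>2) = 2 * \<delta>\<^sup>2"
  proof -
    have "expectation (\<lambda>\<omega>. ((\<xi> \<omega>)\<^sup>2 - \<delta>)\<^sup>2)
        = expectation (\<lambda>\<omega>. (\<xi> \<omega>)^4) - expectation (\<lambda>\<omega>. 2 * \<delta> * (\<xi> \<omega>)\<^sup>2) + expectation (\<lambda>\<omega>. \<delta>\<^sup>2)"
      unfolding sq using int
      by (subst Bochner_Integration.integral_add) (auto intro!: Bochner_Integration.integral_diff)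
    also have "\<dots> = 3 * \<delta>\<^sup>2 - 2 * \<delta> * \<delta> + \<delta>\<^sup>2"
      by (simp only: e4 integral_mult_right_zero e2 lebesgue_integral_const prob_space) simp
    also have "\<dots> = 2 * \<delta>\<^sup>2" by (simp add: power2_eq_square)
    finally show ?thesis .
  qed
qed

text \<open>The sum of all squares has finite mean, hence is almost surely finite, and its square
  root bounds every member.\<close>

lemma (in prob_space) AE_bounded_of_summable_moments:
  fixes S :: "nat \<Rightarrow> 'a \<Rightarrow> real"
  assumes S: "\<And>n. integrable M (\<lambda>\<omega>. (S n \<omega>)\<^sup>2)" "\<And>n. S n \<in> borel_measurable M"
    and sum: "summable (\<lambda>n. expectation (\<lambda>\<omega>. (S n \<omega>)\<^sup>2))"
  shows "AE \<omega> in M. \<exists>B. \<forall>n. \<bar>S n \<omega>\<bar> \<le> B"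
proof -
  note [measurable] = S(2)
  have "(\<integral>\<^sup>+\<omega>. (\<Sum>n. ennreal ((S n \<omega>)\<^sup>2)) \<partial>M) = (\<Sum>n. \<integral>\<^sup>+\<omega>. ennreal ((S n \<omega>)\<^sup>2) \<partial>M)"
    by (rule nn_integral_suminf) auto
  also have "\<dots> = (\<Sum>n. ennreal (expectation (\<lambda>\<omega>. (S n \<omega>)\<^sup>2)))"
    using S(1) by (simp add: nn_integral_eq_integral)
  also have "\<dots> < \<infinity>"
    using sum by (simp add: suminf_ennreal2 less_top)
  finally have "AE \<omega> in M. (\<Sum>n. ennreal ((S n \<omega>)\<^sup>2)) \<noteq> \<infinity>"
    by (intro nn_integral_PInf_AE) auto
  then show ?thesis
  proof eventually_elim
    case (elim \<omega>)
    define r where "r = enn2real (\<Sum>n. ennreal ((S n \<omega>)\<^sup>2))"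
    have r: "0 \<le> r" by (simp add: r_def)
    have r': "ennreal r = (\<Sum>n. ennreal ((S n \<omega>)\<^sup>2))"
      unfolding r_def using elim by (intro ennreal_enn2real) (simp only: infinity_ennreal_def less_top)
    have "\<bar>S n \<omega>\<bar> \<le> sqrt r" for n
    proof -
      have "(\<Sum>k\<in>{n}. ennreal ((S k \<omega>)\<^sup>2)) \<le> (\<Sum>n. ennreal ((S n \<omega>)\<^sup>2))"
        by (rule sum_le_suminf) auto
      then have "ennreal ((S n \<omega>)\<^sup>2) \<le> ennreal r" unfolding r' by simp
      then have "(S n \<omega>)\<^sup>2 \<le> r" using r by (simp only: ennreal_le_iff)
      from real_sqrt_le_mono[OF this] show ?thesis by simp
    qed
    then show "\<exists>B. \<forall>n. \<bar>S n \<omega>\<bar> \<le> B" by blast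
  qed
qed

text \<open>An L2 bound gives uniform integrability: below a level \<open>c\<close> dominated
  convergence applies, above it |R| <= |R|^2 / c.\<close>

lemma (in prob_space) expectation_tendsto_zero:
  fixes R :: "nat \<Rightarrow> 'a \<Rightarrow> complex"
  assumes R[measurable]: "\<And>n. R n \<in> borel_measurable M" and R2: "\<And>n. integrable M (\<lambda>\<omega>. (cmod (R n \<omega>))\<^sup>2)"
    and K: "\<And>n. expectation (\<lambda>\<omega>. (cmod (R n \<omega>))\<^sup>2) \<le> K"
    and lim: "AE \<omega> in M. (\<lambda>n. R n \<omega>) \<longlonglongrightarrow> 0"
  shows "(\<lambda>n. expectation (R n)) \<longlonglongrightarrow> 0"
proof (rule LIMSEQ_I)
  fix r :: real assume r: "r > 0"
  have K0: "0 \<le> K" using order_trans[OF _ K[of 0]] by simp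
  \<comment> \<open>This level makes the tail \<open>K / c\<close> at most r / 2; the summand 1
    keeps \<open>c\<close> positive when \<open>K\<close> = 0.\<close>
  define c where "c = (K + 1) * 2 / r"
  have c: "c > 0" using K0 r by (simp add: c_def)
  have Ri: "integrable M (R n)" for n by (rule integrable_square_bound) (use R2 in auto)
  have lim1: "(\<lambda>n. expectation (\<lambda>\<omega>. min (cmod (R n \<omega>)) c)) \<longlonglongrightarrow> expectation (\<lambda>\<omega>. 0)"
  proof (rule integral_dominated_convergence[where w="\<lambda>_. c"])
    show "AE \<omega> in M. (\<lambda>n. min (cmod (R n \<omega>)) c) \<longlonglongrightarrow> 0"
      using lim
    proof eventually_elim
      case (elim \<omega>)
      have "(\<lambda>n. min (cmod (R n \<omega>)) c) \<longlonglongrightarrow> min 0 c"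
        by (intro tendsto_min tendsto_norm_zero[OF elim] tendsto_const)
      then show ?case using c by simp
    qed
  qed (use c in auto)
  have "eventually (\<lambda>n. expectation (\<lambda>\<omega>. min (cmod (R n \<omega>)) c) < r / 2) sequentially"
    using order_tendstoD(2)[OF lim1, of "r / 2"] r by simp
  then obtain N where N: "\<And>n. n \<ge> N \<Longrightarrow> expectation (\<lambda>\<omega>. min (cmod (R n \<omega>)) c) < r / 2"
    unfolding eventually_sequentially by blast
  show "\<exists>no. \<forall>n\<ge>no. norm (expectation (R n) - 0) < r"
  proof (intro exI allI impI)
    fix n assume n: "n \<ge> N"
    have "norm (expectation (R n)) \<le> expectation (\<lambda>\<omega>. cmod (R n \<omega>))" by (rule integral_norm_bound)
    also have "\<dots> \<le> expectation (\<lambda>\<omega>. min (cmod (R n \<omega>)) c + (cmod (R n \<omega>))\<^sup>2 / c)"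
    proof (rule integral_mono)
      show "integrable M (\<lambda>\<omega>. min (cmod (R n \<omega>)) c + (cmod (R n \<omega>))\<^sup>2 / c)"
        using R2 Ri c by (intro Bochner_Integration.integrable_add integrable_min) auto
      show "cmod (R n \<omega>) \<le> min (cmod (R n \<omega>)) c + (cmod (R n \<omega>))\<^sup>2 / c" for \<omega>
      proof (cases "cmod (R n \<omega>) \<le> c")
        case True
        then show ?thesis using c by simp
      next
        case False
        then have "cmod (R n \<omega>) * c \<le> cmod (R n \<omega>) * cmod (R n \<omega>)" by (intro mult_left_mono) auto
        then have "cmod (R n \<omega>) \<le> (cmod (R n \<omega>))\<^sup>2 / c" using c by (simp add: field_simps power2_eq_square)
        then show ?thesis using False c by simp
      qed
    qed (use Ri in auto)
    also have "\<dots> = expectation (\<lambda>\<omega>. min (cmod (R n \<omega>)) c) + expectation (\<lambda>\<omega>. (cmod (R n \<omega>))\<^sup>2) / c"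
      using R2 Ri by (subst Bochner_Integration.integral_add) auto
    finally have 1: "norm (expectation (R n)) \<le> expectation (\<lambda>\<omega>. min (cmod (R n \<omega>)) c) + expectation (\<lambda>\<omega>. (cmod (R n \<omega>))\<^sup>2) / c" .
    have 2: "expectation (\<lambda>\<omega>. (cmod (R n \<omega>))\<^sup>2) / c \<le> K / c"
      by (rule divide_right_mono[OF K]) (use c in simp)
    have "c * (r / 2) = K + 1" using r by (simp add: c_def)
    then have "K \<le> (r / 2) * c" by (simp add: mult.commute)
    then have "K / c \<le> r / 2" using c by (simp only: pos_divide_le_eq)
    then have "norm (expectation (R n)) < r" using 1 2 N[OF n] by linarith
    then show "norm (expectation (R n) - 0) < r" by simp
  qed
qed

section \<open>The Gaussian weight and its Mills ratio\<close>

locale OU_coefficients =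
  fixes \<alpha> \<gamma> \<sigma> :: real
  assumes \<gamma>_pos: "\<gamma> > 0" and \<sigma>_pos: "\<sigma> > 0"
begin

abbreviation w :: "real \<Rightarrow> real" where "w \<equiv> Wsc \<alpha> \<gamma> \<sigma>"

lemma w_pos [simp]: "w v > 0" "w v \<noteq> 0"
  by (simp_all add: Wsc_def)

lemma w_0 [simp]: "w 0 = 1"
  by (simp add: Wsc_def)

text \<open>So \<open>w\<close> is the integrating factor of the generator: G f = \<sigma>^2/2 * (w
  f')' / w. Every Poisson equation below is solved through this form.\<close>

lemma w_deriv: "(w has_real_derivative (2 * (\<alpha> - \<gamma> * v) / \<sigma>\<^sup>2 * w v)) (at v)"
  unfolding Wsc_def[abs_def] using \<sigma>_pos
  by (auto intro!: derivative_eq_intros simp: power2_eq_square field_simps)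

lemma w_cont: "continuous_on A w"
  by (rule continuous_at_imp_continuous_on) (use w_deriv DERIV_isCont in blast)

lemma w_measurable [measurable]: "w \<in> borel_measurable borel"
  by (rule borel_measurable_continuous_onI[OF w_cont])

text \<open>With \<open>gs\<close>, the mean and standard deviation of the stationary law of the
  unreflected process; \<open>pY\<close> is that normal density restricted to y >= 0 and
  renormalised.\<close>

definition gm where "gm = \<alpha> / \<gamma>"
definition gs where "gs = \<sigma> / sqrt (2 * \<gamma>)"

lemma gs_pos: "gs > 0" using \<gamma>_pos \<sigma>_pos by (simp add: gs_def)

lemma gs_sq: "gs\<^sup>2 = \<sigma>\<^sup>2 / (2 * \<gamma>)"
  using \<gamma>_pos by (simp add: gs_def power_divide)

lemma gm_over_gs: "gm / gs = \<alpha> / sqrt (\<sigma>\<^sup>2 * \<gamma> / 2)"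
proof -
  have "sqrt (\<sigma>\<^sup>2 * \<gamma> / 2) = \<gamma> * gs"
  proof (rule real_sqrt_unique)
    show "(\<gamma> * gs)\<^sup>2 = \<sigma>\<^sup>2 * \<gamma> / 2"
      unfolding power_mult_distrib gs_sq using \<gamma>_pos by (simp add: power2_eq_square)
  qed (use \<gamma>_pos gs_pos in simp)
  then show ?thesis by (simp add: gm_def)
qed

lemma exp_eq_normal_density:
  "exp (- (\<gamma> / \<sigma>\<^sup>2) * (y - \<alpha> / \<gamma>)\<^sup>2) = sqrt (pi * \<sigma>\<^sup>2 / \<gamma>) * normal_density gm gs y"
proof -
  have "2 * pi * gs\<^sup>2 = pi * \<sigma>\<^sup>2 / \<gamma>" using \<gamma>_pos by (simp add: gs_sq)
  moreover have "- (y - gm)\<^sup>2 / (2 * gs\<^sup>2) = - (\<gamma> / \<sigma>\<^sup>2) * (y - \<alpha> / \<gamma>)\<^sup>2"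
    using \<gamma>_pos \<sigma>_pos by (simp add: gs_sq gm_def)
  moreover have "sqrt (pi * \<sigma>\<^sup>2 / \<gamma>) > 0" using \<gamma>_pos \<sigma>_pos by simp
  ultimately show ?thesis using \<gamma>_pos \<sigma>_pos by (simp add: normal_density_def)
qed

lemma pY_eq: "pY \<alpha> \<gamma> \<sigma> y = normal_density gm gs y / Phi (gm / gs)"
proof -
  have "1 / (a * S) * (S * n) = n / a" if "S \<noteq> 0" for a S n :: real using that by simp
  moreover have "sqrt (pi * \<sigma>\<^sup>2 / \<gamma>) \<noteq> 0" using \<gamma>_pos \<sigma>_pos by simp
  ultimately show ?thesis unfolding pY_def exp_eq_normal_density gm_over_gs by blast
qed

lemma Phi_eq: "Phi (gm / gs) = (LINT y:{0..}|lborel. normal_density gm gs y)"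
proof -
  have "(LINT y:{0..}|lborel. normal_density gm gs y) = (\<integral>y. indicator {0..} y * normal_density gm gs y \<partial>lborel)"
    by (simp add: set_lebesgue_integral_def)
  \<comment> \<open>The substitution y = gm - gs z reverses orientation and turns the half-line y >=
    0 into z <= gm / gs.\<close>
  also have "\<dots> = \<bar>- gs\<bar> *\<^sub>R (\<integral>z. indicator {0..} (gm + (- gs) * z) * normal_density gm gs (gm + (- gs) * z) \<partial>lborel)"
    by (rule lborel_integral_real_affine) (use gs_pos in simp)
  also have "\<dots> = (\<integral>z. gs * (indicator {0..} (gm + (- gs) * z) * normal_density gm gs (gm + (- gs) * z)) \<partial>lborel)"
    using gs_pos by simp
  also have "\<dots> = (\<integral>z. indicator {..gm / gs} z * std_normal_density z \<partial>lborel)"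
  proof (rule Bochner_Integration.integral_cong[OF refl])
    fix z
    have "indicator {0..} (gm + (- gs) * z) = (indicator {..gm / gs} z :: real)"
      using gs_pos by (auto simp: indicator_def field_simps)
    moreover have "gs * normal_density gm gs (gm + (- gs) * z) = std_normal_density z"
      using gs_pos by (simp add: normal_density_def real_sqrt_mult power_mult_distrib)
    ultimately show "gs * (indicator {0..} (gm + (- gs) * z) * normal_density gm gs (gm + (- gs) * z)) = indicator {..gm / gs} z * std_normal_density z"
      by (metis mult.left_commute)
  qed
  finally show ?thesis by (simp add: Phi_def set_lebesgue_integral_def)
qed

lemma normal_density_integrable: "set_integrable lborel {0..} (normal_density gm gs)"
  unfolding set_integrable_def using gs_pos by (intro integrable_mult_indicator) (auto simp: integrable_normal_density)

lemma Phi_pos: "Phi (gm / gs) > 0"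
proof -
  have "(LINT y:{0..}|lborel. normal_density gm gs y) \<noteq> 0"
  proof
    assume z: "(LINT y:{0..}|lborel. normal_density gm gs y) = 0"
    have "AE y in lborel. indicator {0..} y *\<^sub>R normal_density gm gs y = 0"
      using z integral_nonneg_eq_0_iff_AE[OF normal_density_integrable[unfolded set_integrable_def]]
      by (simp add: set_lebesgue_integral_def)
    \<comment> \<open>A vanishing integral of a strictly positive density would make [0,1] a null
      set.\<close>
    then have "AE y in lborel. y \<notin> {0::real..1}"
      by eventually_elim (use normal_density_pos[OF gs_pos, of gm] in \<open>auto simp: indicator_def less_le split: if_splits\<close>)
    then have "{0::real..1} \<in> null_sets lborel" by (subst AE_iff_null_sets) auto
    then have "emeasure lborel {0::real..1} = 0" by (rule null_setsD1)
    then show False by (simp only: emeasure_lborel_Icc_eq) simp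
  qed
  moreover have "(LINT y:{0..}|lborel. normal_density gm gs y) \<ge> 0"
    unfolding set_lebesgue_integral_def by (intro Bochner_Integration.integral_nonneg) (auto simp: normal_density_nonneg)
  ultimately show ?thesis unfolding Phi_eq by simp
qed

abbreviation p where "p \<equiv> pY \<alpha> \<gamma> \<sigma>"

lemma p_pos: "p y > 0"
  unfolding pY_eq using Phi_pos normal_density_pos[OF gs_pos] by simp

lemma p_integrable: "set_integrable lborel {0..} p"
  unfolding pY_eq[abs_def] using normal_density_integrable by simp

lemma p_integral: "(LINT y:{0..}|lborel. p y) = 1"
proof -
  have "(LINT y:{0..}|lborel. p y) = (LINT y:{0..}|lborel. normal_density gm gs y) / Phi (gm / gs)"
    unfolding pY_eq[abs_def] by simp
  then show ?thesis using Phi_pos unfolding Phi_eq by simp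
qed

text \<open>Completing the square. Integrals against \<open>w\<close> are thus stationary means up
  to the factor \<open>p 0\<close>, so the decay conditions for Poisson solutions become statements
  about the invariant law.\<close>

lemma p_eq_w: "p y = p 0 * w y"
proof -
  have "exp (- (\<gamma> / \<sigma>\<^sup>2) * (y - \<alpha> / \<gamma>)\<^sup>2) = exp (- (\<gamma> / \<sigma>\<^sup>2) * (0 - \<alpha> / \<gamma>)\<^sup>2) * w y"
    unfolding Wsc_def exp_add[symmetric]
    using \<gamma>_pos \<sigma>_pos by (simp add: power2_eq_square field_simps)
  then show ?thesis unfolding pY_def by (simp only: mult.assoc)
qed

lemma w_eq_p: "w y = p y / p 0"
  using p_eq_w[of y] p_pos[of 0] by simp

lemma w_integrable: "set_integrable lborel {0..} w"
  unfolding w_eq_p[abs_def] using p_integrable by simp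

lemma w_integral: "(LINT y:{0..}|lborel. w y) = 1 / p 0"
  unfolding w_eq_p[abs_def] using p_integral by simp

lemma w_mult_integrable:
  assumes "g \<in> borel_measurable borel" "\<And>y. y \<ge> 0 \<Longrightarrow> \<bar>g y\<bar> \<le> C" "A \<subseteq> {0..}" "A \<in> sets borel"
  shows "set_integrable lborel A (\<lambda>y. w y * g y)"
proof (rule set_integrable_bound[where f = "\<lambda>y. C * w y"])
  show "set_integrable lborel A (\<lambda>y. C * w y)"
    using set_integrable_subset[OF w_integrable _ assms(3)] assms(4) by simp
  show "set_borel_measurable lborel A (\<lambda>y. w y * g y)"
    unfolding set_borel_measurable_def using assms by measurable
  show "AE y in lborel. y \<in> A \<longrightarrow> norm (w y * g y) \<le> norm (C * w y)"
  proof (intro AE_I2 impI)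
    fix y assume "y \<in> A"
    then have "\<bar>g y\<bar> \<le> C" using assms by auto
    then have "w y * \<bar>g y\<bar> \<le> w y * \<bar>C\<bar>" by (intro mult_left_mono) (auto simp: less_imp_le)
    then show "norm (w y * g y) \<le> norm (C * w y)" using w_pos(1)[of y] by (simp add: abs_mult mult.commute)
  qed
qed

section \<open>Tail of the Gaussian weight\<close>

definition tail where "tail y = (LINT v:{y..}|lborel. w v)"

lemma tail_nonneg: "0 \<le> tail y"
  unfolding tail_def set_lebesgue_integral_def by (intro Bochner_Integration.integral_nonneg) (auto simp: less_imp_le)

lemma w_tendsto_0: "(w \<longlongrightarrow> 0) at_top"
proof -
  have "filterlim (\<lambda>v. v * (\<gamma> / \<sigma>\<^sup>2 * v - 2 * \<alpha> / \<sigma>\<^sup>2)) at_top at_top"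
  proof (rule filterlim_at_top_mult_at_top[OF filterlim_ident])
    have "filterlim (\<lambda>v. \<gamma> / \<sigma>\<^sup>2 * v) at_top at_top"
      by (rule filterlim_tendsto_pos_mult_at_top[OF tendsto_const _ filterlim_ident]) (use \<gamma>_pos \<sigma>_pos in simp)
    from filterlim_tendsto_add_at_top[OF tendsto_const[of "- (2 * \<alpha> / \<sigma>\<^sup>2)"] this]
    show "filterlim (\<lambda>v. \<gamma> / \<sigma>\<^sup>2 * v - 2 * \<alpha> / \<sigma>\<^sup>2) at_top at_top" by (simp add: algebra_simps)
  qed
  then have "((\<lambda>v. exp (- (v * (\<gamma> / \<sigma>\<^sup>2 * v - 2 * \<alpha> / \<sigma>\<^sup>2)))) \<longlongrightarrow> 0) at_top"
    by (intro filterlim_compose[OF exp_at_bot]) (simp add: filterlim_uminus_at_bot)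
  then show ?thesis
    by (rule Lim_transform_eventually) (simp add: Wsc_def power2_eq_square algebra_simps)
qed

text \<open>The Mills ratio of the Gaussian weight decays like \<open>1/y\<close>: far out, \<open>w\<close> is bounded by a
  multiple of \<open>- w' / y\<close>.\<close>

lemma mills_ratio_far:
  assumes y: "y \<ge> 2 * \<bar>\<alpha>\<bar> / \<gamma> + 1"
  shows "y * tail y \<le> \<sigma>\<^sup>2 / \<gamma> * w y"
proof -
  have y1: "y \<ge> 1" using y \<gamma>_pos by (smt (verit) divide_nonneg_pos abs_ge_zero)
  \<comment> \<open>The threshold on \<open>y\<close> gives 2 |\<alpha>| <= \<gamma> y; its summand
    1 keeps \<open>y\<close> away from 0.\<close>
  have lb: "\<gamma> * y / 2 \<le> \<gamma> * v - \<alpha>" if "v \<ge> y" for v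
  proof -
    have "2 * \<bar>\<alpha>\<bar> / \<gamma> \<le> y" using y by simp
    then have "2 * \<bar>\<alpha>\<bar> \<le> \<gamma> * y" using \<gamma>_pos by (simp add: pos_divide_le_eq mult.commute)
    moreover have "\<gamma> * y \<le> \<gamma> * v" using that \<gamma>_pos by simp
    ultimately show ?thesis by linarith
  qed
  have n: "0 \<le> \<gamma> * v - \<alpha>" if "v \<ge> y" for v
    using lb[OF that] y1 \<gamma>_pos mult_nonneg_nonneg[of \<gamma> y] by linarith
  let ?f = "\<lambda>v. 2 * (\<gamma> * v - \<alpha>) / \<sigma>\<^sup>2 * w v"
  \<comment> \<open>\<open>?f\<close> is the derivative of \<open>- w\<close> and is nonnegative on
    this range; as \<open>w\<close> vanishes at infinity, the integral is exactly
    \<open>w y\<close>.\<close>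
  have FTC: "(\<integral>\<^sup>+v. ennreal (?f v) * indicator {y..} v \<partial>lborel) = 0 - (- w y)"
  proof (rule nn_integral_FTC_atLeast)
    show "((\<lambda>v. - w v) has_real_derivative ?f v) (at v)" for v
      using DERIV_minus[OF w_deriv[of v]] by (simp add: minus_mult_left minus_divide_left)
    show "((\<lambda>v. - w v) \<longlongrightarrow> 0) at_top" using tendsto_minus[OF w_tendsto_0] by simp
    show "0 \<le> ?f v" if "y \<le> v" for v using n[OF that] by (simp add: less_imp_le)
  qed measurable
  have ti: "set_integrable lborel {y..} w"
    by (rule set_integrable_subset[OF w_integrable]) (use y1 in auto)
  have "ennreal (\<gamma> * y / \<sigma>\<^sup>2 * tail y) = (\<integral>\<^sup>+v. ennreal (\<gamma> * y / \<sigma>\<^sup>2 * (indicator {y..} v *\<^sub>R w v)) \<partial>lborel)"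
    unfolding tail_def set_lebesgue_integral_def
    by (subst integral_mult_right_zero[symmetric], subst nn_integral_eq_integral)
       (use ti y1 \<gamma>_pos in \<open>auto simp: set_integrable_def less_imp_le\<close>)
  also have "\<dots> \<le> (\<integral>\<^sup>+v. ennreal (?f v) * indicator {y..} v \<partial>lborel)"
  proof (rule nn_integral_mono)
    fix v
    show "ennreal (\<gamma> * y / \<sigma>\<^sup>2 * (indicator {y..} v *\<^sub>R w v)) \<le> ennreal (?f v) * indicator {y..} v"
    proof (cases "v \<ge> y")
      case True
      have "\<gamma> * y / \<sigma>\<^sup>2 \<le> 2 * (\<gamma> * v - \<alpha>) / \<sigma>\<^sup>2" using lb[OF True] by (intro divide_right_mono) auto
      then have "\<gamma> * y / \<sigma>\<^sup>2 * w v \<le> ?f v" by (intro mult_right_mono) (auto simp: less_imp_le)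
      then show ?thesis using True by (simp add: ennreal_leI)
    qed simp
  qed
  also have "\<dots> = ennreal (w y)" using FTC by simp
  finally have "\<gamma> * y / \<sigma>\<^sup>2 * tail y \<le> w y" by (simp add: ennreal_le_iff less_imp_le)
  then show ?thesis using \<gamma>_pos \<sigma>_pos by (simp add: field_simps)
qed

text \<open>On a compact interval continuity and the total mass 1 / \<open>p 0\<close> suffice;
  beyond it 1 + y <= 2 y reduces to the far estimate. The factor 1 + y is what later offsets the
  linear growth of the drift.\<close>

lemma mills_ratio_bound: "\<exists>B>0. \<forall>y\<ge>0. (1 + y) * tail y / w y \<le> B"
proof -
  define y1 where "y1 = 2 * \<bar>\<alpha>\<bar> / \<gamma> + 1"
  have y1: "y1 \<ge> 1" using \<gamma>_pos by (simp add: y1_def)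
  have "continuous_on {0..y1} (\<lambda>y. (1 + y) / w y)" by (intro continuous_intros w_cont) auto
  then have "bounded ((\<lambda>y. (1 + y) / w y) ` {0..y1})" by (intro compact_imp_bounded compact_continuous_image) auto
  then obtain B1 where B1: "\<And>y. y \<in> {0..y1} \<Longrightarrow> (1 + y) / w y \<le> B1"
    unfolding bounded_real by (meson abs_le_D1 imageI)
  define B where "B = max (B1 * (1 / p 0)) (2 * \<sigma>\<^sup>2 / \<gamma>) + 1"
  have B0: "2 * \<sigma>\<^sup>2 / \<gamma> > 0" using \<gamma>_pos \<sigma>_pos by simp
  have Ble: "B1 * (1 / p 0) \<le> B" "2 * \<sigma>\<^sup>2 / \<gamma> \<le> B" unfolding B_def by linarith+
  have "(1 + y) * tail y / w y \<le> B" if y: "y \<ge> 0" for y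
  proof (cases "y \<le> y1")
    case True
    have "tail y \<le> 1 / p 0"
      unfolding tail_def w_integral[symmetric] set_lebesgue_integral_def
    proof (rule integral_mono)
      show "integrable lborel (\<lambda>v. indicator {y..} v *\<^sub>R w v)"
        using set_integrable_subset[OF w_integrable, of "{y..}"] y by (simp add: set_integrable_def)
      show "integrable lborel (\<lambda>v. indicator {0..} v *\<^sub>R w v)" using w_integrable by (simp add: set_integrable_def)
    qed (use y in \<open>auto simp: indicator_def less_imp_le\<close>)
    then have "(1 + y) / w y * tail y \<le> B1 * (1 / p 0)"
      using B1[of y] True y tail_nonneg[of y] w_pos(1)[of y] order_trans[OF _ B1[of 0]] y1 by (intro mult_mono) auto
    then show ?thesis using Ble by simp
  next
    case False
    then have far: "y * tail y \<le> \<sigma>\<^sup>2 / \<gamma> * w y" by (intro mills_ratio_far) (simp add: y1_def)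
    have "(1 + y) * tail y \<le> 2 * y * tail y" using False y1 tail_nonneg by (intro mult_right_mono) auto
    also have "\<dots> \<le> 2 * \<sigma>\<^sup>2 / \<gamma> * w y" using far by simp
    finally have "(1 + y) * tail y / w y \<le> 2 * \<sigma>\<^sup>2 / \<gamma>" by (simp only: pos_divide_le_eq w_pos)
    then show ?thesis using Ble by simp
  qed
  moreover have "B > 0" using B0 Ble by linarith
  ultimately show ?thesis by blast
qed

end

section \<open>Poisson equations\<close>

text \<open>The oriented integral also covers negative \<open>x\<close>, so the derivative is
  two-sided at every real, 0 included, as the Taylor lemma demands.\<close>

lemma LBINT_has_real_derivative:
  fixes f :: "real \<Rightarrow> real"
  assumes "continuous_on UNIV f"
  shows "((\<lambda>x. LBINT y=0..ereal x. f y) has_real_derivative f x) (at x)"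
proof -
  have "((\<lambda>x. LBINT y=ereal 0..ereal x. f y) has_vector_derivative f x) (at x within {- (\<bar>x\<bar> + 1)..\<bar>x\<bar> + 1})"
    by (rule interval_integral_FTC2) (use assms in \<open>auto intro: continuous_on_subset\<close>)
  moreover have "at x within {- (\<bar>x\<bar> + 1)..\<bar>x\<bar> + 1} = at x"
    by (rule at_within_Icc_at) auto
  ultimately show ?thesis by (simp add: has_real_derivative_iff_has_vector_derivative zero_ereal_def)
qed

context OU_coefficients
begin

text \<open>The equation G f = g integrated once with the factor \<open>w\<close>: w f' = c +
  2/\<sigma>^2 * \<integral> w g, where c = f'(0). In \<open>sol''\<close> the second derivative is
  read off the equation, which makes \<open>poisson_equation\<close> a matter of algebra.\<close>

definition sol' :: "real \<Rightarrow> (real \<Rightarrow> real) \<Rightarrow> real \<Rightarrow> real" where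
  "sol' c g y = (1 / w y) * (c + 2 / \<sigma>\<^sup>2 * (LBINT v=0..y. w v * g v))"

definition sol'' :: "real \<Rightarrow> (real \<Rightarrow> real) \<Rightarrow> real \<Rightarrow> real" where
  "sol'' c g y = 2 / \<sigma>\<^sup>2 * (g y - (\<alpha> - \<gamma> * y) * sol' c g y)"

definition sol :: "real \<Rightarrow> (real \<Rightarrow> real) \<Rightarrow> real \<Rightarrow> real" where
  "sol c g y = (LBINT u=0..y. sol' c g u)"

lemma sol'_deriv:
  assumes g: "continuous_on UNIV g"
  shows "(sol' c g has_real_derivative sol'' c g y) (at y)"
proof -
  have cwg: "continuous_on UNIV (\<lambda>v. w v * g v)" by (intro continuous_intros w_cont g)
  let ?N = "\<lambda>y. c + 2 / \<sigma>\<^sup>2 * (LBINT v=0..ereal y. w v * g v)"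
  have N: "(?N has_real_derivative 2 / \<sigma>\<^sup>2 * (w y * g y)) (at y)"
    using DERIV_add[OF DERIV_const[of c] DERIV_cmult[OF LBINT_has_real_derivative[OF cwg], of "2 / \<sigma>\<^sup>2"]] by simp
  have "((\<lambda>y. ?N y / w y) has_real_derivative
      (2 / \<sigma>\<^sup>2 * (w y * g y) * w y - ?N y * (2 * (\<alpha> - \<gamma> * y) / \<sigma>\<^sup>2 * w y)) / (w y * w y)) (at y)"
    by (rule DERIV_divide[OF N w_deriv]) simp
  moreover have "(2 / \<sigma>\<^sup>2 * (w y * g y) * w y - N * (2 * (\<alpha> - \<gamma> * y) / \<sigma>\<^sup>2 * w y)) / (w y * w y)
      = 2 / \<sigma>\<^sup>2 * (g y - (\<alpha> - \<gamma> * y) * ((1 / w y) * N))" for N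
  proof -
    have "w y \<noteq> 0" by simp
    then show ?thesis using \<sigma>_pos by (simp add: divide_simps) (simp add: algebra_simps)
  qed
  moreover have "(\<lambda>y. ?N y / w y) = sol' c g" by (simp add: fun_eq_iff sol'_def)
  ultimately show ?thesis unfolding sol''_def sol'_def by simp
qed

lemma sol'_cont: "continuous_on UNIV g \<Longrightarrow> continuous_on UNIV (sol' c g)"
  by (rule continuous_at_imp_continuous_on) (use sol'_deriv DERIV_isCont in blast)

lemma sol''_cont: "continuous_on UNIV g \<Longrightarrow> continuous_on UNIV (sol'' c g)"
  unfolding sol''_def[abs_def] by (intro continuous_intros sol'_cont)

lemma sol_deriv: "continuous_on UNIV g \<Longrightarrow> (sol c g has_real_derivative sol' c g y) (at y)"
  unfolding sol_def[abs_def] by (rule LBINT_has_real_derivative[OF sol'_cont])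

lemma sol_0 [simp]: "sol c g 0 = 0" "sol' c g 0 = c"
  by (simp_all add: sol_def sol'_def zero_ereal_def[symmetric])

lemma poisson_equation: "\<sigma>\<^sup>2 / 2 * sol'' c g y + (\<alpha> - \<gamma> * y) * sol' c g y = g y"
proof -
  have "\<sigma>\<^sup>2 / 2 * (2 / \<sigma>\<^sup>2 * X) = X" for X using \<sigma>_pos by simp
  then have "\<sigma>\<^sup>2 / 2 * sol'' c g y = g y - (\<alpha> - \<gamma> * y) * sol' c g y" unfolding sol''_def .
  then show ?thesis by (simp only: diff_add_cancel)
qed

text \<open>This choice of \<open>c\<close> turns the bracket in the definition of \<open>sol'\<close> into a tail integral.\<close>

lemma sol'_decay:
  assumes g: "continuous_on UNIV g" and C: "\<And>y. y \<ge> 0 \<Longrightarrow> \<bar>g y\<bar> \<le> C"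
    and c: "c = - (2 / \<sigma>\<^sup>2) * (LINT v:{0..}|lborel. w v * g v)"
  obtains B where "B > 0" "\<And>y. y \<ge> 0 \<Longrightarrow> \<bar>sol' c g y\<bar> * (1 + y) \<le> B"
proof -
  have C0: "0 \<le> C" using order_trans[OF abs_ge_zero C[of 0]] by simp
  have [measurable]: "g \<in> borel_measurable borel" by (rule borel_measurable_continuous_onI[OF g])
  obtain B where B: "B > 0" "\<And>y. y \<ge> 0 \<Longrightarrow> (1 + y) * tail y / w y \<le> B" using mills_ratio_bound by blast
  have "\<bar>sol' c g y\<bar> * (1 + y) \<le> 2 * C / \<sigma>\<^sup>2 * B" if y: "y \<ge> 0" for y
  proof -
    let ?wg = "\<lambda>v. w v * g v"
    have i1: "set_integrable lborel {0..y} ?wg" by (rule w_mult_integrable[where C = C]) (use C y in auto)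
    have i2: "set_integrable lborel {y<..} ?wg" by (rule w_mult_integrable[where C = C]) (use C y in auto)
    have un: "{0..y} \<union> {y<..} = {0..}" using y by auto
    have "(LINT v:{0..}|lborel. ?wg v) = (LINT v:{0..y}|lborel. ?wg v) + (LINT v:{y<..}|lborel. ?wg v)"
    proof -
      have "{0..y} \<inter> {y<..} = {}" by auto
      from set_integral_Un[OF this i1 i2] show ?thesis unfolding un .
    qed
    moreover have "(LBINT v=0..y. ?wg v) = (LINT v:{0..y}|lborel. ?wg v)"
      using interval_integral_Icc[OF y, of ?wg] by (simp add: zero_ereal_def)
    ultimately have N: "sol' c g y = - (2 / \<sigma>\<^sup>2) * (LINT v:{y<..}|lborel. ?wg v) / w y"
      unfolding sol'_def c by (simp add: algebra_simps)
    have i3: "integrable lborel (\<lambda>v. C * (indicator {y..} v *\<^sub>R w v))"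
      using set_integrable_subset[OF w_integrable, of "{y..}"] y by (simp add: set_integrable_def)
    have "\<bar>LINT v:{y<..}|lborel. ?wg v\<bar> \<le> (\<integral>v. norm (indicator {y<..} v *\<^sub>R ?wg v) \<partial>lborel)"
      unfolding set_lebesgue_integral_def using integral_norm_bound[of lborel "\<lambda>v. indicator {y<..} v *\<^sub>R ?wg v"] by simp
    also have "\<dots> \<le> (\<integral>v. C * (indicator {y..} v *\<^sub>R w v) \<partial>lborel)"
    proof (rule integral_mono[OF _ i3])
      show "integrable lborel (\<lambda>v. norm (indicator {y<..} v *\<^sub>R ?wg v))" using i2 by (simp add: set_integrable_def integrable_norm)
      show "norm (indicator {y<..} v *\<^sub>R ?wg v) \<le> C * (indicator {y..} v *\<^sub>R w v)" for v
      proof (cases "v > y")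
        case True
        then have "\<bar>g v\<bar> * w v \<le> C * w v" using C[of v] y by (intro mult_right_mono) (auto simp: less_imp_le)
        then show ?thesis using True abs_of_pos[OF w_pos(1)[of v]] by (simp add: abs_mult mult.commute)
      qed (use C0 in \<open>auto simp: indicator_def less_imp_le\<close>)
    qed
    also have "\<dots> = C * tail y" by (simp add: tail_def set_lebesgue_integral_def)
    finally have I: "\<bar>LINT v:{y<..}|lborel. ?wg v\<bar> \<le> C * tail y" .
    have "\<bar>sol' c g y\<bar> * (1 + y) = 2 / \<sigma>\<^sup>2 * \<bar>LINT v:{y<..}|lborel. ?wg v\<bar> * ((1 + y) / w y)"
      unfolding N using less_imp_le[OF w_pos(1)[of y]] by (simp add: abs_mult)
    also have "\<dots> \<le> 2 / \<sigma>\<^sup>2 * (C * tail y) * ((1 + y) / w y)"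
      using I y less_imp_le[OF w_pos(1)[of y]] by (intro mult_right_mono mult_left_mono) auto
    also have "\<dots> = 2 * C / \<sigma>\<^sup>2 * ((1 + y) * tail y / w y)" by simp
    also have "\<dots> \<le> 2 * C / \<sigma>\<^sup>2 * B" using B(2)[OF y] C0 by (intro mult_left_mono) auto
    finally show ?thesis .
  qed
  \<comment> \<open>The summand 1 keeps the constant positive when \<open>C\<close> = 0.\<close>
  moreover have "2 * C / \<sigma>\<^sup>2 * B + 1 > 0"
    using C0 B(1) by (simp add: add_nonneg_pos)
  ultimately show thesis by (intro that[of "2 * C / \<sigma>\<^sup>2 * B + 1"]) fastforce+
qed

text \<open>Integrates the decay B / (1 + z). The logarithm matters for \<open>h\<close>: with only
  E Y = O(sqrt T) at hand, a linear bound would leave h(Y) / sqrt T merely bounded in mean.\<close>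

lemma sol_log_growth:
  assumes g: "continuous_on UNIV g" and B: "\<And>y. y \<ge> 0 \<Longrightarrow> \<bar>sol' c g y\<bar> * (1 + y) \<le> B" and y: "y \<ge> 0"
  shows "\<bar>sol c g y\<bar> \<le> B * ln (1 + y)"
proof (cases "y = 0")
  case False
  then have y: "0 < y" using y by simp
  have "norm (sol c g y - sol c g 0) \<le> B * ln (1 + y) - B * ln (1 + 0)"
  proof (rule differentiable_bound_general[OF y])
    show "continuous_on {0..y} (sol c g)"
      by (rule continuous_at_imp_continuous_on) (use sol_deriv[OF g] DERIV_isCont in blast)
    show "continuous_on {0..y} (\<lambda>y. B * ln (1 + y))" by (intro continuous_intros) auto
    fix z assume z: "0 < z" "z < y"
    show "(sol c g has_vector_derivative sol' c g z) (at z)"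
      using sol_deriv[OF g] by (simp add: has_real_derivative_iff_has_vector_derivative)
    show "((\<lambda>y. B * ln (1 + y)) has_vector_derivative B / (1 + z)) (at z)"
      unfolding has_real_derivative_iff_has_vector_derivative[symmetric]
      using z by (auto intro!: derivative_eq_intros)
    show "norm (sol' c g z) \<le> B / (1 + z)" using B[of z] z by (simp add: pos_le_divide_eq)
  qed
  then show ?thesis by simp
qed simp

section \<open>The first corrector and the asymptotic variance\<close>

abbreviation q where "q \<equiv> qL \<alpha> \<gamma> \<sigma>"
abbreviation h where "h \<equiv> hfun \<alpha> \<gamma> \<sigma>"
abbreviation h' where "h' \<equiv> sol' 1 (\<lambda>_. - q)"
abbreviation h'' where "h'' \<equiv> sol'' 1 (\<lambda>_. - q)"
abbreviation \<tau>2 where "\<tau>2 \<equiv> tau2 \<alpha> \<gamma> \<sigma>"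

lemma h_eq: "h = sol 1 (\<lambda>_. - q)"
proof -
  have "(LBINT v=0..ereal u. w v * - q) = - (q * (LBINT v=0..ereal u. w v))" for u
    using interval_lebesgue_integral_mult_left[of lborel 0 "ereal u" w "- q"]
    by (simp add: mult.commute)
  then have "(1 / w u) * (1 - 2 * q / \<sigma>\<^sup>2 * (LBINT v=0..ereal u. w v)) = h' u" for u
    unfolding sol'_def by simp
  then show ?thesis by (simp add: fun_eq_iff hfun_def sol_def)
qed

lemma h_deriv: "(h has_real_derivative h' y) (at y)"
  unfolding h_eq by (rule sol_deriv) simp

lemma deriv_h: "deriv h = h'"
  using h_deriv DERIV_imp_deriv by blast

text \<open>The origin of q: as \<open>w\<close> has integral 1 / \<open>p 0\<close>, the slope 1 at
  0 meets the condition of \<open>sol'_decay\<close> exactly when q = \<sigma>^2/2 * p(0).\<close>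

lemma h_centred: "1 = - (2 / \<sigma>\<^sup>2) * (LINT v:{0..}|lborel. w v * (- q))"
proof -
  have "(LINT v:{0..}|lborel. w v * (- q)) = (1 / p 0) * (- q)"
    by (subst set_integral_mult_left) (simp only: w_integral)
  then show ?thesis using \<sigma>_pos p_pos[of 0] by (simp add: qL_def)
qed

lemma h'_decay: obtains B where "B > 0" "\<And>y. y \<ge> 0 \<Longrightarrow> \<bar>h' y\<bar> * (1 + y) \<le> B"
  by (rule sol'_decay[OF _ _ h_centred, where C = "\<bar>q\<bar>"]) auto

lemma h'_cont: "continuous_on A h'"
  using sol'_cont[of "\<lambda>_. - q" 1] continuous_on_subset by auto

lemma h'_measurable [measurable]: "h' \<in> borel_measurable borel"
  by (rule borel_measurable_continuous_onI[OF h'_cont])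

lemma h'_sq_bounded: obtains B where "\<And>y. y \<ge> 0 \<Longrightarrow> (h' y)\<^sup>2 \<le> B"
proof -
  obtain B where B: "B > 0" "\<And>y. y \<ge> 0 \<Longrightarrow> \<bar>h' y\<bar> * (1 + y) \<le> B" using h'_decay by blast
  have "(h' y)\<^sup>2 \<le> B\<^sup>2" if "y \<ge> 0" for y
  proof -
    have "\<bar>h' y\<bar> * 1 \<le> \<bar>h' y\<bar> * (1 + y)" using that by (intro mult_left_mono) auto
    then have "\<bar>h' y\<bar> \<le> \<bar>B\<bar>" using B(2)[OF that] by linarith
    then show ?thesis by (simp only: abs_le_square_iff)
  qed
  then show thesis by (rule that)
qed

lemma h'_sq_integrable: "set_integrable lborel {0..} (\<lambda>y. (h' y)\<^sup>2 * p y)"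
proof -
  obtain B where B: "\<And>y. y \<ge> 0 \<Longrightarrow> (h' y)\<^sup>2 \<le> B" using h'_sq_bounded by blast
  have "set_integrable lborel {0..} (\<lambda>y. w y * (h' y)\<^sup>2)"
    by (rule w_mult_integrable[where C = B]) (use B in auto)
  then have "set_integrable lborel {0..} (\<lambda>y. p 0 * (w y * (h' y)\<^sup>2))" by (rule set_integrable_mult_right)
  moreover have "p 0 * (w y * (h' y)\<^sup>2) = (h' y)\<^sup>2 * p y" for y
    unfolding p_eq_w[of y] by simp
  ultimately show ?thesis by (simp only:)
qed

lemma tau2_eq: "\<tau>2 = \<sigma>\<^sup>2 * (LINT y:{0..}|lborel. (h' y)\<^sup>2 * p y)"
  by (simp add: tau2_def deriv_h)

text \<open>Keeps the limiting normal law nondegenerate. Since h'(0) = 1 and \<open>h'\<close> is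
  continuous, \<open>h'\<close> cannot vanish almost everywhere on the half-line.\<close>

lemma tau2_pos: "\<tau>2 > 0"
proof -
  have nn: "0 \<le> indicator {0..} y *\<^sub>R ((h' y)\<^sup>2 * p y)" for y using less_imp_le[OF p_pos[of y]] by simp
  have "(LINT y:{0..}|lborel. (h' y)\<^sup>2 * p y) \<noteq> 0"
  proof
    assume z: "(LINT y:{0..}|lborel. (h' y)\<^sup>2 * p y) = 0"
    have "AE y in lborel. indicator {0..} y *\<^sub>R ((h' y)\<^sup>2 * p y) = 0"
      using z integral_nonneg_eq_0_iff_AE[OF h'_sq_integrable[unfolded set_integrable_def]] nn
      by (simp add: set_lebesgue_integral_def)
    then have ae: "AE y in lborel. y \<ge> 0 \<longrightarrow> h' y = 0"
    proof eventually_elim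
      case (elim y)
      then show ?case using p_pos[of y] by (auto simp: indicator_def)
    qed
    have "isCont h' 0" using h'_cont[of UNIV] by (simp add: continuous_on_eq_continuous_at)
    then have "((\<lambda>y. h' y) \<longlongrightarrow> 1) (at 0)" by (simp add: isCont_def)
    then have "eventually (\<lambda>y. h' y > 0) (at 0)" by (rule order_tendstoD) simp
    then obtain d where d: "d > 0" "\<And>y. y \<noteq> 0 \<Longrightarrow> \<bar>y\<bar> < d \<Longrightarrow> h' y > 0"
      unfolding eventually_at by (auto simp: dist_real_def)
    \<comment> \<open>An interval of positive length inside (0,d), where \<open>h'\<close> is
      positive.\<close>
    have "AE y in lborel. y \<notin> {d/3..d/2}"
      using ae
    proof eventually_elim
      case (elim y)
      show ?case
      proof
        assume "y \<in> {d/3..d/2}"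
        then have "y > 0" "\<bar>y\<bar> < d" using d(1) by auto
        then show False using d(2)[of y] elim by simp
      qed
    qed
    then have "{d/3..d/2} \<in> null_sets lborel" by (subst AE_iff_null_sets) auto
    then have "emeasure lborel {d/3..d/2} = 0" by (rule null_setsD1)
    then show False using d(1) by (simp add: emeasure_lborel_Icc_eq)
  qed
  moreover have "(LINT y:{0..}|lborel. (h' y)\<^sup>2 * p y) \<ge> 0"
    unfolding set_lebesgue_integral_def by (intro Bochner_Integration.integral_nonneg nn)
  ultimately show ?thesis unfolding tau2_eq using \<sigma>_pos by simp
qed

text \<open>Deviation of the bracket rate from its stationary mean, the right-hand side of the
  equation for the second corrector.\<close>

definition g where "g y = \<sigma>\<^sup>2 * (h' y)\<^sup>2 - \<tau>2"

lemma g_cont: "continuous_on A g"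
  unfolding g_def[abs_def] by (intro continuous_intros h'_cont)

text \<open>The origin of \<tau>^2: it is the stationary mean of \<sigma>^2 h'^2, so
  \<open>g\<close> has mean zero under the invariant law and the slope 0 meets the condition of
  \<open>sol'_decay\<close>.\<close>

lemma g_centred: "0 = - (2 / \<sigma>\<^sup>2) * (LINT v:{0..}|lborel. w v * g v)"
proof -
  have i: "set_integrable lborel {0..} (\<lambda>y. \<sigma>\<^sup>2 / p 0 * ((h' y)\<^sup>2 * p y))" "set_integrable lborel {0..} (\<lambda>y. \<tau>2 * w y)"
    using h'_sq_integrable w_integrable by simp_all
  have "w v * g v = \<sigma>\<^sup>2 / p 0 * ((h' v)\<^sup>2 * p v) - \<tau>2 * w v" for v
    unfolding g_def w_eq_p[of v] by (simp add: algebra_simps)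
  then have "(LINT v:{0..}|lborel. w v * g v) = (LINT v:{0..}|lborel. \<sigma>\<^sup>2 / p 0 * ((h' v)\<^sup>2 * p v)) - (LINT v:{0..}|lborel. \<tau>2 * w v)"
    using set_integral_diff(2)[OF i] by (simp only:)
  also have "\<dots> = \<sigma>\<^sup>2 / p 0 * (LINT v:{0..}|lborel. (h' v)\<^sup>2 * p v) - \<tau>2 * (1 / p 0)"
    by (simp only: set_integral_mult_right w_integral)
  also have "\<dots> = 0" unfolding tau2_eq by simp
  finally show ?thesis by simp
qed

abbreviation k where "k \<equiv> sol 0 g"
abbreviation k' where "k' \<equiv> sol' 0 g"
abbreviation k'' where "k'' \<equiv> sol'' 0 g"

lemma g_bounded: obtains C where "\<And>y. y \<ge> 0 \<Longrightarrow> \<bar>g y\<bar> \<le> C"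
proof -
  obtain B where B: "\<And>y. y \<ge> 0 \<Longrightarrow> (h' y)\<^sup>2 \<le> B" using h'_sq_bounded by blast
  have "\<bar>g y\<bar> \<le> \<sigma>\<^sup>2 * B + \<tau>2" if "y \<ge> 0" for y
  proof -
    have "0 \<le> \<sigma>\<^sup>2 * (h' y)\<^sup>2" "\<sigma>\<^sup>2 * (h' y)\<^sup>2 \<le> \<sigma>\<^sup>2 * B" using B[OF that] by (simp_all add: mult_left_mono)
    then show ?thesis using tau2_pos unfolding g_def abs_le_iff by linarith
  qed
  then show thesis by (rule that)
qed

lemma k'_decay: obtains B where "B > 0" "\<And>y. y \<ge> 0 \<Longrightarrow> \<bar>k' y\<bar> * (1 + y) \<le> B"
proof -
  obtain C where C: "\<And>y. y \<ge> 0 \<Longrightarrow> \<bar>g y\<bar> \<le> C" using g_bounded by blast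
  show thesis by (rule sol'_decay[OF g_cont C g_centred]) (auto intro: that)
qed

lemma drift_linear_growth:
  assumes y: "y \<ge> 0"
  shows "\<bar>\<alpha> - \<gamma> * y\<bar> \<le> (\<bar>\<alpha>\<bar> + \<gamma>) * (1 + y)"
proof -
  have "\<bar>\<alpha> - \<gamma> * y\<bar> \<le> \<bar>\<alpha>\<bar> + \<gamma> * y" using \<gamma>_pos y by (intro order_trans[OF abs_triangle_ineq4]) (simp add: abs_mult)
  also have "\<dots> \<le> (\<bar>\<alpha>\<bar> + \<gamma>) * (1 + y)"
  proof -
    have "(\<bar>\<alpha>\<bar> + \<gamma>) * (1 + y) = (\<bar>\<alpha>\<bar> + \<gamma> * y) + (\<gamma> + \<bar>\<alpha>\<bar> * y)" by (simp add: algebra_simps)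
    then show ?thesis using \<gamma>_pos mult_nonneg_nonneg[OF abs_ge_zero y, of \<alpha>] by linarith
  qed
  finally show ?thesis .
qed

text \<open>In the Poisson equation the drift grows linearly while the first derivative decays like
  1 / (1 + y), so their product stays bounded.\<close>

lemma sol''_bounded:
  assumes B: "\<And>y. y \<ge> 0 \<Longrightarrow> \<bar>sol' c f y\<bar> * (1 + y) \<le> B" and C: "\<And>y. y \<ge> 0 \<Longrightarrow> \<bar>f y\<bar> \<le> C" and y: "y \<ge> 0"
  shows "\<bar>sol'' c f y\<bar> \<le> 2 / \<sigma>\<^sup>2 * (C + (\<bar>\<alpha>\<bar> + \<gamma>) * B)"
proof -
  from drift_linear_growth[OF y] have "\<bar>\<alpha> - \<gamma> * y\<bar> * \<bar>sol' c f y\<bar> \<le> (\<bar>\<alpha>\<bar> + \<gamma>) * (1 + y) * \<bar>sol' c f y\<bar>" by (rule mult_right_mono) simp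
  also have "\<dots> = (\<bar>\<alpha>\<bar> + \<gamma>) * (\<bar>sol' c f y\<bar> * (1 + y))" by simp
  also have "\<dots> \<le> (\<bar>\<alpha>\<bar> + \<gamma>) * B" using B[OF y] \<gamma>_pos by (intro mult_left_mono) auto
  finally have "\<bar>f y - (\<alpha> - \<gamma> * y) * sol' c f y\<bar> \<le> C + (\<bar>\<alpha>\<bar> + \<gamma>) * B"
    using C[OF y] abs_triangle_ineq4[of "f y" "(\<alpha> - \<gamma> * y) * sol' c f y"] by (simp add: abs_mult)
  then have "2 / \<sigma>\<^sup>2 * \<bar>f y - (\<alpha> - \<gamma> * y) * sol' c f y\<bar> \<le> 2 / \<sigma>\<^sup>2 * (C + (\<bar>\<alpha>\<bar> + \<gamma>) * B)"
    by (intro mult_left_mono) auto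
  moreover have "\<bar>2 / \<sigma>\<^sup>2\<bar> = 2 / \<sigma>\<^sup>2" by simp
  ultimately show ?thesis unfolding sol''_def abs_mult by metis
qed



text \<open>One constant for all later estimates. A linear bound is enough for \<open>k\<close>,
  which is multiplied by u^2, whereas \<open>h\<close> carries only one factor u and keeps its
  logarithm.\<close>

lemma coefficient_bounds:
  obtains B where "B \<ge> 1"
    "\<And>y. y \<ge> 0 \<Longrightarrow> \<bar>h' y\<bar> * (1 + y) \<le> B" "\<And>y. y \<ge> 0 \<Longrightarrow> \<bar>k' y\<bar> * (1 + y) \<le> B"
    "\<And>y. y \<ge> 0 \<Longrightarrow> \<bar>h' y\<bar> \<le> B" "\<And>y. y \<ge> 0 \<Longrightarrow> \<bar>k' y\<bar> \<le> B"
    "\<And>y. y \<ge> 0 \<Longrightarrow> \<bar>h'' y\<bar> \<le> B" "\<And>y. y \<ge> 0 \<Longrightarrow> \<bar>k'' y\<bar> \<le> B"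
    "\<And>y. y \<ge> 0 \<Longrightarrow> \<bar>h y\<bar> \<le> B * ln (1 + y)" "\<And>y. y \<ge> 0 \<Longrightarrow> \<bar>k y\<bar> \<le> B * y"
proof -
  obtain B1 where B1: "B1 > 0" "\<And>y. y \<ge> 0 \<Longrightarrow> \<bar>h' y\<bar> * (1 + y) \<le> B1" using h'_decay by blast
  obtain B2 where B2: "B2 > 0" "\<And>y. y \<ge> 0 \<Longrightarrow> \<bar>k' y\<bar> * (1 + y) \<le> B2" using k'_decay by blast
  obtain C where C: "\<And>y. y \<ge> 0 \<Longrightarrow> \<bar>g y\<bar> \<le> C" using g_bounded by blast
  define B3 where "B3 = 2 / \<sigma>\<^sup>2 * (\<bar>q\<bar> + (\<bar>\<alpha>\<bar> + \<gamma>) * B1)"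
  define B4 where "B4 = 2 / \<sigma>\<^sup>2 * (C + (\<bar>\<alpha>\<bar> + \<gamma>) * B2)"
  have b3: "\<bar>h'' y\<bar> \<le> B3" if "y \<ge> 0" for y
    unfolding B3_def by (rule sol''_bounded[OF B1(2) _ that]) auto
  have b4: "\<bar>k'' y\<bar> \<le> B4" if "y \<ge> 0" for y
    unfolding B4_def by (rule sol''_bounded[OF B2(2) C that])
  have pos: "0 \<le> B3" "0 \<le> B4" using order_trans[OF abs_ge_zero b3[of 0]] order_trans[OF abs_ge_zero b4[of 0]] by simp_all
  define B where "B = 1 + B1 + B2 + B3 + B4"
  have le: "1 \<le> B" "B1 \<le> B" "B2 \<le> B" "B3 \<le> B" "B4 \<le> B" using B1(1) B2(1) pos by (simp_all add: B_def)
  have weaken: "\<bar>z\<bar> \<le> b" if "\<bar>z\<bar> * (1 + y) \<le> b" "y \<ge> 0" for z y b :: real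
  proof -
    have "\<bar>z\<bar> * 1 \<le> \<bar>z\<bar> * (1 + y)" using that(2) by (intro mult_left_mono) auto
    then show ?thesis using that(1) by linarith
  qed
  have ln0: "0 \<le> ln (1 + y)" if "y \<ge> 0" for y :: real using that by simp
  have hl: "\<bar>h y\<bar> \<le> B * ln (1 + y)" if "y \<ge> 0" for y
  proof -
    have "\<bar>h y\<bar> \<le> B1 * ln (1 + y)" unfolding h_eq by (rule sol_log_growth[OF _ B1(2) that]) auto
    also have "\<dots> \<le> B * ln (1 + y)" by (rule mult_right_mono[OF le(2) ln0[OF that]])
    finally show ?thesis .
  qed
  have kl: "\<bar>k y\<bar> \<le> B * y" if "y \<ge> 0" for y
  proof -
    have "\<bar>k y\<bar> \<le> B2 * ln (1 + y)" by (rule sol_log_growth[OF g_cont B2(2) that])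
    also have "\<dots> \<le> B * ln (1 + y)" by (rule mult_right_mono[OF le(3) ln0[OF that]])
    also have "\<dots> \<le> B * y" using le(1) that by (intro mult_left_mono ln_add_one_self_le_self) auto
    finally show ?thesis .
  qed
  show thesis
    by (rule that[OF le(1) order_trans[OF B1(2) le(2)] order_trans[OF B2(2) le(3)]
         order_trans[OF weaken[OF B1(2)] le(2)] order_trans[OF weaken[OF B2(2)] le(3)]
         order_trans[OF b3 le(4)] order_trans[OF b4 le(5)] hl kl])
qed

end

section \<open>Reflected Ornstein--Uhlenbeck processes on dyadic grids\<close>

locale reflected_OU_process =
  fixes M :: "'a measure" and F :: "real \<Rightarrow> 'a measure" and W Y L :: "real \<Rightarrow> 'a \<Rightarrow> real"
    and \<alpha> \<gamma> \<sigma> x :: real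
  assumes brownian: "std_brownian_motion M F W"
    and \<gamma>_pos: "\<gamma> > 0" and \<sigma>_pos: "\<sigma> > 0" and x_nonneg: "x \<ge> 0"
    and reflected: "reflected_OU M F W \<alpha> \<gamma> \<sigma> x Y L"
begin

sublocale OU: OU_coefficients \<alpha> \<gamma> \<sigma>
  by unfold_locales (fact \<gamma>_pos \<sigma>_pos)+

sublocale prob_space M
  using brownian by (simp add: std_brownian_motion_def)

lemma subalg: "subalgebra M (F t)"
  using brownian by (simp add: std_brownian_motion_def)

lemma F_mono: "s \<le> t \<Longrightarrow> sets (F s) \<subseteq> sets (F t)"
  using brownian by (auto simp: std_brownian_motion_def filtration_def)

lemma adapted: "t \<ge> 0 \<Longrightarrow> Y t \<in> borel_measurable (F t)" "t \<ge> 0 \<Longrightarrow> L t \<in> borel_measurable (F t)"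
    "t \<ge> 0 \<Longrightarrow> W t \<in> borel_measurable (F t)"
  using brownian reflected by (auto simp: std_brownian_motion_def reflected_OU_def)

lemma rv [measurable]: "t \<ge> 0 \<Longrightarrow> Y t \<in> borel_measurable M" "t \<ge> 0 \<Longrightarrow> L t \<in> borel_measurable M"
    "t \<ge> 0 \<Longrightarrow> W t \<in> borel_measurable M"
  using adapted measurable_from_subalg[OF subalg] by blast+

lemma increment:
  assumes "0 \<le> s" "s < t"
  shows "distributed M lborel (\<lambda>\<omega>. W t \<omega> - W s \<omega>) (normal_density 0 (sqrt (t - s)))"
    "indep_set (sets (F s)) (preimages M (\<lambda>\<omega>. W t \<omega> - W s \<omega>))"
  using brownian assms unfolding std_brownian_motion_def by blast+

text \<open>The path properties in the shape that \<open>ito_remainder_path\<close> consumes: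
  increments over [s,t], the Henstock-Kurzweil \<open>integral\<close>, and \<open>Y\<close> nonzero
  in place of positive.\<close>

definition good_path :: "'a \<Rightarrow> bool" where
  "good_path \<omega> \<longleftrightarrow> continuous_on {0..} (\<lambda>t. Y t \<omega>) \<and> continuous_on {0..} (\<lambda>t. L t \<omega>) \<and>
    continuous_on {0..} (\<lambda>t. W t \<omega>) \<and> L 0 \<omega> = 0 \<and> Y 0 \<omega> = x \<and>
    (\<forall>s t. 0 \<le> s \<longrightarrow> s \<le> t \<longrightarrow> L s \<omega> \<le> L t \<omega>) \<and> (\<forall>t\<ge>0. Y t \<omega> \<ge> 0) \<and>
    (\<forall>s t. 0 \<le> s \<longrightarrow> s \<le> t \<longrightarrow> Y t \<omega> - Y s \<omega> =
        integral {s..t} (\<lambda>r. \<alpha> - \<gamma> * Y r \<omega>) + \<sigma> * (W t \<omega> - W s \<omega>) + (L t \<omega> - L s \<omega>)) \<and>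
    (\<forall>s t. 0 \<le> s \<longrightarrow> s \<le> t \<longrightarrow> (\<forall>v\<in>{s..t}. Y v \<omega> \<noteq> 0) \<longrightarrow> L s \<omega> = L t \<omega>)"

lemma AE_good_path: "AE \<omega> in M. good_path \<omega>"
proof -
  have W: "AE \<omega> in M. W 0 \<omega> = 0 \<and> continuous_on {0..} (\<lambda>t. W t \<omega>)"
    using brownian by (auto simp: std_brownian_motion_def)
  from W reflected[unfolded reflected_OU_def, THEN conjunct2] show ?thesis
  proof eventually_elim
    case (elim \<omega>)
    then have W: "W 0 \<omega> = 0" "continuous_on {0..} (\<lambda>t. W t \<omega>)"
      and Y: "continuous_on {0..} (\<lambda>t. Y t \<omega>)" and L: "continuous_on {0..} (\<lambda>t. L t \<omega>)" "L 0 \<omega> = 0" "mono_on {0..} (\<lambda>t. L t \<omega>)"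
      and nonneg: "\<And>t. t \<ge> 0 \<Longrightarrow> Y t \<omega> \<ge> 0"
      and eq: "\<And>t. t \<ge> 0 \<Longrightarrow> Y t \<omega> = x + (LBINT s=0..t. \<alpha> - \<gamma> * Y s \<omega>) + \<sigma> * W t \<omega> + L t \<omega>"
      and flat: "\<And>s t. 0 \<le> s \<Longrightarrow> s \<le> t \<Longrightarrow> (\<forall>u\<in>{s..t}. Y u \<omega> > 0) \<Longrightarrow> L s \<omega> = L t \<omega>"
      by auto
    let ?d = "\<lambda>r. \<alpha> - \<gamma> * Y r \<omega>"
    have cd: "continuous_on {s..t} ?d" if "0 \<le> s" for s t
      by (intro continuous_intros continuous_on_subset[OF Y]) (use that in auto)
    have int: "(LBINT s=0..t. ?d s) = integral {0..t} ?d" if "t \<ge> 0" for t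
    proof -
      have "set_integrable lborel {0..t} ?d"
        using borel_integrable_atLeastAtMost'[OF cd[of 0 t]] by simp
      then show ?thesis
        using interval_integral_eq_integral[OF that, of ?d] by (simp add: zero_ereal_def)
    qed
    have Y0: "Y 0 \<omega> = x" using eq[of 0] int[of 0] W L by simp
    have inc: "Y t \<omega> - Y s \<omega> = integral {s..t} ?d + \<sigma> * (W t \<omega> - W s \<omega>) + (L t \<omega> - L s \<omega>)" if "0 \<le> s" "s \<le> t" for s t
    proof -
      have "integral {0..s} ?d + integral {s..t} ?d = integral {0..t} ?d"
        using that by (intro Henstock_Kurzweil_Integration.integral_combine integrable_continuous_interval cd) auto
      then show ?thesis using eq[of s] eq[of t] int[of s] int[of t] that by (simp add: algebra_simps)
    qed
    have flat': "L s \<omega> = L t \<omega>" if "0 \<le> s" "s \<le> t" "\<forall>v\<in>{s..t}. Y v \<omega> \<noteq> 0" for s t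
    proof (rule flat[OF that(1,2)], intro ballI)
      fix u assume u: "u \<in> {s..t}"
      then have "Y u \<omega> \<noteq> 0" "0 \<le> u" using that by auto
      then show "Y u \<omega> > 0" using nonneg[of u] by simp
    qed
    have mono: "L s \<omega> \<le> L t \<omega>" if "0 \<le> s" "s \<le> t" for s t
      using mono_onD[OF L(3), of s t] that by simp
    show "good_path \<omega>"
      unfolding good_path_def
      by (intro conjI allI impI; ((rule W(2) Y L(1,2) Y0) | (rule mono nonneg inc flat'; assumption)))
  qed
qed

text \<open>\<open>L\<close> enters only as a phase, so the modulus is deterministic and exponential
  moments of \<open>L\<close> never arise. A complex \<open>a\<close> absorbs centring and
  normalisation in one parameter.\<close>

definition weight :: "complex \<Rightarrow> real \<Rightarrow> real \<Rightarrow> 'a \<Rightarrow> complex" where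
  "weight a u t \<omega> = exp (a * of_real t + \<i> * of_real u * of_real (L t \<omega>))"

lemma norm_weight: "cmod (weight a u t \<omega>) = exp (Re a * t)"
  by (simp add: weight_def)

lemma weight_adapted: "t \<ge> 0 \<Longrightarrow> weight a u t \<in> borel_measurable (F t)"
  unfolding weight_def[abs_def] using adapted(2)[of t] by measurable

lemma weight_measurable [measurable]: "t \<ge> 0 \<Longrightarrow> weight a u t \<in> borel_measurable M"
  using weight_adapted measurable_from_subalg[OF subalg] by blast

text \<open>Halving the mesh makes the variances of the quadratic variation errors summable in n,
  which yields an almost sure bound without passing to a subsequence.\<close>

definition grid :: "real \<Rightarrow> nat \<Rightarrow> nat \<Rightarrow> real" where
  "grid T n i = T * i / 2 ^ n"

lemma grid_simps [simp]: "grid T n 0 = 0" "grid T n (2 ^ n) = T" "grid T n (Suc i) - grid T n i = T / 2 ^ n"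
  by (simp_all add: grid_def field_simps)

lemma grid_bounds:
  assumes "T > 0"
  shows "0 \<le> grid T n i" "grid T n i < grid T n (Suc i)" "i \<le> 2 ^ n \<Longrightarrow> grid T n i \<le> T"
proof -
  show "0 \<le> grid T n i" "grid T n i < grid T n (Suc i)" using assms by (simp_all add: grid_def divide_strict_right_mono)
  assume "i \<le> 2 ^ n"
  then have "real i \<le> real (2 ^ n)" by (simp only: of_nat_le_iff)
  then have "real i \<le> 2 ^ n" by simp
  then show "grid T n i \<le> T" using assms by (simp add: grid_def divide_le_eq mult_left_mono)
qed

definition dW :: "real \<Rightarrow> nat \<Rightarrow> nat \<Rightarrow> 'a \<Rightarrow> real" where
  "dW T n i \<omega> = W (grid T n (Suc i)) \<omega> - W (grid T n i) \<omega>"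

lemma dW_adapted: "T > 0 \<Longrightarrow> dW T n i \<in> borel_measurable (F (grid T n (Suc i)))"
proof -
  assume T: "T > 0"
  have "W (grid T n i) \<in> borel_measurable (F (grid T n (Suc i)))"
  proof -
    have "sets (F (grid T n i)) \<subseteq> sets (F (grid T n (Suc i)))" using grid_bounds[OF T, of n i] by (intro F_mono) simp
    moreover have "space (F s) = space M" for s using subalg by (simp add: subalgebra_def)
    ultimately show ?thesis using adapted(3)[OF grid_bounds(1)[OF T, of n i]] by (auto simp: measurable_def)
  qed
  moreover have "W (grid T n (Suc i)) \<in> borel_measurable (F (grid T n (Suc i)))"
    using adapted(3) grid_bounds(1)[OF T] by blast
  ultimately show ?thesis unfolding dW_def[abs_def] by measurable
qed

lemma dW_measurable [measurable]: "T > 0 \<Longrightarrow> dW T n i \<in> borel_measurable M"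
  using dW_adapted measurable_from_subalg[OF subalg] by blast

text \<open>The coefficients are known at the left grid points, so both the increments and their
  centred squares form martingale differences. In Dynkin's formula these two sums take the place of
  the stochastic integral, and both have mean zero.\<close>

lemma dW_martingale:
  fixes X :: "nat \<Rightarrow> 'a \<Rightarrow> complex"
  assumes T: "T > 0"
    and X: "\<And>i. X i \<in> borel_measurable (F (grid T n i))"
    and X2: "\<And>i. integrable M (\<lambda>\<omega>. (cmod (X i \<omega>))\<^sup>2)"
  shows "integrable M (\<lambda>\<omega>. (cmod (\<Sum>i<k. X i \<omega> * of_real (dW T n i \<omega>)))\<^sup>2)" (is ?P1)
    "expectation (\<lambda>\<omega>. \<Sum>i<k. X i \<omega> * of_real (dW T n i \<omega>)) = 0" (is ?P2)
    "expectation (\<lambda>\<omega>. (cmod (\<Sum>i<k. X i \<omega> * of_real (dW T n i \<omega>)))\<^sup>2) = T / 2^n * (\<Sum>i<k. expectation (\<lambda>\<omega>. (cmod (X i \<omega>))\<^sup>2))" (is ?P3)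
    "integrable M (\<lambda>\<omega>. (cmod (\<Sum>i<k. X i \<omega> * of_real ((dW T n i \<omega>)\<^sup>2 - T / 2^n)))\<^sup>2)" (is ?P4)
    "expectation (\<lambda>\<omega>. \<Sum>i<k. X i \<omega> * of_real ((dW T n i \<omega>)\<^sup>2 - T / 2^n)) = 0" (is ?P5)
    "expectation (\<lambda>\<omega>. (cmod (\<Sum>i<k. X i \<omega> * of_real ((dW T n i \<omega>)\<^sup>2 - T / 2^n)))\<^sup>2) = 2 * (T / 2^n)\<^sup>2 * (\<Sum>i<k. expectation (\<lambda>\<omega>. (cmod (X i \<omega>))\<^sup>2))" (is ?P6)
proof -
  let ?G = "\<lambda>i. F (grid T n i)"
  have \<delta>: "T / 2^n > 0" using T by simp
  have Gm: "sets (?G i) \<subseteq> sets (?G (Suc i))" for i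
    using grid_bounds[OF T, of n i] by (intro F_mono) simp
  have D: "distributed M lborel (dW T n i) (normal_density 0 (sqrt (T / 2^n)))" for i
    using increment(1)[OF grid_bounds(1,2)[OF T, of n i]] by (simp add: dW_def[abs_def])
  have I: "indep_set (sets (?G i)) (preimages M (dW T n i))" for i
    using increment(2)[OF grid_bounds(1,2)[OF T, of n i]] by (simp add: dW_def[abs_def])
  have I2: "indep_set (sets (?G i)) (preimages M (\<lambda>\<omega>. (dW T n i \<omega>)\<^sup>2 - T / 2^n))" for i
    using indep_set_vimage_compose[OF I, of "\<lambda>z. z\<^sup>2 - T / 2^n" i] by simp
  have A2: "(\<lambda>\<omega>. (dW T n i \<omega>)\<^sup>2 - T / 2^n) \<in> borel_measurable (?G (Suc i))" for i
    using dW_adapted[OF T, of n i] by measurable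
  note m = normal_increment_moments[OF D \<delta>]
  show ?P1 ?P2 ?P3
    by (rule martingale_transform_L2[where G = ?G and \<eta> = "dW T n" and v = "T / 2^n" and X = X];
        rule subalg Gm X dW_adapted[OF T] I X2 m(1) m(2) m(3))+
  show ?P4 ?P5 ?P6
    by (rule martingale_transform_L2[where G = ?G and \<eta> = "\<lambda>i \<omega>. (dW T n i \<omega>)\<^sup>2 - T / 2^n" and v = "2 * (T / 2^n)\<^sup>2" and X = X];
        rule subalg Gm X A2 I2 X2 m(4) m(5) m(6))+
qed

text \<open>With all coefficients equal to 1, the deviation of the sum of squares from T has
  variance 2 T^2 / 2^n, which is summable.\<close>

lemma AE_quadratic_variation_bounded:
  assumes T: "T > 0"
  shows "AE \<omega> in M. \<exists>B. \<forall>n. (\<Sum>i<2^n. (dW T n i \<omega>)\<^sup>2) \<le> B"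
proof -
  define S where "S n \<omega> = (\<Sum>i<2^n. (dW T n i \<omega>)\<^sup>2 - T / 2^n)" for n :: nat and \<omega>
  have S: "S n \<omega> = (\<Sum>i<2^n. (dW T n i \<omega>)\<^sup>2) - T" for n \<omega>
    by (simp add: S_def sum_subtractf)
  have eq: "(cmod (\<Sum>i<2^n. 1 * of_real ((dW T n i \<omega>)\<^sup>2 - T / 2^n)))\<^sup>2 = (S n \<omega>)\<^sup>2" for n \<omega>
    unfolding mult_1 S_def of_real_sum[symmetric] norm_of_real by simp
  have "AE \<omega> in M. \<exists>B. \<forall>n. \<bar>S n \<omega>\<bar> \<le> B"
  proof (rule AE_bounded_of_summable_moments)
    show "integrable M (\<lambda>\<omega>. (S n \<omega>)\<^sup>2)" for n
      using dW_martingale(4)[OF T, of "\<lambda>_ _. 1" n "2^n"] unfolding eq by simp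
    show "S n \<in> borel_measurable M" for n
      unfolding S_def[abs_def] using T by measurable
    have "expectation (\<lambda>\<omega>. (S n \<omega>)\<^sup>2) = 2 * T\<^sup>2 * (1 / 2) ^ n" for n
      using dW_martingale(6)[OF T, of "\<lambda>_ _. 1" n "2^n"] unfolding eq
      by (simp add: prob_space power_divide power2_eq_square)
    then show "summable (\<lambda>n. expectation (\<lambda>\<omega>. (S n \<omega>)\<^sup>2))"
      by (simp add: summable_geometric)
  qed
  then show ?thesis
  proof eventually_elim
    case (elim \<omega>)
    then obtain B where "\<And>n. \<bar>S n \<omega>\<bar> \<le> B" by blast
    then have "(\<Sum>i<2^n. (dW T n i \<omega>)\<^sup>2) \<le> B + T" for n using S[of n \<omega>] by (metis abs_le_D1 diff_le_eq)
    then show ?case by blast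
  qed
qed


section \<open>Dynkin's formula\<close>


definition generator :: "(real \<Rightarrow> complex) \<Rightarrow> (real \<Rightarrow> complex) \<Rightarrow> real \<Rightarrow> complex" where
  "generator f' f'' y = f' y * of_real (\<alpha> - \<gamma> * y) + f'' y * of_real (\<sigma>\<^sup>2 / 2)"

text \<open>Sums the one-step errors along a path. Splitting each squared increment into mesh plus
  centred square completes the generator and leaves two sums of martingale differences.\<close>

lemma dynkin_remainder_tendsto_zero:
  fixes f f' f'' :: "real \<Rightarrow> complex" and a :: complex and u T :: real
  assumes T: "T > 0"
    and f: "\<And>z. (f has_vector_derivative f' z) (at z)"
    and f': "\<And>z. (f' has_vector_derivative f'' z) (at z)"
    and f'': "continuous_on UNIV f''"
    and bdry: "f' 0 + \<i> * u * f 0 = 0"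
  shows "AE \<omega> in M. (\<lambda>n. weight a u T \<omega> * f (Y T \<omega>) - weight a u 0 \<omega> * f (Y 0 \<omega>)
      - (\<Sum>i<2^n. weight a u (grid T n i) \<omega> * (a * f (Y (grid T n i) \<omega>) + generator f' f'' (Y (grid T n i) \<omega>)) * of_real (T / 2^n))
      - (\<Sum>i<2^n. weight a u (grid T n i) \<omega> * f' (Y (grid T n i) \<omega>) * of_real \<sigma> * of_real (dW T n i \<omega>))
      - (\<Sum>i<2^n. weight a u (grid T n i) \<omega> * f'' (Y (grid T n i) \<omega>) * of_real (\<sigma>\<^sup>2 / 2) * of_real ((dW T n i \<omega>)\<^sup>2 - T / 2^n)))
      \<longlonglongrightarrow> 0" (is "AE \<omega> in M. ?R \<omega> \<longlonglongrightarrow> 0")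
  using AE_good_path AE_quadratic_variation_bounded[OF T]
proof eventually_elim
  case (elim \<omega>)
  then obtain B where B: "\<And>n. (\<Sum>i<2^n. (dW T n i \<omega>)\<^sup>2) \<le> B" by blast
  have B0: "0 \<le> B" using order_trans[OF _ B[of 0]] by (simp add: sum_nonneg)
  note g = elim(1)[unfolded good_path_def]
  \<comment> \<open>Bounds the total of elapsed time, local time and quadratic variation on [0,T],
    to which the summed one-step errors are proportional.\<close>
  define C where "C = T + L T \<omega> + B + 1"
  have L: "L 0 \<omega> = 0" using g by simp
  have Lm: "0 \<le> s \<Longrightarrow> s \<le> t \<Longrightarrow> L s \<omega> \<le> L t \<omega>" for s t using g by simp
  have C: "C > 0" using Lm[of 0 T] L T B0 by (simp add: C_def)
  define r where "r s t = weight a u t \<omega> * f (Y t \<omega>) - weight a u s \<omega> * f (Y s \<omega>)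
        - weight a u s \<omega> * (a * f (Y s \<omega>) * of_real (t - s) + f' (Y s \<omega>) * of_real ((\<alpha> - \<gamma> * Y s \<omega>) * (t - s))
            + f' (Y s \<omega>) * of_real (\<sigma> * (W t \<omega> - W s \<omega>)) + f'' (Y s \<omega>) * of_real (\<sigma>\<^sup>2 / 2 * (W t \<omega> - W s \<omega>)\<^sup>2))" for s t
  have eq: "?R \<omega> n = (\<Sum>i<2^n. r (grid T n i) (grid T n (Suc i)))" for n
  proof -
    let ?F = "\<lambda>i. weight a u (grid T n i) \<omega> * f (Y (grid T n i) \<omega>)"
    have tel: "weight a u T \<omega> * f (Y T \<omega>) - weight a u 0 \<omega> * f (Y 0 \<omega>) = (\<Sum>i<2^n. ?F (Suc i) - ?F i)"
      using sum_lessThan_telescope[of ?F "2^n"] by simp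
    have alg: "A - B - E0 * (a * f0 + (f1 * of_real d + f2 * of_real k)) * of_real \<delta> - E0 * f1 * of_real \<sigma> * of_real w
        - E0 * f2 * of_real k * of_real (w\<^sup>2 - \<delta>) = A - B - E0 * (a * f0 * of_real \<delta> + f1 * of_real (d * \<delta>)
        + f1 * of_real (\<sigma> * w) + f2 * of_real (k * w\<^sup>2))" for A B E0 f0 f1 f2 :: complex and d k \<delta> w :: real
      by (simp only: of_real_mult of_real_diff) (simp add: algebra_simps)
    have dWe: "W (grid T n (Suc i)) \<omega> - W (grid T n i) \<omega> = dW T n i \<omega>" for i by (simp add: dW_def)
    show ?thesis
      unfolding tel sum_subtractf[symmetric] r_def dWe grid_simps generator_def
      by (intro sum.cong refl alg)
  qed
  show ?case
    unfolding eq
  proof (rule LIMSEQ_I)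
    fix e :: real assume e: "e > 0"
    have cont: "continuous_on {0..T} (\<lambda>t. Y t \<omega>)" "continuous_on {0..T} (\<lambda>t. W t \<omega>)" "continuous_on {0..T} (\<lambda>t. L t \<omega>)"
      using g by (auto intro: continuous_on_subset)
    have cd: "continuous_on {0..T} (\<lambda>t. \<alpha> - \<gamma> * Y t \<omega>)" by (intro continuous_intros cont)
    have eC: "e / (2 * C) > 0" using e C by simp
    obtain \<eta> where \<eta>: "\<eta> > 0" and "\<And>s t. 0 \<le> s \<Longrightarrow> s \<le> t \<Longrightarrow> t \<le> T \<Longrightarrow> t - s < \<eta> \<Longrightarrow>
      cmod (exp (a * t + \<i> * u * L t \<omega>) * f (Y t \<omega>) - exp (a * s + \<i> * u * L s \<omega>) * f (Y s \<omega>)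
        - exp (a * s + \<i> * u * L s \<omega>) * (a * f (Y s \<omega>) * of_real (t - s) + f' (Y s \<omega>) * of_real ((\<alpha> - \<gamma> * Y s \<omega>) * (t - s))
            + f' (Y s \<omega>) * of_real (\<sigma> * (W t \<omega> - W s \<omega>)) + f'' (Y s \<omega>) * of_real (\<sigma>\<^sup>2 / 2 * (W t \<omega> - W s \<omega>)\<^sup>2)))
      \<le> e / (2 * C) * ((t - s) + (L t \<omega> - L s \<omega>) + (W t \<omega> - W s \<omega>)\<^sup>2)"
    proof (rule ito_remainder_path[OF f f' f'' cont cd _ _ _ bdry eC, where \<sigma> = \<sigma> and a = a])
      show "L s \<omega> \<le> L t \<omega>" if "0 \<le> s" "s \<le> t" "t \<le> T" for s t by (rule Lm[OF that(1,2)])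
      show "Y t \<omega> - Y s \<omega> = integral {s..t} (\<lambda>r. \<alpha> - \<gamma> * Y r \<omega>) + \<sigma> * (W t \<omega> - W s \<omega>) + (L t \<omega> - L s \<omega>)"
        if "0 \<le> s" "s \<le> t" "t \<le> T" for s t using g that by simp
      show "L s \<omega> = L t \<omega>" if "0 \<le> s" "s \<le> t" "t \<le> T" "\<forall>v\<in>{s..t}. Y v \<omega> \<noteq> 0" for s t using g that by blast
    qed (rule that; assumption)
    then have r: "cmod (r s t) \<le> e / (2 * C) * ((t - s) + (L t \<omega> - L s \<omega>) + (W t \<omega> - W s \<omega>)\<^sup>2)"
      if "0 \<le> s" "s \<le> t" "t \<le> T" "t - s < \<eta>" for s t
      unfolding r_def weight_def using that by simp
    have "(\<lambda>n. T * (1 / 2) ^ n) \<longlonglongrightarrow> T * 0" by (intro tendsto_mult tendsto_const LIMSEQ_realpow_zero) auto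
    then have "eventually (\<lambda>n. T * (1 / 2) ^ n < \<eta>) sequentially" using \<eta> by (simp add: order_tendsto_iff)
    then obtain N where N: "\<And>n. n \<ge> N \<Longrightarrow> T / 2 ^ n < \<eta>"
      unfolding eventually_sequentially by (auto simp: power_divide)
    show "\<exists>no. \<forall>n\<ge>no. norm ((\<Sum>i<2 ^ n. r (grid T n i) (grid T n (Suc i))) - 0) < e"
    proof (intro exI allI impI)
      fix n assume n: "n \<ge> N"
      have "norm (\<Sum>i<2 ^ n. r (grid T n i) (grid T n (Suc i)))
         \<le> (\<Sum>i<2 ^ n. e / (2 * C) * (T / 2^n + (L (grid T n (Suc i)) \<omega> - L (grid T n i) \<omega>) + (dW T n i \<omega>)\<^sup>2))"
      proof (rule sum_norm_le)
        fix i :: nat assume i: "i \<in> {..<2^n}"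
        have "cmod (r (grid T n i) (grid T n (Suc i))) \<le> e / (2 * C) * ((grid T n (Suc i) - grid T n i) + (L (grid T n (Suc i)) \<omega> - L (grid T n i) \<omega>) + (W (grid T n (Suc i)) \<omega> - W (grid T n i) \<omega>)\<^sup>2)"
          by (rule r) (use grid_bounds[OF T, of n i] grid_bounds(3)[OF T, of "Suc i" n] N[OF n] i in auto)
        then show "norm (r (grid T n i) (grid T n (Suc i))) \<le> e / (2 * C) * (T / 2^n + (L (grid T n (Suc i)) \<omega> - L (grid T n i) \<omega>) + (dW T n i \<omega>)\<^sup>2)"
          by (simp add: dW_def)
      qed
      also have "\<dots> = e / (2 * C) * (T + (L T \<omega> - L 0 \<omega>) + (\<Sum>i<2 ^ n. (dW T n i \<omega>)\<^sup>2))"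
        using sum_lessThan_telescope[of "\<lambda>i. L (grid T n i) \<omega>" "2^n"]
        by (simp only: sum_distrib_left[symmetric] sum.distrib) simp
      also have "\<dots> \<le> e / (2 * C) * C"
        using B[of n] L eC by (intro mult_left_mono) (auto simp: C_def)
      also have "\<dots> < e" using e C by simp
      finally show "norm ((\<Sum>i<2 ^ n. r (grid T n i) (grid T n (Suc i))) - 0) < e" by simp
    qed
  qed
qed

lemma norm_sum5_sq:
  fixes v1 v2 v3 v4 v5 :: complex
  shows "(cmod (v1 - v2 - v3 - v4 - v5))\<^sup>2 \<le> 5 * ((cmod v1)\<^sup>2 + (cmod v2)\<^sup>2 + (cmod v3)\<^sup>2 + (cmod v4)\<^sup>2 + (cmod v5)\<^sup>2)"
proof -
  define w where "w i = (if i = 0 then cmod v1 else if i = 1 then cmod v2 else if i = 2 then cmod v3 else if i = 3 then cmod v4 else cmod v5)" for i :: nat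
  have "cmod (v1 - v2 - v3 - v4 - v5) \<le> cmod v1 + cmod v2 + cmod v3 + cmod v4 + cmod v5"
    by (intro order_trans[OF norm_triangle_ineq4] add_mono order_refl)
  also have "\<dots> = (\<Sum>i<5. w i)" by (simp add: w_def eval_nat_numeral)
  finally have "(cmod (v1 - v2 - v3 - v4 - v5))\<^sup>2 \<le> (\<Sum>i<5. w i)\<^sup>2" by (intro power_mono) auto
  also have "\<dots> \<le> (\<Sum>i<5. (w i)\<^sup>2) * card {..<5::nat}" by (rule sum_squared_le_sum_of_squares) 
  also have "\<dots> = 5 * ((cmod v1)\<^sup>2 + (cmod v2)\<^sup>2 + (cmod v3)\<^sup>2 + (cmod v4)\<^sup>2 + (cmod v5)\<^sup>2)"
    by (simp add: w_def eval_nat_numeral)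
  finally show ?thesis .
qed



lemma AE_Y_nonneg: "t \<ge> 0 \<Longrightarrow> AE \<omega> in M. Y t \<omega> \<ge> 0"
  using AE_good_path by eventually_elim (simp add: good_path_def)

lemma weighted_L2:
  fixes g :: "real \<Rightarrow> complex"
  assumes t: "t \<ge> 0" and g[measurable]: "g \<in> borel_measurable borel"
    and bnd: "\<And>y. y \<ge> 0 \<Longrightarrow> cmod (g y) \<le> c * b y"
    and int: "integrable M (\<lambda>\<omega>. (b (Y t \<omega>))\<^sup>2)"
  shows "integrable M (\<lambda>\<omega>. (cmod (weight a u t \<omega> * g (Y t \<omega>)))\<^sup>2)" (is ?int)
    and "expectation (\<lambda>\<omega>. (cmod (weight a u t \<omega> * g (Y t \<omega>)))\<^sup>2) \<le> (exp (Re a * t))\<^sup>2 * c\<^sup>2 * expectation (\<lambda>\<omega>. (b (Y t \<omega>))\<^sup>2)" (is ?le)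
proof -
  note [measurable] = rv(1)[OF t] weight_measurable[OF t]
  have le: "AE \<omega> in M. (cmod (weight a u t \<omega> * g (Y t \<omega>)))\<^sup>2 \<le> (exp (Re a * t))\<^sup>2 * c\<^sup>2 * (b (Y t \<omega>))\<^sup>2"
    using AE_Y_nonneg[OF t]
  proof eventually_elim
    case (elim \<omega>)
    have "cmod (weight a u t \<omega> * g (Y t \<omega>)) \<le> exp (Re a * t) * (c * b (Y t \<omega>))"
      using bnd[OF elim] by (simp add: norm_mult norm_weight)
    then have "(cmod (weight a u t \<omega> * g (Y t \<omega>)))\<^sup>2 \<le> (exp (Re a * t) * (c * b (Y t \<omega>)))\<^sup>2"
      by (intro power_mono) auto
    then show ?case by (simp only: power_mult_distrib mult.assoc)
  qed
  show 1: ?int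
  proof (rule Bochner_Integration.integrable_bound)
    show "integrable M (\<lambda>\<omega>. (exp (Re a * t))\<^sup>2 * c\<^sup>2 * (b (Y t \<omega>))\<^sup>2)" using int by (intro integrable_mult_right)
    show "AE \<omega> in M. norm ((cmod (weight a u t \<omega> * g (Y t \<omega>)))\<^sup>2) \<le> norm ((exp (Re a * t))\<^sup>2 * c\<^sup>2 * (b (Y t \<omega>))\<^sup>2)"
      using le by eventually_elim auto
  qed measurable
  have "expectation (\<lambda>\<omega>. (cmod (weight a u t \<omega> * g (Y t \<omega>)))\<^sup>2) \<le> expectation (\<lambda>\<omega>. (exp (Re a * t))\<^sup>2 * c\<^sup>2 * (b (Y t \<omega>))\<^sup>2)"
    by (rule integral_mono_AE[OF 1 _ le]) (use int in \<open>intro integrable_mult_right\<close>)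
  then show ?le
    by simp
qed

text \<open>The remainder tends to 0 almost surely and is bounded in L2, so its mean tends to 0, and
  both martingale sums have mean zero. The time integral stays a limit of Riemann sums, because the
  applications only bound its terms. The factor 1 + y in the envelope of \<open>f'\<close> offsets
  the drift.\<close>

lemma dynkin_limit:
  fixes f f' f'' :: "real \<Rightarrow> complex" and a :: complex and u T :: real
  assumes T: "T > 0"
    and f: "\<And>z. (f has_vector_derivative f' z) (at z)"
    and f': "\<And>z. (f' has_vector_derivative f'' z) (at z)"
    and f'': "continuous_on UNIV f''"
    and bdry: "f' 0 + \<i> * u * f 0 = 0"
    and bnd: "\<And>y. y \<ge> 0 \<Longrightarrow> cmod (f y) \<le> b y" "\<And>y. y \<ge> 0 \<Longrightarrow> cmod (f' y) * (1 + y) \<le> b y"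
      "\<And>y. y \<ge> 0 \<Longrightarrow> cmod (f'' y) \<le> b y"
    and int: "\<And>t. t \<ge> 0 \<Longrightarrow> integrable M (\<lambda>\<omega>. (b (Y t \<omega>))\<^sup>2)"
    and K: "\<And>t. 0 \<le> t \<Longrightarrow> t \<le> T \<Longrightarrow> expectation (\<lambda>\<omega>. (b (Y t \<omega>))\<^sup>2) \<le> K"
  shows "(\<lambda>n. \<Sum>i<2^n. expectation (\<lambda>\<omega>. weight a u (grid T n i) \<omega> *
            (a * f (Y (grid T n i) \<omega>) + generator f' f'' (Y (grid T n i) \<omega>))) * of_real (T / 2^n))
      \<longlonglongrightarrow> expectation (\<lambda>\<omega>. weight a u T \<omega> * f (Y T \<omega>)) - f x"
proof -
  have cf: "continuous_on UNIV f" "continuous_on UNIV f'"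
    using f f' by (auto intro!: continuous_at_imp_continuous_on has_vector_derivative_continuous)
  have [measurable]: "f \<in> borel_measurable borel" "f' \<in> borel_measurable borel" "f'' \<in> borel_measurable borel"
    using cf f'' by (auto intro: borel_measurable_continuous_onI)
  define G where "G y = a * f y + generator f' f'' y" for y
  have [measurable]: "G \<in> borel_measurable borel" unfolding G_def[abs_def] generator_def by measurable
  \<comment> \<open>Adds up the zeroth-order term, the drift and the diffusion coefficient, so that
    |a f + G f| <= \<open>cG * b\<close>.\<close>
  define cG where "cG = cmod a + (\<bar>\<alpha>\<bar> + \<gamma>) + \<sigma>\<^sup>2 / 2"
  have b0: "0 \<le> b y" if "y \<ge> 0" for y using order_trans[OF norm_ge_zero bnd(1)[OF that]] .
  have f'b: "cmod (f' y) \<le> b y" if "y \<ge> 0" for y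
  proof -
    have "cmod (f' y) * 1 \<le> cmod (f' y) * (1 + y)" using that by (intro mult_left_mono) auto
    then show ?thesis using bnd(2)[OF that] by simp
  qed
  have Gb: "cmod (G y) \<le> cG * b y" if y: "y \<ge> 0" for y
  proof -
    have "\<bar>\<alpha> - \<gamma> * y\<bar> \<le> (\<bar>\<alpha>\<bar> + \<gamma>) * (1 + y)" by (rule OU.drift_linear_growth[OF y])
    then have "cmod (f' y) * \<bar>\<alpha> - \<gamma> * y\<bar> \<le> cmod (f' y) * ((\<bar>\<alpha>\<bar> + \<gamma>) * (1 + y))" by (intro mult_left_mono) auto
    also have "\<dots> = (\<bar>\<alpha>\<bar> + \<gamma>) * (cmod (f' y) * (1 + y))" by (simp only: mult_ac)
    also have "\<dots> \<le> (\<bar>\<alpha>\<bar> + \<gamma>) * b y" using bnd(2)[OF y] \<gamma>_pos by (intro mult_left_mono) auto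
    finally have 1: "cmod (f' y) * \<bar>\<alpha> - \<gamma> * y\<bar> \<le> (\<bar>\<alpha>\<bar> + \<gamma>) * b y" .
    have 2: "cmod a * cmod (f y) \<le> cmod a * b y" by (rule mult_left_mono[OF bnd(1)[OF y] norm_ge_zero])
    have 3: "cmod (f'' y) * (\<sigma>\<^sup>2 / 2) \<le> b y * (\<sigma>\<^sup>2 / 2)" by (rule mult_right_mono[OF bnd(3)[OF y]]) simp
    have "cmod (G y) \<le> cmod (a * f y) + (cmod (f' y * of_real (\<alpha> - \<gamma> * y)) + cmod (f'' y * of_real (\<sigma>\<^sup>2 / 2)))"
      unfolding G_def generator_def by (intro order_trans[OF norm_triangle_ineq] add_left_mono norm_triangle_ineq)
    also have "\<dots> = cmod a * cmod (f y) + (cmod (f' y) * \<bar>\<alpha> - \<gamma> * y\<bar> + cmod (f'' y) * (\<sigma>\<^sup>2 / 2))"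
      by (simp only: norm_mult norm_of_real) simp
    also have "\<dots> \<le> cmod a * b y + ((\<bar>\<alpha>\<bar> + \<gamma>) * b y + b y * (\<sigma>\<^sup>2 / 2))" using 1 2 3 by (intro add_mono)
    also have "\<dots> = cG * b y" unfolding cG_def by (simp only: distrib_right mult.commute[of "b y"] add.assoc)
    finally show ?thesis .
  qed
  define A where "A = (exp (\<bar>Re a\<bar> * T))\<^sup>2"
  have A: "A > 0" by (simp add: A_def)
  have K0: "0 \<le> K" using order_trans[OF _ K[of 0]] T by simp
  have wb: "(exp (Re a * t))\<^sup>2 \<le> A" if "0 \<le> t" "t \<le> T" for t
  proof -
    have "Re a * t \<le> \<bar>Re a\<bar> * T" using that T by (intro mult_mono) auto
    then show ?thesis unfolding A_def by (intro power_mono) auto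
  qed
  have L2: "integrable M (\<lambda>\<omega>. (cmod (weight a u t \<omega> * g (Y t \<omega>)))\<^sup>2)"
    if "t \<ge> 0" "g \<in> borel_measurable borel" "\<And>y. y \<ge> 0 \<Longrightarrow> cmod (g y) \<le> c * b y" for t c and g :: "real \<Rightarrow> complex"
    by (rule weighted_L2(1)[OF that int[OF that(1)]])
  have L2b: "expectation (\<lambda>\<omega>. (cmod (weight a u t \<omega> * g (Y t \<omega>)))\<^sup>2) \<le> A * c\<^sup>2 * K"
    if "0 \<le> t" "t \<le> T" "g \<in> borel_measurable borel" "\<And>y. y \<ge> 0 \<Longrightarrow> cmod (g y) \<le> c * b y" for t c and g :: "real \<Rightarrow> complex"
  proof -
    have "expectation (\<lambda>\<omega>. (cmod (weight a u t \<omega> * g (Y t \<omega>)))\<^sup>2) \<le> (exp (Re a * t))\<^sup>2 * c\<^sup>2 * expectation (\<lambda>\<omega>. (b (Y t \<omega>))\<^sup>2)"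
      by (rule weighted_L2(2)[OF that(1,3,4) int[OF that(1)]])
    also have "\<dots> \<le> A * c\<^sup>2 * K"
      using wb[OF that(1,2)] K[OF that(1,2)] A by (intro mult_mono) auto
    finally show ?thesis .
  qed
  have nonneg_dominated: "integrable M (\<lambda>\<omega>. (p \<omega>)\<^sup>2)"
    if "integrable M q" "(\<lambda>\<omega>. (p \<omega>)\<^sup>2) \<in> borel_measurable M" "\<And>\<omega>. (p \<omega>)\<^sup>2 \<le> q \<omega>" for p q :: "'a \<Rightarrow> real"
    by (rule Bochner_Integration.integrable_bound[OF that(1,2)]) (auto intro: order_trans[OF that(3) abs_ge_self])
  have fb: "\<And>y. y \<ge> 0 \<Longrightarrow> cmod (f y) \<le> 1 * b y" using bnd(1) by simp
  define h1 where "h1 y = f' y * complex_of_real \<sigma>" for y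
  define h2 where "h2 y = f'' y * complex_of_real (\<sigma>\<^sup>2 / 2)" for y
  have hm [measurable]: "h1 \<in> borel_measurable borel" "h2 \<in> borel_measurable borel"
    unfolding h1_def[abs_def] h2_def[abs_def] by measurable
  have h1b: "cmod (h1 y) \<le> \<sigma> * b y" if "y \<ge> 0" for y
  proof -
    have "cmod (h1 y) = \<sigma> * cmod (f' y)" using \<sigma>_pos by (simp add: h1_def norm_mult)
    also have "\<dots> \<le> \<sigma> * b y" using f'b[OF that] \<sigma>_pos by (intro mult_left_mono) auto
    finally show ?thesis .
  qed
  have h2b: "cmod (h2 y) \<le> \<sigma>\<^sup>2 / 2 * b y" if "y \<ge> 0" for y
  proof -
    have "cmod (h2 y) = \<sigma>\<^sup>2 / 2 * cmod (f'' y)" unfolding h2_def norm_mult norm_of_real by simp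
    also have "\<dots> \<le> \<sigma>\<^sup>2 / 2 * b y" using bnd(3)[OF that] by (intro mult_left_mono) auto
    finally show ?thesis .
  qed
  have g0: "0 \<le> grid T n i" for n i by (rule grid_bounds(1)[OF T])
  have gT: "grid T n i \<le> T" if "i \<in> {..<2^n}" for n i using that by (intro grid_bounds(3)[OF T]) auto
  \<comment> \<open>Coefficients at left grid points, hence known before the increments that
    multiply them.\<close>
  define X where "X g n i \<omega> = weight a u (grid T n i) \<omega> * g (Y (grid T n i) \<omega>)" for g :: "real \<Rightarrow> complex" and n i \<omega>
  have X_ad: "X g n i \<in> borel_measurable (F (grid T n i))" if "g \<in> borel_measurable borel" for g n i
  proof -
    note [measurable] = that adapted(1)[OF g0] weight_adapted[OF g0]
    show ?thesis unfolding X_def[abs_def] by measurable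
  qed
  have X_m: "X g n i \<in> borel_measurable M" if "g \<in> borel_measurable borel" for g n i
    using measurable_from_subalg[OF subalg X_ad[OF that]] .
  have X_L2: "integrable M (\<lambda>\<omega>. (cmod (X g n i \<omega>))\<^sup>2)"
    if "g \<in> borel_measurable borel" "\<And>y. y \<ge> 0 \<Longrightarrow> cmod (g y) \<le> c * b y" for g c n i
    unfolding X_def by (rule L2[OF g0 that])
  have X_L2b: "(\<Sum>i<2^n. expectation (\<lambda>\<omega>. (cmod (X g n i \<omega>))\<^sup>2)) \<le> 2^n * (A * c\<^sup>2 * K)"
    if "g \<in> borel_measurable borel" "\<And>y. y \<ge> 0 \<Longrightarrow> cmod (g y) \<le> c * b y" for g c n
  proof -
    have "(\<Sum>i<2^n. expectation (\<lambda>\<omega>. (cmod (X g n i \<omega>))\<^sup>2)) \<le> (\<Sum>i<(2::nat)^n. A * c\<^sup>2 * K)"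
      unfolding X_def by (intro sum_mono L2b[OF g0 gT that])
    then show ?thesis by simp
  qed
  define FT where "FT \<omega> = weight a u T \<omega> * f (Y T \<omega>)" for \<omega>
  define F0 where "F0 \<omega> = weight a u 0 \<omega> * f (Y 0 \<omega>)" for \<omega>
  define D where "D n \<omega> = (\<Sum>i<2^n. X G n i \<omega> * of_real (T / 2^n))" for n \<omega>
  define S1 where "S1 n \<omega> = (\<Sum>i<2^n. X h1 n i \<omega> * of_real (dW T n i \<omega>))" for n \<omega>
  define S2 where "S2 n \<omega> = (\<Sum>i<2^n. X h2 n i \<omega> * of_real ((dW T n i \<omega>)\<^sup>2 - T / 2^n))" for n \<omega>
  define R where "R n \<omega> = FT \<omega> - F0 \<omega> - D n \<omega> - S1 n \<omega> - S2 n \<omega>" for n \<omega>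
  have T0: "0 \<le> T" using T by simp
  have [measurable]: "FT \<in> borel_measurable M" "F0 \<in> borel_measurable M"
    unfolding FT_def[abs_def] F0_def[abs_def] using T0 by measurable
  have [measurable]: "D n \<in> borel_measurable M" "S1 n \<in> borel_measurable M" "S2 n \<in> borel_measurable M" for n
    unfolding D_def[abs_def] S1_def[abs_def] S2_def[abs_def]
    by (intro borel_measurable_sum borel_measurable_times X_m borel_measurable_const borel_measurable_diff
        borel_measurable_power measurable_compose[OF _ borel_measurable_of_real] dW_measurable T; measurable)+
  have FT2: "integrable M (\<lambda>\<omega>. (cmod (FT \<omega>))\<^sup>2)" "expectation (\<lambda>\<omega>. (cmod (FT \<omega>))\<^sup>2) \<le> A * K"
    unfolding FT_def using L2[OF T0 _ fb] L2b[OF T0 _ _ fb] by simp_all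
  have F02: "integrable M (\<lambda>\<omega>. (cmod (F0 \<omega>))\<^sup>2)" "expectation (\<lambda>\<omega>. (cmod (F0 \<omega>))\<^sup>2) \<le> A * K"
    unfolding F0_def using L2[OF order_refl _ fb] L2b[OF order_refl T0 _ fb] by simp_all
  \<comment> \<open>Cauchy-Schwarz over 2^n terms: (T / 2^n)^2 * 2^n = T^2 / 2^n. The sum of 2^n
    bounded means then restores a bound uniform in n.\<close>
  have dom: "(cmod (D n \<omega>))\<^sup>2 \<le> T\<^sup>2 / 2^n * (\<Sum>i<2^n. (cmod (X G n i \<omega>))\<^sup>2)" for n \<omega>
  proof -
    have "cmod (D n \<omega>) \<le> (\<Sum>i<2^n. cmod (X G n i \<omega>)) * (T / 2^n)"
      unfolding D_def sum_distrib_right by (intro sum_norm_le) (use T in \<open>simp add: norm_mult norm_divide norm_power\<close>)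
    then have "(cmod (D n \<omega>))\<^sup>2 \<le> ((\<Sum>i<2^n. cmod (X G n i \<omega>)) * (T / 2^n))\<^sup>2" by (intro power_mono) auto
    also have "\<dots> = (\<Sum>i<2^n. cmod (X G n i \<omega>))\<^sup>2 * (T / 2^n)\<^sup>2" by (simp only: power_mult_distrib)
    also have "\<dots> \<le> ((\<Sum>i<2^n. (cmod (X G n i \<omega>))\<^sup>2) * card {..<(2::nat)^n}) * (T / 2^n)\<^sup>2"
      by (intro mult_right_mono sum_squared_le_sum_of_squares) auto
    also have "\<dots> = T\<^sup>2 / 2^n * (\<Sum>i<2^n. (cmod (X G n i \<omega>))\<^sup>2)" by (simp add: power2_eq_square)
    finally show ?thesis .
  qed
  have Dint: "integrable M (\<lambda>\<omega>. T\<^sup>2 / 2^n * (\<Sum>i<2^n. (cmod (X G n i \<omega>))\<^sup>2))" for n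
    by (intro integrable_mult_right Bochner_Integration.integrable_sum X_L2[OF _ Gb]) simp_all
  have D2: "integrable M (\<lambda>\<omega>. (cmod (D n \<omega>))\<^sup>2)" for n
    by (rule nonneg_dominated[OF Dint[of n] _ dom]) measurable
  have D2b: "expectation (\<lambda>\<omega>. (cmod (D n \<omega>))\<^sup>2) \<le> T\<^sup>2 * (A * cG\<^sup>2 * K)" for n
  proof -
    have "expectation (\<lambda>\<omega>. (cmod (D n \<omega>))\<^sup>2) \<le> expectation (\<lambda>\<omega>. T\<^sup>2 / 2^n * (\<Sum>i<2^n. (cmod (X G n i \<omega>))\<^sup>2))"
      by (rule integral_mono[OF D2 Dint dom])
    also have "\<dots> = T\<^sup>2 / 2^n * (\<Sum>i<2^n. expectation (\<lambda>\<omega>. (cmod (X G n i \<omega>))\<^sup>2))"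
      by (subst integral_mult_right_zero, subst Bochner_Integration.integral_sum) (auto intro: X_L2[OF _ Gb])
    also have "\<dots> \<le> T\<^sup>2 / 2^n * (2^n * (A * cG\<^sup>2 * K))"
      by (intro mult_left_mono X_L2b[OF _ Gb]) auto
    also have "\<dots> = T\<^sup>2 * (A * cG\<^sup>2 * K)" by simp
    finally show ?thesis .
  qed
  note m1 = dW_martingale[where X = "X h1 n" for n, OF T X_ad[OF hm(1)] X_L2[OF hm(1) h1b]]
  note m2 = dW_martingale[where X = "X h2 n" for n, OF T X_ad[OF hm(2)] X_L2[OF hm(2) h2b]]
  have S12: "integrable M (\<lambda>\<omega>. (cmod (S1 n \<omega>))\<^sup>2)" "expectation (S1 n) = 0" for n
    unfolding S1_def[abs_def] using m1(1,2) by simp_all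
  have S22: "integrable M (\<lambda>\<omega>. (cmod (S2 n \<omega>))\<^sup>2)" "expectation (S2 n) = 0" for n
    unfolding S2_def[abs_def] using m2(4,5) by simp_all
  have S1b: "expectation (\<lambda>\<omega>. (cmod (S1 n \<omega>))\<^sup>2) \<le> T * (A * \<sigma>\<^sup>2 * K)" for n
  proof -
    have "expectation (\<lambda>\<omega>. (cmod (S1 n \<omega>))\<^sup>2) = T / 2^n * (\<Sum>i<2^n. expectation (\<lambda>\<omega>. (cmod (X h1 n i \<omega>))\<^sup>2))"
      unfolding S1_def using m1(3) by simp
    also have "\<dots> \<le> T / 2^n * (2^n * (A * \<sigma>\<^sup>2 * K))"
      by (intro mult_left_mono X_L2b[OF _ h1b]) (use T in auto)
    also have "\<dots> = T * (A * \<sigma>\<^sup>2 * K)" by simp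
    finally show ?thesis .
  qed
  have S2b: "expectation (\<lambda>\<omega>. (cmod (S2 n \<omega>))\<^sup>2) \<le> 2 * T\<^sup>2 * (A * (\<sigma>\<^sup>2 / 2)\<^sup>2 * K)" for n
  proof -
    have "expectation (\<lambda>\<omega>. (cmod (S2 n \<omega>))\<^sup>2) = 2 * (T / 2^n)\<^sup>2 * (\<Sum>i<2^n. expectation (\<lambda>\<omega>. (cmod (X h2 n i \<omega>))\<^sup>2))"
      unfolding S2_def using m2(6) by simp
    also have "\<dots> \<le> 2 * (T / 2^n)\<^sup>2 * (2^n * (A * (\<sigma>\<^sup>2 / 2)\<^sup>2 * K))"
      by (intro mult_left_mono X_L2b[OF _ h2b]) (use T in auto)
    also have "\<dots> = 2 * T\<^sup>2 * (A * (\<sigma>\<^sup>2 / 2)\<^sup>2 * K) * (1 / 2^n)" by (simp add: power2_eq_square)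
    also have "\<dots> \<le> 2 * T\<^sup>2 * (A * (\<sigma>\<^sup>2 / 2)\<^sup>2 * K) * 1" using A K0 by (intro mult_left_mono) auto
    finally show ?thesis by simp
  qed
  let ?Q = "\<lambda>n \<omega>. 5 * ((cmod (FT \<omega>))\<^sup>2 + (cmod (F0 \<omega>))\<^sup>2 + (cmod (D n \<omega>))\<^sup>2 + (cmod (S1 n \<omega>))\<^sup>2 + (cmod (S2 n \<omega>))\<^sup>2)"
  have Qint: "integrable M (?Q n)" for n
    by (intro integrable_mult_right Bochner_Integration.integrable_add FT2 F02 D2 S12 S22)
  have RQ: "(cmod (R n \<omega>))\<^sup>2 \<le> ?Q n \<omega>" for n \<omega> unfolding R_def by (rule norm_sum5_sq)
  have [measurable]: "R n \<in> borel_measurable M" for n unfolding R_def[abs_def] by measurable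
  have R2: "integrable M (\<lambda>\<omega>. (cmod (R n \<omega>))\<^sup>2)" for n
    by (rule nonneg_dominated[OF Qint[of n] _ RQ]) measurable
  define KR where "KR = 5 * (A * K + A * K + T\<^sup>2 * (A * cG\<^sup>2 * K) + T * (A * \<sigma>\<^sup>2 * K) + 2 * T\<^sup>2 * (A * (\<sigma>\<^sup>2 / 2)\<^sup>2 * K))"
  have R2b: "expectation (\<lambda>\<omega>. (cmod (R n \<omega>))\<^sup>2) \<le> KR" for n
  proof -
    have "expectation (\<lambda>\<omega>. (cmod (R n \<omega>))\<^sup>2) \<le> expectation (?Q n)" by (rule integral_mono[OF R2 Qint RQ])
    also have "\<dots> = 5 * (expectation (\<lambda>\<omega>. (cmod (FT \<omega>))\<^sup>2) + expectation (\<lambda>\<omega>. (cmod (F0 \<omega>))\<^sup>2) + expectation (\<lambda>\<omega>. (cmod (D n \<omega>))\<^sup>2)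
       + expectation (\<lambda>\<omega>. (cmod (S1 n \<omega>))\<^sup>2) + expectation (\<lambda>\<omega>. (cmod (S2 n \<omega>))\<^sup>2))"
      using FT2(1) F02(1) D2[of n] S12(1)[of n] S22(1)[of n] by simp
    also have "\<dots> \<le> KR" unfolding KR_def using FT2(2) F02(2) D2b[of n] S1b[of n] S2b[of n] by (intro mult_left_mono add_mono) auto
    finally show ?thesis .
  qed
  have "AE \<omega> in M. (\<lambda>n. R n \<omega>) \<longlonglongrightarrow> 0"
    using dynkin_remainder_tendsto_zero[OF T f f' f'' bdry, where a = a]
    unfolding R_def FT_def F0_def D_def S1_def S2_def X_def h1_def h2_def G_def by (simp only: mult.assoc)
  then have ER: "(\<lambda>n. expectation (R n)) \<longlonglongrightarrow> 0"
    by (rule expectation_tendsto_zero[OF _ R2 R2b, rotated]) measurable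
  have FTi: "integrable M FT" by (rule integrable_square_bound[OF _ FT2(1)]) measurable
  have F0i: "integrable M F0" by (rule integrable_square_bound[OF _ F02(1)]) measurable
  have Di: "integrable M (D n)" for n by (rule integrable_square_bound[OF _ D2]) measurable
  have S1i: "integrable M (S1 n)" for n by (rule integrable_square_bound[OF _ S12(1)]) measurable
  have S2i: "integrable M (S2 n)" for n by (rule integrable_square_bound[OF _ S22(1)]) measurable
  \<comment> \<open>At time 0 almost surely L = 0 and Y = x, so the weight is 1.\<close>
  have F0e: "expectation F0 = f x"
  proof -
    have "AE \<omega> in M. F0 \<omega> = f x"
      using AE_good_path by eventually_elim (simp add: F0_def good_path_def weight_def)
    then have "expectation F0 = expectation (\<lambda>_. f x)" by (intro integral_cong_AE) auto
    then show ?thesis by (simp add: prob_space)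
  qed
  have ERn: "expectation (R n) = expectation FT - f x - expectation (D n)" for n
  proof -
    have "expectation (R n) = expectation FT - expectation F0 - expectation (D n) - expectation (S1 n) - expectation (S2 n)"
      unfolding R_def[abs_def] using FTi F0i Di[of n] S1i[of n] S2i[of n] by simp
    then show ?thesis using F0e S12(2) S22(2) by simp
  qed
  have XGi: "integrable M (X G n i)" for n i
    by (rule integrable_square_bound[OF X_m X_L2[OF _ Gb]]) measurable
  have De: "expectation (D n) = (\<Sum>i<2^n. expectation (X G n i) * of_real (T / 2^n))" for n
    unfolding D_def[abs_def] by (subst Bochner_Integration.integral_sum) (use XGi in \<open>auto simp del: of_real_divide\<close>)
  have "(\<lambda>n. expectation FT - f x - expectation (R n)) \<longlonglongrightarrow> expectation FT - f x - 0"
    by (intro tendsto_diff tendsto_const ER)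
  then have "(\<lambda>n. expectation (D n)) \<longlonglongrightarrow> expectation FT - f x"
    unfolding ERn by simp
  then show ?thesis unfolding De unfolding X_def[abs_def] G_def FT_def[abs_def] .
qed


section \<open>Moments\<close>


text \<open>Upper bound for the generator on y^2, which is 2 y (\<alpha> - \<gamma> y) + \<sigma>^2:
  the parabola is largest at y = \<alpha> / (2 \<gamma>).\<close>

definition moment_rate :: real where
  "moment_rate = \<alpha>\<^sup>2 / (2 * \<gamma>) + \<sigma>\<^sup>2"

lemma moment_rate_pos: "moment_rate > 0"
  unfolding moment_rate_def using \<gamma>_pos \<sigma>_pos by (intro add_nonneg_pos) auto

lemma truncated_second_moment:
  assumes T: "T > 0" and \<epsilon>: "\<epsilon> > 0"
  shows "expectation (\<lambda>\<omega>. (Y T \<omega>)\<^sup>2 / (1 + \<epsilon> * (Y T \<omega>)\<^sup>2)) \<le> x\<^sup>2 + moment_rate * T"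
proof -
  define q where "q y = 1 + \<epsilon> * y\<^sup>2" for y :: real
  have q1: "q y \<ge> 1" for y using \<epsilon> by (simp add: q_def)
  have q0: "q y > 0" "q y \<noteq> 0" for y using q1[of y] by linarith+
  define f0 where "f0 y = y\<^sup>2 / q y" for y
  define f1 where "f1 y = 2 * y / (q y)\<^sup>2" for y
  define f2 where "f2 y = (2 - 6 * \<epsilon> * y\<^sup>2) / (q y)^3" for y
  have dq: "(q has_real_derivative 2 * \<epsilon> * y) (at y)" for y
    unfolding q_def by (auto intro!: derivative_eq_intros)
  have d0: "(f0 has_real_derivative f1 y) (at y)" for y
  proof -
    have "(f0 has_real_derivative (2 * y * q y - y\<^sup>2 * (2 * \<epsilon> * y)) / (q y * q y)) (at y)"
      unfolding f0_def[abs_def] using q0 by (auto intro!: derivative_eq_intros dq)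
    moreover have "2 * y * q y - y\<^sup>2 * (2 * \<epsilon> * y) = 2 * y" by (simp add: q_def power2_eq_square algebra_simps)
    ultimately show ?thesis by (simp add: f1_def power2_eq_square)
  qed
  have d1: "(f1 has_real_derivative f2 y) (at y)" for y
  proof -
    have "(f1 has_real_derivative (2 * (q y)\<^sup>2 - 2 * y * (2 * q y * (2 * \<epsilon> * y))) / ((q y)\<^sup>2 * (q y)\<^sup>2)) (at y)"
      unfolding f1_def[abs_def] using q0 by (auto intro!: derivative_eq_intros dq)
    moreover have "2 * (q y)\<^sup>2 - 2 * y * (2 * q y * (2 * \<epsilon> * y)) = (2 - 6 * \<epsilon> * y\<^sup>2) * q y"
      by (simp add: q_def power2_eq_square algebra_simps)
    moreover have "(2 - 6 * \<epsilon> * y\<^sup>2) * q y / ((q y)\<^sup>2 * (q y)\<^sup>2) = f2 y"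
      using q0[of y] by (simp add: f2_def power2_eq_square power3_eq_cube)
    ultimately show ?thesis by simp
  qed
  have cf2: "continuous_on UNIV f2"
    unfolding f2_def[abs_def] q_def using q0 by (intro continuous_intros) (auto simp: q_def)
  \<comment> \<open>The bounds to cover are 1 / \<epsilon> for \<open>f0\<close>, 2 + 4 / \<epsilon>
    for \<open>f1\<close> times 1 + y, and 6 for \<open>f2\<close>.\<close>
  define b where "b = 6 + 4 / \<epsilon>"
  have bq: "y\<^sup>2 \<le> q y / \<epsilon>" for y using \<epsilon> by (simp add: q_def field_simps)
  have cd0: "((\<lambda>y. of_real (f0 y) :: complex) has_vector_derivative of_real (f1 y)) (at y)" for y
    by (rule has_vector_derivative_of_real) (use d0 in \<open>simp add: has_real_derivative_iff_has_vector_derivative[symmetric]\<close>)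
  have cd1: "((\<lambda>y. of_real (f1 y) :: complex) has_vector_derivative of_real (f2 y)) (at y)" for y
    by (rule has_vector_derivative_of_real) (use d1 in \<open>simp add: has_real_derivative_iff_has_vector_derivative[symmetric]\<close>)
  have b0: "cmod (of_real (f0 y)) \<le> b" for y
  proof -
    have "f0 y \<le> 1 / \<epsilon>" using bq[of y] q0[of y] by (simp add: f0_def field_simps)
    moreover have "0 \<le> f0 y" using q0[of y] by (simp add: f0_def)
    moreover have "1 / \<epsilon> \<le> b" using \<epsilon> by (simp add: b_def field_simps)
    ultimately show ?thesis by simp
  qed
  have b1: "cmod (of_real (f1 y)) * (1 + y) \<le> b" if y: "y \<ge> 0" for y
  proof -
    have "2 * y * (1 + y) \<le> 2 + 4 * y\<^sup>2"
    proof -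
      have "2 * y \<le> y\<^sup>2 + 1" using sum_squares_bound[of y 1] by simp
      moreover have "2 * y * (1 + y) = 2 * y + 2 * y\<^sup>2" by (simp add: power2_eq_square algebra_simps)
      ultimately show ?thesis using zero_le_power2[of y] by linarith
    qed
    also have "\<dots> \<le> 2 * q y + 4 * (q y / \<epsilon>)" using q1[of y] bq[of y] by (intro add_mono) auto
    also have "\<dots> \<le> b * q y" using q0[of y] \<epsilon> by (simp add: b_def algebra_simps)
    also have "\<dots> \<le> b * (q y)\<^sup>2"
      using q1[of y] \<epsilon> by (intro mult_left_mono) (auto simp: b_def power2_eq_square)
    finally have "2 * y * (1 + y) / (q y)\<^sup>2 \<le> b" using q0[of y] by (simp add: divide_le_eq)
    moreover have "cmod (of_real (f1 y)) = 2 * y / (q y)\<^sup>2"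
      unfolding norm_of_real using y by (simp add: f1_def)
    ultimately show ?thesis by simp
  qed
  have b2: "cmod (of_real (f2 y)) \<le> b" for y
  proof -
    have "\<bar>2 - 6 * \<epsilon> * y\<^sup>2\<bar> \<le> 6 * q y" using \<epsilon> by (simp add: q_def abs_le_iff)
    also have "\<dots> \<le> 6 * (q y)^3" using q1[of y] self_le_power[OF q1[of y], of 3] by simp
    also have "\<dots> \<le> b * (q y)^3" using q0[of y] \<epsilon> by (intro mult_right_mono) (auto simp: b_def)
    finally have "\<bar>2 - 6 * \<epsilon> * y\<^sup>2\<bar> / (q y)^3 \<le> b" using q0[of y] by (simp add: divide_le_eq)
    then show ?thesis unfolding norm_of_real using q0[of y] by (simp add: f2_def)
  qed
  define gen0 where "gen0 y = f1 y * (\<alpha> - \<gamma> * y) + f2 y * (\<sigma>\<^sup>2 / 2)" for y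
  have gen: "generator (\<lambda>y. of_real (f1 y)) (\<lambda>y. of_real (f2 y)) y = of_real (gen0 y)" for y
    by (simp only: generator_def gen0_def of_real_add of_real_mult)
  have gen_le: "gen0 y \<le> moment_rate" if y: "y \<ge> 0" for y
  proof -
    have "2 * y * (\<alpha> - \<gamma> * y) \<le> \<alpha>\<^sup>2 / (2 * \<gamma>)"
    proof -
      have "0 \<le> (\<alpha> - 2 * \<gamma> * y)\<^sup>2" by simp
      then have "2 * \<gamma> * (2 * y * (\<alpha> - \<gamma> * y)) \<le> \<alpha>\<^sup>2" by (simp add: power2_eq_square algebra_simps)
      then show ?thesis using \<gamma>_pos by (simp add: le_divide_eq mult.commute)
    qed
    also have "\<dots> \<le> \<alpha>\<^sup>2 / (2 * \<gamma>) * (q y)\<^sup>2"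
    proof -
      have "\<alpha>\<^sup>2 / (2 * \<gamma>) * 1 \<le> \<alpha>\<^sup>2 / (2 * \<gamma>) * (q y)\<^sup>2"
        using \<gamma>_pos by (intro mult_left_mono one_le_power q1) auto
      then show ?thesis by simp
    qed
    finally have "2 * y * (\<alpha> - \<gamma> * y) / (q y)\<^sup>2 \<le> \<alpha>\<^sup>2 / (2 * \<gamma>)" using q0[of y] by (simp add: divide_le_eq)
    then have 1: "f1 y * (\<alpha> - \<gamma> * y) \<le> \<alpha>\<^sup>2 / (2 * \<gamma>)" by (simp add: f1_def)
    have "2 - 6 * \<epsilon> * y\<^sup>2 \<le> 2 * (q y)^3" using one_le_power[OF q1[of y], of 3] \<epsilon> by (simp add: add_increasing2 algebra_simps) 
    then have "f2 y \<le> 2" using q0[of y] by (simp add: f2_def divide_le_eq)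
    then have 2: "f2 y * (\<sigma>\<^sup>2 / 2) \<le> 2 * (\<sigma>\<^sup>2 / 2)" by (intro mult_right_mono) auto
    show ?thesis using 1 2 by (simp add: moment_rate_def gen0_def)
  qed
  have w: "weight 0 0 t \<omega> = 1" for t \<omega> by (simp add: weight_def)
  have lim: "(\<lambda>n. \<Sum>i<2^n. expectation (\<lambda>\<omega>. weight 0 0 (grid T n i) \<omega> *
            (0 * of_real (f0 (Y (grid T n i) \<omega>)) + generator (\<lambda>y. of_real (f1 y)) (\<lambda>y. of_real (f2 y)) (Y (grid T n i) \<omega>))) * of_real (T / 2^n))
      \<longlonglongrightarrow> expectation (\<lambda>\<omega>. weight 0 0 T \<omega> * of_real (f0 (Y T \<omega>))) - of_real (f0 x)"
  proof (rule dynkin_limit[OF T cd0 cd1, where b = "\<lambda>_. b" and K = "b\<^sup>2"])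
    show "continuous_on UNIV (\<lambda>y. complex_of_real (f2 y))" using cf2 by (intro continuous_intros)
  qed (use b0 b1 b2 in \<open>simp_all add: f1_def prob_space\<close>)
  have m: "f0 \<in> borel_measurable borel" "gen0 \<in> borel_measurable borel"
    unfolding f0_def[abs_def] gen0_def[abs_def] f1_def f2_def q_def by measurable
  have "(\<lambda>n. \<Sum>i<2^n. expectation (\<lambda>\<omega>. gen0 (Y (grid T n i) \<omega>)) * (T / 2^n)) \<longlonglongrightarrow> expectation (\<lambda>\<omega>. f0 (Y T \<omega>)) - f0 x"
    using tendsto_Re[OF lim] unfolding w gen
    by (simp add: integral_complex_of_real flip: of_real_mult of_real_sum of_real_divide of_real_power)
  then have "expectation (\<lambda>\<omega>. f0 (Y T \<omega>)) - f0 x \<le> moment_rate * T"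
  proof (rule LIMSEQ_le_const2, intro exI allI impI)
    fix n :: nat
    have "(\<Sum>i<2^n. expectation (\<lambda>\<omega>. gen0 (Y (grid T n i) \<omega>)) * (T / 2^n)) \<le> (\<Sum>i<(2::nat)^n. moment_rate * (T / 2^n))"
    proof (intro sum_mono mult_right_mono)
      fix i
      have g0: "0 \<le> grid T n i" by (rule grid_bounds(1)[OF T])
      show "expectation (\<lambda>\<omega>. gen0 (Y (grid T n i) \<omega>)) \<le> moment_rate"
      proof (cases "integrable M (\<lambda>\<omega>. gen0 (Y (grid T n i) \<omega>))")
        case True
        have "AE \<omega> in M. gen0 (Y (grid T n i) \<omega>) \<le> moment_rate"
          using AE_Y_nonneg[OF g0] by eventually_elim (rule gen_le)
        then have "expectation (\<lambda>\<omega>. gen0 (Y (grid T n i) \<omega>)) \<le> expectation (\<lambda>_. moment_rate)"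
          by (intro integral_mono_AE True) simp_all
        then show ?thesis by (simp add: prob_space)
      next
        \<comment> \<open>A non-integrable function has expectation 0 by convention, and 0 lies
          below the positive rate.\<close>
        case False
        then show ?thesis using moment_rate_pos by (simp add: not_integrable_integral_eq)
      qed
    qed (use T in simp)
    then show "(\<Sum>i<2^n. expectation (\<lambda>\<omega>. gen0 (Y (grid T n i) \<omega>)) * (T / 2^n)) \<le> moment_rate * T" by simp
  qed
  moreover have "f0 x \<le> x\<^sup>2" using q1[of x] q0[of x] by (simp add: f0_def divide_le_eq mult_le_cancel_left1)
  ultimately show ?thesis by (simp add: f0_def q_def)
qed

text \<open>Fatou's lemma along \<epsilon> = 1 / (n + 1), since the truncated bounds do not depend
  on \<epsilon>. At T = 0, outside the range of the truncated estimate, Y = x is used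
  directly.\<close>

lemma second_moment:
  assumes T: "T \<ge> 0"
  shows "integrable M (\<lambda>\<omega>. (Y T \<omega>)\<^sup>2)" "expectation (\<lambda>\<omega>. (Y T \<omega>)\<^sup>2) \<le> x\<^sup>2 + moment_rate * T"
proof -
  note [measurable] = rv(1)[OF T]
  have C0: "0 \<le> x\<^sup>2 + moment_rate * T" using moment_rate_pos T by simp
  define p where "p n \<omega> = (Y T \<omega>)\<^sup>2 / (1 + 1 / real (Suc n) * (Y T \<omega>)\<^sup>2)" for n \<omega>
  have [measurable]: "p n \<in> borel_measurable M" for n unfolding p_def[abs_def] by measurable
  have pos: "1 + 1 / real (Suc n) * (Y T \<omega>)\<^sup>2 > 0" for n \<omega> by (simp add: add_pos_nonneg)
  have p0: "0 \<le> p n \<omega>" for n \<omega> unfolding p_def using pos[of n \<omega>] by (simp add: zero_le_divide_iff less_imp_le)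
  have pb: "p n \<omega> \<le> real (Suc n)" for n \<omega>
  proof -
    have "(Y T \<omega>)\<^sup>2 \<le> real (Suc n) + (Y T \<omega>)\<^sup>2" by simp
    also have "\<dots> = real (Suc n) * (1 + 1 / real (Suc n) * (Y T \<omega>)\<^sup>2)" by (simp add: distrib_left del: of_nat_Suc)
    finally show ?thesis unfolding p_def using pos[of n \<omega>] by (simp only: pos_divide_le_eq)
  qed
  have pe: "expectation (p n) \<le> x\<^sup>2 + moment_rate * T" for n
  proof (cases "T = 0")
    case True
    have "AE \<omega> in M. p n \<omega> \<le> x\<^sup>2"
      using AE_good_path
    proof eventually_elim
      case (elim \<omega>)
      then have "Y T \<omega> = x" by (simp add: good_path_def True)
      then show ?case using pos[of n \<omega>] unfolding p_def by (subst pos_divide_le_eq) (simp_all add: algebra_simps)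
    qed
    moreover have "integrable M (p n)"
      by (rule integrable_const_bound[where B = "real (Suc n)"]) (use p0 pb in \<open>auto intro!: AE_I2\<close>)
    ultimately have "expectation (p n) \<le> expectation (\<lambda>_. x\<^sup>2)" by (intro integral_mono_AE) auto
    then show ?thesis by (simp add: prob_space True)
  next
    case False
    then show ?thesis using truncated_second_moment[of T "1 / real (Suc n)"] T by (simp add: p_def[abs_def])
  qed
  have lim: "(\<lambda>n. ennreal (p n \<omega>)) \<longlonglongrightarrow> ennreal ((Y T \<omega>)\<^sup>2)" for \<omega>
  proof (rule tendsto_ennrealI)
    have "(\<lambda>n. (Y T \<omega>)\<^sup>2 / (1 + 1 / real (Suc n) * (Y T \<omega>)\<^sup>2)) \<longlonglongrightarrow> (Y T \<omega>)\<^sup>2 / (1 + 0 * (Y T \<omega>)\<^sup>2)"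
      by (intro tendsto_intros LIMSEQ_Suc[OF lim_1_over_n]) simp
    then show "(\<lambda>n. p n \<omega>) \<longlonglongrightarrow> (Y T \<omega>)\<^sup>2" by (simp add: p_def)
  qed
  have "(\<integral>\<^sup>+\<omega>. ennreal ((Y T \<omega>)\<^sup>2) \<partial>M) = (\<integral>\<^sup>+\<omega>. liminf (\<lambda>n. ennreal (p n \<omega>)) \<partial>M)"
    by (intro nn_integral_cong lim_imp_Liminf[symmetric] lim) simp
  also have "\<dots> \<le> liminf (\<lambda>n. \<integral>\<^sup>+\<omega>. ennreal (p n \<omega>) \<partial>M)" by (rule nn_integral_liminf) measurable
  also have "\<dots> \<le> ennreal (x\<^sup>2 + moment_rate * T)"
  proof (rule Liminf_le)
    show "\<forall>\<^sub>F n in sequentially. (\<integral>\<^sup>+\<omega>. ennreal (p n \<omega>) \<partial>M) \<le> ennreal (x\<^sup>2 + moment_rate * T)"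
    proof (intro always_eventually allI)
      fix n
      have "integrable M (p n)"
        by (rule integrable_const_bound[where B = "real (Suc n)"]) (use p0 pb in \<open>auto intro!: AE_I2\<close>)
      then have "(\<integral>\<^sup>+\<omega>. ennreal (p n \<omega>) \<partial>M) = ennreal (expectation (p n))"
        using p0 by (intro nn_integral_eq_integral) auto
      then show "(\<integral>\<^sup>+\<omega>. ennreal (p n \<omega>) \<partial>M) \<le> ennreal (x\<^sup>2 + moment_rate * T)"
        using pe[of n] by (simp add: ennreal_leI)
    qed
  qed simp
  finally have nn: "(\<integral>\<^sup>+\<omega>. ennreal ((Y T \<omega>)\<^sup>2) \<partial>M) \<le> ennreal (x\<^sup>2 + moment_rate * T)" .
  show int: "integrable M (\<lambda>\<omega>. (Y T \<omega>)\<^sup>2)"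
  proof (rule integrableI_bounded)
    show "(\<integral>\<^sup>+\<omega>. ennreal (norm ((Y T \<omega>)\<^sup>2)) \<partial>M) < \<infinity>"
      using le_less_trans[OF nn ennreal_less_top] by simp
  qed measurable
  have "ennreal (expectation (\<lambda>\<omega>. (Y T \<omega>)\<^sup>2)) \<le> ennreal (x\<^sup>2 + moment_rate * T)"
    using nn nn_integral_eq_integral[OF int] by simp
  then show "expectation (\<lambda>\<omega>. (Y T \<omega>)\<^sup>2) \<le> x\<^sup>2 + moment_rate * T" using C0 by (simp add: ennreal_le_iff)
qed

text \<open>From the second moment by Y <= sqrt T + Y^2 / sqrt T. Growth like sqrt T is not sharp,
  yet small enough for T u^4 E Y to vanish when u = \<theta> / sqrt T.\<close>

lemma first_moment:
  assumes t: "0 \<le> t" "t \<le> T" and T: "T \<ge> 1"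
  shows "integrable M (Y t)" "expectation (Y t) \<le> (1 + x\<^sup>2 + moment_rate) * sqrt T"
proof -
  note [measurable] = rv(1)[OF t(1)]
  note m = second_moment[OF t(1)]
  show int: "integrable M (Y t)" by (rule integrable_square_bound[OF _ ]) (use m in simp_all)
  have sT: "sqrt T > 0" using T by simp
  have "expectation (Y t) \<le> expectation (\<lambda>\<omega>. sqrt T + (Y t \<omega>)\<^sup>2 / sqrt T)"
  proof (rule integral_mono[OF int])
    show "integrable M (\<lambda>\<omega>. sqrt T + (Y t \<omega>)\<^sup>2 / sqrt T)" using m by simp
    fix \<omega>
    have "2 * (Y t \<omega> * sqrt T) \<le> (Y t \<omega>)\<^sup>2 + (sqrt T)\<^sup>2"
      using sum_squares_bound[of "Y t \<omega>" "sqrt T"] by (simp only: mult.assoc)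
    then have "Y t \<omega> * sqrt T \<le> (Y t \<omega>)\<^sup>2 + (sqrt T)\<^sup>2"
      using zero_le_power2[of "Y t \<omega>"] zero_le_power2[of "sqrt T"] by linarith
    also have "\<dots> = (sqrt T + (Y t \<omega>)\<^sup>2 / sqrt T) * sqrt T"
      using sT by (simp add: distrib_right power2_eq_square)
    finally show "Y t \<omega> \<le> sqrt T + (Y t \<omega>)\<^sup>2 / sqrt T" using sT by (simp only: mult_le_cancel_right_pos)
  qed
  also have "\<dots> = sqrt T + expectation (\<lambda>\<omega>. (Y t \<omega>)\<^sup>2) / sqrt T" using m by (simp add: prob_space)
  also have "\<dots> \<le> sqrt T + (x\<^sup>2 + moment_rate) * T / sqrt T"
  proof -
    have "expectation (\<lambda>\<omega>. (Y t \<omega>)\<^sup>2) \<le> x\<^sup>2 * 1 + moment_rate * t" using m by simp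
    also have "\<dots> \<le> x\<^sup>2 * T + moment_rate * T" using t T moment_rate_pos by (intro add_mono mult_left_mono) auto
    finally show ?thesis using sT by (simp add: divide_right_mono algebra_simps)
  qed
  also have "\<dots> = (1 + x\<^sup>2 + moment_rate) * sqrt T"
  proof -
    have "T / sqrt T = sqrt T" using T by (intro real_div_sqrt) simp
    then have "(x\<^sup>2 + moment_rate) * T / sqrt T = (x\<^sup>2 + moment_rate) * sqrt T"
      by (metis times_divide_eq_right)
    then show ?thesis by (simp add: algebra_simps)
  qed
  finally show "expectation (Y t) \<le> (1 + x\<^sup>2 + moment_rate) * sqrt T" .
qed

end

section \<open>The perturbed exponential martingale\<close>

lemma norm_exp_i_minus_1: "cmod (exp (- (\<i> * of_real z)) - 1) \<le> \<bar>z\<bar>"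
proof -
  have "cmod (exp (- (\<i> * of_real z)) - 1) = 2 * \<bar>sin (- z / 2)\<bar>"
    using dist_exp_i_1[of "- z"] by simp
  also have "\<dots> \<le> 2 * \<bar>- z / 2\<bar>" by (intro mult_left_mono abs_sin_x_le_abs_x) simp
  finally show ?thesis by simp
qed

text \<open>ln z <= z - 1, applied to both factors of 1 + y = s * ((1 + y) / s). With E Y = O(sqrt
  T), the choice s = T^(1/4) gives E ln (1 + Y) = O(T^(1/4)).\<close>

lemma ln_le_split: "s > 0 \<Longrightarrow> y \<ge> 0 \<Longrightarrow> ln (1 + y) \<le> s + (1 + y) / s" for s y :: real
proof -
  assume s: "s > 0" and y: "y \<ge> 0"
  have "ln (1 + y) = ln ((1 + y) / s) + ln s" using s y by (simp add: ln_div)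
  also have "\<dots> \<le> ((1 + y) / s - 1) + (s - 1)" using s y by (intro add_mono ln_le_minus_one) auto
  finally show ?thesis by simp
qed

text \<open>The algebra of the cancellation: \<open>H1\<close>, \<open>H2\<close> are the
  derivatives of h, \<open>K0\<close> to \<open>K2\<close> are k and its derivatives,
  \<open>S\<close> is \<sigma>^2/2 and \<open>d\<close> the drift. The equation for h removes order
  u, the one for k removes order u^2, and only terms of orders u^4 and u^3 remain.\<close>

lemma corrector_identity:
  fixes u c S d q t H1 H2 K0 K1 K2 :: complex
  assumes c: "c = u\<^sup>2 / 2" and h: "S * H2 + d * H1 = - q" and k: "S * K2 + d * K1 = 2 * S * H1\<^sup>2 - t"
  shows "(- \<i> * u * q + u\<^sup>2 * t / 2) * (1 + c * K0)
      + ((- \<i> * u * H1 * (1 + c * K0) + c * K1) * d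
      + (- u\<^sup>2 * H1\<^sup>2 * (1 + c * K0) - 2 * \<i> * u * c * H1 * K1 - \<i> * u * H2 * (1 + c * K0) + c * K2) * S)
    = c * K0 * (u\<^sup>2 * t / 2 - S * u\<^sup>2 * H1\<^sup>2) - 2 * \<i> * S * u * c * H1 * K1"
proof -
  have q: "q = - (S * H2 + d * H1)" using h by simp
  have t: "t = 2 * S * H1\<^sup>2 - (S * K2 + d * K1)" using k by simp
  show ?thesis unfolding q t c by (simp add: field_simps power2_eq_square)
qed

context reflected_OU_process
begin

context
  fixes u :: real
begin

definition corr :: real where "corr = u\<^sup>2 / 2"

definition phase :: "real \<Rightarrow> complex" where "phase y = exp (- (\<i> * of_real (u * OU.h y)))"

text \<open>The phase subtracts h from \<open>L\<close> in the exponent of the weight. The second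
  corrector enters as a factor 1 + u^2 k / 2 rather than in the exponent, which keeps the growth in
  y linear.\<close>

definition test_fun :: "real \<Rightarrow> complex" where
  "test_fun y = phase y * (1 + of_real corr * of_real (OU.k y))"

definition test_fun' :: "real \<Rightarrow> complex" where
  "test_fun' y = phase y * (- \<i> * of_real u * of_real (OU.h' y) * (1 + of_real corr * of_real (OU.k y)) + of_real corr * of_real (OU.k' y))"

definition test_fun'' :: "real \<Rightarrow> complex" where
  "test_fun'' y = phase y * (- (of_real u)\<^sup>2 * (of_real (OU.h' y))\<^sup>2 * (1 + of_real corr * of_real (OU.k y))
      - 2 * \<i> * of_real u * of_real corr * of_real (OU.h' y) * of_real (OU.k' y)
      - \<i> * of_real u * of_real (OU.h'' y) * (1 + of_real corr * of_real (OU.k y)) + of_real corr * of_real (OU.k'' y))"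

text \<open>The imaginary part centres \<open>L\<close> at q t; the real part compensates the
  expected Gaussian decay exp (- u^2 \<tau>^2 t / 2).\<close>

definition drift_const :: complex where
  "drift_const = - \<i> * of_real u * of_real OU.q + (of_real u)\<^sup>2 * of_real OU.\<tau>2 / 2"

lemma Re_drift_const: "Re drift_const = u\<^sup>2 * OU.\<tau>2 / 2"
  by (simp add: drift_const_def flip: of_real_power)

lemma norm_phase [simp]: "cmod (phase y) = 1"
  by (simp add: phase_def)

lemma vd_of_real: "(f has_real_derivative f') (at y) \<Longrightarrow> ((\<lambda>y. complex_of_real (f y)) has_vector_derivative of_real f') (at y)"
  by (rule has_vector_derivative_of_real) (simp add: has_real_derivative_iff_has_vector_derivative[symmetric])

lemma h'_deriv: "(OU.h' has_real_derivative OU.h'' y) (at y)"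
  by (rule OU.sol'_deriv) simp

lemmas vd_h = vd_of_real[OF OU.h_deriv] vd_of_real[OF h'_deriv]
lemmas vd_k = vd_of_real[OF OU.sol_deriv[OF OU.g_cont]] vd_of_real[OF OU.sol'_deriv[OF OU.g_cont]]

lemma phase_deriv: "(phase has_vector_derivative phase y * (- \<i> * of_real u * of_real (OU.h' y))) (at y)"
proof -
  have "((\<lambda>y. - \<i> * of_real u * of_real (OU.h y)) has_vector_derivative - \<i> * of_real u * of_real (OU.h' y)) (at y)"
    by (rule has_vector_derivative_mult_right[OF vd_h(1)])
  from field_vector_diff_chain_at[OF this DERIV_exp]
  show ?thesis by (simp add: phase_def[abs_def] o_def mult_ac)
qed

lemma test_fun_deriv: "(test_fun has_vector_derivative test_fun' y) (at y)"
proof -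
  have "((\<lambda>y. 1 + of_real corr * complex_of_real (OU.k y)) has_vector_derivative 0 + of_real corr * of_real (OU.k' y)) (at y)"
    by (intro has_vector_derivative_add has_vector_derivative_const has_vector_derivative_mult_right vd_k)
  from has_vector_derivative_mult[OF phase_deriv this]
  show ?thesis by (simp add: test_fun_def[abs_def] test_fun'_def algebra_simps)
qed

lemma test_fun'_deriv: "(test_fun' has_vector_derivative test_fun'' y) (at y)"
proof -
  have P: "((\<lambda>y. 1 + of_real corr * complex_of_real (OU.k y)) has_vector_derivative 0 + of_real corr * of_real (OU.k' y)) (at y)"
    by (intro has_vector_derivative_add has_vector_derivative_const has_vector_derivative_mult_right vd_k)
  have H: "((\<lambda>y. - \<i> * of_real u * of_real (OU.h' y)) has_vector_derivative - \<i> * of_real u * of_real (OU.h'' y)) (at y)"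
    by (rule has_vector_derivative_mult_right[OF vd_h(2)])
  have K: "((\<lambda>y. of_real corr * complex_of_real (OU.k' y)) has_vector_derivative of_real corr * of_real (OU.k'' y)) (at y)"
    by (rule has_vector_derivative_mult_right[OF vd_k(2)])
  from has_vector_derivative_mult[OF phase_deriv has_vector_derivative_add[OF has_vector_derivative_mult[OF H P] K]]
  show ?thesis unfolding test_fun'_def[abs_def]
    by (rule has_vector_derivative_eq_rhs) (simp add: test_fun''_def power2_eq_square algebra_simps)
qed

lemma k_cont: "continuous_on A OU.k"
  by (rule continuous_at_imp_continuous_on) (use OU.sol_deriv[OF OU.g_cont] DERIV_isCont in blast)

lemma h_cont: "continuous_on A OU.h"
  by (rule continuous_at_imp_continuous_on) (use OU.h_deriv DERIV_isCont in blast)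

lemma test_fun''_cont: "continuous_on UNIV test_fun''"
  unfolding test_fun''_def[abs_def] phase_def
  by (intro continuous_intros k_cont h_cont OU.h'_cont OU.sol'_cont[OF OU.g_cont] OU.sol''_cont[OF OU.g_cont] OU.sol''_cont continuous_on_const)

text \<open>Here h(0) = k(0) = 0, h'(0) = 1 and k'(0) = 0 come together: the slope - i u of the test
  function at 0 offsets the rotation of the weight while \<open>L\<close> grows.\<close>

lemma test_fun_boundary: "test_fun' 0 + \<i> * u * test_fun 0 = 0"
proof -
  have h0: "OU.h 0 = 0" using OU.sol_0(1)[of 1 "\<lambda>_. - OU.q"] unfolding OU.h_eq .
  show ?thesis by (simp add: test_fun_def test_fun'_def phase_def h0)
qed

lemma test_fun_generator:
  "drift_const * test_fun y + generator test_fun' test_fun'' y =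
     phase y * (of_real corr * of_real (OU.k y) * ((of_real u)\<^sup>2 * of_real OU.\<tau>2 / 2 - of_real (\<sigma>\<^sup>2 / 2) * (of_real u)\<^sup>2 * (of_real (OU.h' y))\<^sup>2)
       - 2 * \<i> * of_real (\<sigma>\<^sup>2 / 2) * of_real u * of_real corr * of_real (OU.h' y) * of_real (OU.k' y))"
proof -
  have h: "complex_of_real (\<sigma>\<^sup>2 / 2) * of_real (OU.h'' y) + of_real (\<alpha> - \<gamma> * y) * of_real (OU.h' y) = - of_real OU.q"
    using OU.poisson_equation[of 1 "\<lambda>_. - OU.q" y] by (simp only: of_real_mult[symmetric] of_real_add[symmetric] of_real_minus[symmetric])
  have "\<sigma>\<^sup>2 / 2 * OU.k'' y + (\<alpha> - \<gamma> * y) * OU.k' y = 2 * (\<sigma>\<^sup>2 / 2) * (OU.h' y)\<^sup>2 - OU.\<tau>2"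
    using OU.poisson_equation[of 0 OU.g y] by (simp add: OU.g_def)
  then have "complex_of_real (\<sigma>\<^sup>2 / 2 * OU.k'' y + (\<alpha> - \<gamma> * y) * OU.k' y) = of_real (2 * (\<sigma>\<^sup>2 / 2) * (OU.h' y)\<^sup>2 - OU.\<tau>2)"
    by (rule arg_cong)
  then have k: "complex_of_real (\<sigma>\<^sup>2 / 2) * of_real (OU.k'' y) + of_real (\<alpha> - \<gamma> * y) * of_real (OU.k' y)
      = 2 * complex_of_real (\<sigma>\<^sup>2 / 2) * (of_real (OU.h' y))\<^sup>2 - of_real OU.\<tau>2"
    by (simp only: of_real_mult of_real_add of_real_diff of_real_power of_real_numeral)
  have c: "complex_of_real corr = (of_real u)\<^sup>2 / 2" by (simp add: corr_def)
  note id = corrector_identity[OF c h k, of "of_real (OU.k y)"]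
  have factor: "A * (E0 * P) + (E0 * Q * D + E0 * R * S) = E0 * (A * P + (Q * D + R * S))"
    for A E0 P Q D R S :: complex by (simp add: algebra_simps)
  show ?thesis unfolding test_fun_def test_fun'_def test_fun''_def generator_def drift_const_def factor id ..
qed

end



section \<open>Size of the test function and of its residual drift\<close>

lemma corr_nonneg: "corr u \<ge> 0" by (simp add: corr_def)

lemma norm_one_plus_corr_k:
  assumes "\<bar>OU.k y\<bar> \<le> B * y"
  shows "cmod (1 + of_real (corr u) * of_real (OU.k y)) \<le> 1 + corr u * B * y"
proof -
  have "cmod (1 + of_real (corr u) * of_real (OU.k y)) \<le> 1 + corr u * \<bar>OU.k y\<bar>"
    by (rule order_trans[OF norm_triangle_ineq]) (simp add: norm_mult corr_nonneg)
  also have "\<dots> \<le> 1 + corr u * (B * y)" using assms corr_nonneg[of u] by (intro add_left_mono mult_left_mono) auto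
  finally show ?thesis by simp
qed

text \<open>A common envelope for the three function bounds of \<open>dynkin_limit\<close>; being
  affine in y, it is square integrable along \<open>Y\<close> by
  \<open>second_moment\<close>.\<close>

definition growth_bound :: "real \<Rightarrow> real \<Rightarrow> real \<Rightarrow> real" where
  "growth_bound B u y = (1 + \<bar>u\<bar> * B + u\<^sup>2 * B\<^sup>2) * (1 + corr u * B * y) + (corr u * B + 2 * \<bar>u\<bar> * corr u * B\<^sup>2)"

lemma test_fun_bounds:
  assumes B: "B \<ge> 1" and y: "y \<ge> 0"
    and b: "\<bar>OU.h' y\<bar> * (1 + y) \<le> B" "\<bar>OU.k' y\<bar> * (1 + y) \<le> B" "\<bar>OU.h' y\<bar> \<le> B" "\<bar>OU.k' y\<bar> \<le> B"
      "\<bar>OU.h'' y\<bar> \<le> B" "\<bar>OU.k'' y\<bar> \<le> B" "\<bar>OU.k y\<bar> \<le> B * y"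
  shows "cmod (test_fun u y) \<le> growth_bound B u y" "cmod (test_fun' u y) * (1 + y) \<le> growth_bound B u y" "cmod (test_fun'' u y) \<le> growth_bound B u y"
proof -
  let ?P = "1 + corr u * B * y"
  note P = norm_one_plus_corr_k[OF b(7), of u]
  have c0: "corr u \<ge> 0" by (rule corr_nonneg)
  have P1: "1 \<le> ?P" using c0 B y by simp
  have n: "0 \<le> corr u * B" "0 \<le> 2 * \<bar>u\<bar> * corr u * B\<^sup>2" "0 \<le> \<bar>u\<bar> * B * ?P" "0 \<le> u\<^sup>2 * B\<^sup>2 * ?P"
    using c0 B P1 by simp_all
  have bexp: "growth_bound B u y = ?P + \<bar>u\<bar> * B * ?P + u\<^sup>2 * B\<^sup>2 * ?P + corr u * B + 2 * \<bar>u\<bar> * corr u * B\<^sup>2"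
    unfolding growth_bound_def by (simp only: distrib_right mult_1 add.assoc)
  show "cmod (test_fun u y) \<le> growth_bound B u y"
    unfolding bexp test_fun_def norm_mult norm_phase using P n by linarith
  show "cmod (test_fun' u y) * (1 + y) \<le> growth_bound B u y"
  proof -
    have "cmod (test_fun' u y) \<le> \<bar>u\<bar> * \<bar>OU.h' y\<bar> * ?P + corr u * \<bar>OU.k' y\<bar>"
    proof -
      have "cmod (test_fun' u y) \<le> \<bar>u\<bar> * \<bar>OU.h' y\<bar> * cmod (1 + of_real (corr u) * of_real (OU.k y)) + corr u * \<bar>OU.k' y\<bar>"
        unfolding test_fun'_def norm_mult[of "phase u y"] norm_phase mult_1
        by (rule order_trans[OF norm_triangle_ineq]) (simp add: norm_mult c0)
      also have "\<dots> \<le> \<bar>u\<bar> * \<bar>OU.h' y\<bar> * ?P + corr u * \<bar>OU.k' y\<bar>"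
        by (intro add_right_mono mult_left_mono P) auto
      finally show ?thesis .
    qed
    then have "cmod (test_fun' u y) * (1 + y) \<le> (\<bar>u\<bar> * \<bar>OU.h' y\<bar> * ?P + corr u * \<bar>OU.k' y\<bar>) * (1 + y)"
      using y by (intro mult_right_mono) auto
    also have "\<dots> = \<bar>u\<bar> * ?P * (\<bar>OU.h' y\<bar> * (1 + y)) + corr u * (\<bar>OU.k' y\<bar> * (1 + y))" by (simp add: algebra_simps)
    also have "\<dots> \<le> \<bar>u\<bar> * ?P * B + corr u * B" using b c0 P1 by (intro add_mono mult_left_mono) auto
    also have "\<dots> = \<bar>u\<bar> * B * ?P + corr u * B" by (simp only: mult_ac)
    finally show ?thesis unfolding bexp using n P1 by linarith
  qed
  show "cmod (test_fun'' u y) \<le> growth_bound B u y"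
  proof -
    let ?Q = "1 + of_real (corr u) * of_real (OU.k y) :: complex"
    have "cmod (test_fun'' u y) \<le> u\<^sup>2 * \<bar>OU.h' y\<bar>\<^sup>2 * cmod ?Q + 2 * \<bar>u\<bar> * corr u * \<bar>OU.h' y\<bar> * \<bar>OU.k' y\<bar> + \<bar>u\<bar> * \<bar>OU.h'' y\<bar> * cmod ?Q + corr u * \<bar>OU.k'' y\<bar>"
      unfolding test_fun''_def norm_mult[of "phase u y"] norm_phase mult_1
      by (rule order_trans[OF norm_triangle_ineq], rule add_mono, rule order_trans[OF norm_triangle_ineq4], rule add_mono,
          rule order_trans[OF norm_triangle_ineq4], rule add_mono)
         (simp_all add: norm_mult norm_power c0)
    also have "\<dots> \<le> u\<^sup>2 * B\<^sup>2 * ?P + 2 * \<bar>u\<bar> * corr u * B * B + \<bar>u\<bar> * B * ?P + corr u * B"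
    proof (intro add_mono)
      have hh: "\<bar>OU.h' y\<bar>\<^sup>2 \<le> B\<^sup>2" using b(3) by (intro power_mono) auto
      show "u\<^sup>2 * \<bar>OU.h' y\<bar>\<^sup>2 * cmod ?Q \<le> u\<^sup>2 * B\<^sup>2 * ?P"
        by (rule mult_mono[OF mult_left_mono[OF hh] P]) auto
      have hk: "\<bar>OU.h' y\<bar> * \<bar>OU.k' y\<bar> \<le> B * B" using b B by (intro mult_mono) auto
      have "2 * \<bar>u\<bar> * corr u * (\<bar>OU.h' y\<bar> * \<bar>OU.k' y\<bar>) \<le> 2 * \<bar>u\<bar> * corr u * (B * B)"
        by (rule mult_left_mono[OF hk]) (use c0 in simp)
      then show "2 * \<bar>u\<bar> * corr u * \<bar>OU.h' y\<bar> * \<bar>OU.k' y\<bar> \<le> 2 * \<bar>u\<bar> * corr u * B * B" by (simp only: mult.assoc)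
      show "\<bar>u\<bar> * \<bar>OU.h'' y\<bar> * cmod ?Q \<le> \<bar>u\<bar> * B * ?P"
        by (rule mult_mono[OF mult_left_mono[OF b(5)] P]) (use B in auto)
      show "corr u * \<bar>OU.k'' y\<bar> \<le> corr u * B" by (rule mult_left_mono[OF b(6) c0])
    qed
    also have "\<dots> = u\<^sup>2 * B\<^sup>2 * ?P + 2 * \<bar>u\<bar> * corr u * B\<^sup>2 + \<bar>u\<bar> * B * ?P + corr u * B" by (simp only: power2_eq_square mult.assoc)
    finally show ?thesis unfolding bexp using P1 by linarith
  qed
qed

text \<open>The factor y stems from |k| <= B y. With u = \<theta> / sqrt T and E Y = O(sqrt T), each
  summand contributes O(1 / sqrt T) over [0,T].\<close>

lemma test_fun_generator_bound:
  assumes B: "B \<ge> 1" and y: "y \<ge> 0" and b: "\<bar>OU.h' y\<bar> \<le> B" "\<bar>OU.k' y\<bar> \<le> B" "\<bar>OU.k y\<bar> \<le> B * y"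
  shows "cmod (drift_const u * test_fun u y + generator (test_fun' u) (test_fun'' u) y)
     \<le> u^4 * (B * (OU.\<tau>2 + \<sigma>\<^sup>2 * B\<^sup>2)) * y + \<bar>u\<bar>^3 * (\<sigma>\<^sup>2 * B\<^sup>2)"
proof -
  have c0: "corr u \<ge> 0" by (rule corr_nonneg)
  have t0: "OU.\<tau>2 \<ge> 0" using OU.tau2_pos by simp
  let ?A = "of_real (corr u) * of_real (OU.k y) * ((of_real u)\<^sup>2 * of_real OU.\<tau>2 / 2 - of_real (\<sigma>\<^sup>2 / 2) * (of_real u)\<^sup>2 * (of_real (OU.h' y))\<^sup>2) :: complex"
  let ?C = "2 * \<i> * of_real (\<sigma>\<^sup>2 / 2) * of_real u * of_real (corr u) * of_real (OU.h' y) * of_real (OU.k' y) :: complex"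
  have h2: "\<bar>OU.h' y\<bar>\<^sup>2 \<le> B\<^sup>2" using b(1) by (intro power_mono) auto
  have "cmod ?A \<le> (corr u * (B * y)) * (u\<^sup>2 * OU.\<tau>2 / 2 + \<sigma>\<^sup>2 / 2 * u\<^sup>2 * B\<^sup>2)"
  proof -
    have "cmod ((of_real u)\<^sup>2 * of_real OU.\<tau>2 / 2 - of_real (\<sigma>\<^sup>2 / 2) * (of_real u)\<^sup>2 * (of_real (OU.h' y))\<^sup>2) \<le> u\<^sup>2 * OU.\<tau>2 / 2 + \<sigma>\<^sup>2 / 2 * u\<^sup>2 * \<bar>OU.h' y\<bar>\<^sup>2"
      by (rule order_trans[OF norm_triangle_ineq4]) (use t0 in \<open>simp add: norm_mult norm_power norm_divide\<close>)
    also have "\<dots> \<le> u\<^sup>2 * OU.\<tau>2 / 2 + \<sigma>\<^sup>2 / 2 * u\<^sup>2 * B\<^sup>2" using h2 by (intro add_left_mono mult_left_mono) auto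
    finally have 1: "cmod ((of_real u)\<^sup>2 * of_real OU.\<tau>2 / 2 - of_real (\<sigma>\<^sup>2 / 2) * (of_real u)\<^sup>2 * (of_real (OU.h' y))\<^sup>2) \<le> u\<^sup>2 * OU.\<tau>2 / 2 + \<sigma>\<^sup>2 / 2 * u\<^sup>2 * B\<^sup>2" .
    have 2: "cmod (of_real (corr u) * of_real (OU.k y)) \<le> corr u * (B * y)"
      using b(3) c0 by (simp add: norm_mult mult_left_mono)
    show ?thesis unfolding norm_mult[of "of_real (corr u) * of_real (OU.k y)"]
      by (intro mult_mono 1 2) (use c0 B y in auto)
  qed
  also have "\<dots> = u^4 * (B * (OU.\<tau>2 + \<sigma>\<^sup>2 * B\<^sup>2)) * y / 4"
    unfolding corr_def by (simp add: power2_eq_square power4_eq_xxxx algebra_simps)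
  also have "\<dots> \<le> u^4 * (B * (OU.\<tau>2 + \<sigma>\<^sup>2 * B\<^sup>2)) * y"
  proof -
    have "0 \<le> u^4 * (B * (OU.\<tau>2 + \<sigma>\<^sup>2 * B\<^sup>2)) * y" using B y t0 by simp
    then show ?thesis by linarith
  qed
  finally have A: "cmod ?A \<le> u^4 * (B * (OU.\<tau>2 + \<sigma>\<^sup>2 * B\<^sup>2)) * y" .
  have "cmod ?C = \<sigma>\<^sup>2 * \<bar>u\<bar> * corr u * (\<bar>OU.h' y\<bar> * \<bar>OU.k' y\<bar>)" using c0 by (simp add: norm_mult norm_divide norm_power)
  also have "\<dots> \<le> \<sigma>\<^sup>2 * \<bar>u\<bar> * corr u * (B * B)" using b B c0 by (intro mult_left_mono mult_mono) auto
  also have "\<dots> = \<bar>u\<bar>^3 * (\<sigma>\<^sup>2 * B\<^sup>2) / 2"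
  proof -
    have "corr u = \<bar>u\<bar> * \<bar>u\<bar> / 2" by (simp add: corr_def power2_eq_square)
    then show ?thesis by (simp add: power2_eq_square power3_eq_cube)
  qed
  also have "\<dots> \<le> \<bar>u\<bar>^3 * (\<sigma>\<^sup>2 * B\<^sup>2)" by simp
  finally have C: "cmod ?C \<le> \<bar>u\<bar>^3 * (\<sigma>\<^sup>2 * B\<^sup>2)" .
  have "cmod (drift_const u * test_fun u y + generator (test_fun' u) (test_fun'' u) y) = cmod (?A - ?C)"
    unfolding test_fun_generator norm_mult[of "phase u y"] norm_phase by simp
  also have "\<dots> \<le> cmod ?A + cmod ?C" by (rule norm_triangle_ineq4)
  finally show ?thesis using A C by linarith
qed

text \<open>\<open>H\<close> and \<open>K\<close> stay free because the estimate serves twice: at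
  the starting point with ln (1 + x), and at \<open>Y T\<close> with the bound of
  \<open>ln_le_split\<close>.\<close>

lemma norm_tf_minus_1:
  assumes "\<bar>OU.h y\<bar> \<le> B * H" "\<bar>OU.k y\<bar> \<le> B * K"
  shows "cmod (test_fun u y - 1) \<le> \<bar>u\<bar> * (B * H) + u\<^sup>2 * (B * K)"
proof -
  have c: "0 \<le> corr u" "corr u \<le> u\<^sup>2" by (simp_all add: corr_def)
  have "test_fun u y - 1 = (phase u y - 1) + phase u y * (of_real (corr u) * of_real (OU.k y))"
    by (simp add: test_fun_def algebra_simps)
  then have "cmod (test_fun u y - 1) \<le> cmod (phase u y - 1) + cmod (phase u y * (of_real (corr u) * of_real (OU.k y)))"
    by (metis norm_triangle_ineq)
  also have "\<dots> \<le> \<bar>u * OU.h y\<bar> + corr u * \<bar>OU.k y\<bar>"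
  proof (rule add_mono)
    show "cmod (phase u y - 1) \<le> \<bar>u * OU.h y\<bar>" unfolding phase_def by (rule norm_exp_i_minus_1)
    show "cmod (phase u y * (of_real (corr u) * of_real (OU.k y))) \<le> corr u * \<bar>OU.k y\<bar>" using c by (simp add: norm_mult)
  qed
  also have "\<dots> \<le> \<bar>u\<bar> * (B * H) + u\<^sup>2 * (B * K)"
    unfolding abs_mult using assms c by (intro add_mono mult_left_mono mult_mono) auto
  finally show ?thesis .
qed


section \<open>Convergence in distribution\<close>


abbreviation tilt :: "real \<Rightarrow> real \<Rightarrow> 'a \<Rightarrow> complex" where
  "tilt \<theta> T \<equiv> weight (drift_const (\<theta> / sqrt T)) (\<theta> / sqrt T) T"

definition rate where "rate = 1 + x\<^sup>2 + moment_rate"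

lemma rate_ge_1: "rate \<ge> 1" using moment_rate_pos by (simp add: rate_def)

lemma weight_expectation_bound:
  assumes t: "t \<ge> 0" and g: "g \<in> borel_measurable borel" and q: "integrable M (\<lambda>\<omega>. q (Y t \<omega>))"
    and bnd: "\<And>y. y \<ge> 0 \<Longrightarrow> cmod (g y) \<le> q y"
  shows "cmod (expectation (\<lambda>\<omega>. weight a u t \<omega> * g (Y t \<omega>))) \<le> exp (Re a * t) * expectation (\<lambda>\<omega>. q (Y t \<omega>))"
proof -
  note [measurable] = g rv(1)[OF t] weight_measurable[OF t]
  have qi: "integrable M (\<lambda>\<omega>. exp (Re a * t) * q (Y t \<omega>))" using q by simp
  have le: "AE \<omega> in M. cmod (weight a u t \<omega> * g (Y t \<omega>)) \<le> exp (Re a * t) * q (Y t \<omega>)"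
    using AE_Y_nonneg[OF t] by eventually_elim (simp add: norm_mult norm_weight bnd)
  have int: "integrable M (\<lambda>\<omega>. weight a u t \<omega> * g (Y t \<omega>))"
  proof (rule Bochner_Integration.integrable_bound[OF qi])
    show "AE \<omega> in M. norm (weight a u t \<omega> * g (Y t \<omega>)) \<le> norm (exp (Re a * t) * q (Y t \<omega>))"
      using le
    proof eventually_elim
      case (elim \<omega>)
      show ?case unfolding real_norm_def by (rule order_trans[OF elim abs_ge_self])
    qed
  qed measurable
  have "cmod (expectation (\<lambda>\<omega>. weight a u t \<omega> * g (Y t \<omega>))) \<le> expectation (\<lambda>\<omega>. cmod (weight a u t \<omega> * g (Y t \<omega>)))"
    by (rule integral_norm_bound)
  also have "\<dots> \<le> expectation (\<lambda>\<omega>. exp (Re a * t) * q (Y t \<omega>))"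
    by (rule integral_mono_AE[OF integrable_norm[OF int] qi le])
  finally have "cmod (expectation (\<lambda>\<omega>. weight a u t \<omega> * g (Y t \<omega>))) \<le> expectation (\<lambda>\<omega>. exp (Re a * t) * q (Y t \<omega>))" .
  then show ?thesis by simp
qed

text \<open>Dynkin's formula for the test function. Every Riemann sum has 2^n terms of mesh T / 2^n,
  each within the residual bound, so the limit is at most T times that bound.\<close>

lemma perturbed_martingale_estimate:
  fixes \<theta> :: real
  obtains D where "\<And>T. T \<ge> 1 \<Longrightarrow>
    cmod (expectation (\<lambda>\<omega>. tilt \<theta> T \<omega> * test_fun (\<theta> / sqrt T) (Y T \<omega>)) - test_fun (\<theta> / sqrt T) x) \<le> D / sqrt T"
proof -
  obtain B where B: "B \<ge> 1"
    "\<And>y. y \<ge> 0 \<Longrightarrow> \<bar>OU.h' y\<bar> * (1 + y) \<le> B" "\<And>y. y \<ge> 0 \<Longrightarrow> \<bar>OU.k' y\<bar> * (1 + y) \<le> B"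
    "\<And>y. y \<ge> 0 \<Longrightarrow> \<bar>OU.h' y\<bar> \<le> B" "\<And>y. y \<ge> 0 \<Longrightarrow> \<bar>OU.k' y\<bar> \<le> B"
    "\<And>y. y \<ge> 0 \<Longrightarrow> \<bar>OU.h'' y\<bar> \<le> B" "\<And>y. y \<ge> 0 \<Longrightarrow> \<bar>OU.k'' y\<bar> \<le> B"
    "\<And>y. y \<ge> 0 \<Longrightarrow> \<bar>OU.h y\<bar> \<le> B * ln (1 + y)" "\<And>y. y \<ge> 0 \<Longrightarrow> \<bar>OU.k y\<bar> \<le> B * y"
    using OU.coefficient_bounds by blast
  define C1 where "C1 = B * (OU.\<tau>2 + \<sigma>\<^sup>2 * B\<^sup>2)"
  define C2 where "C2 = \<sigma>\<^sup>2 * B\<^sup>2"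
  have C: "0 \<le> C1" "0 \<le> C2" using B(1) OU.tau2_pos by (simp_all add: C1_def C2_def)
  define E where "E = exp (\<theta>\<^sup>2 * OU.\<tau>2 / 2)"
  show thesis
  proof (rule that[of "E * (\<theta>^4 * C1 * rate + \<bar>\<theta>\<bar>^3 * C2)"])
    fix T :: real assume T: "T \<ge> 1"
    then have T0: "T > 0" by simp
    define r where "r = sqrt T"
    have r: "r \<ge> 1" "r * r = T" using T by (simp_all add: r_def)
    define u where "u = \<theta> / r"
    let ?a = "drift_const u"
    have u2: "u\<^sup>2 * T = \<theta>\<^sup>2" using r T by (simp add: u_def power_divide power2_eq_square)
    let ?b = "growth_bound B u"
    define b0 where "b0 = (1 + \<bar>u\<bar> * B + u\<^sup>2 * B\<^sup>2) + (corr u * B + 2 * \<bar>u\<bar> * corr u * B\<^sup>2)"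
    define b1 where "b1 = (1 + \<bar>u\<bar> * B + u\<^sup>2 * B\<^sup>2) * (corr u * B)"
    have b_lin: "?b y = b0 + b1 * y" for y unfolding growth_bound_def b0_def b1_def by (simp add: algebra_simps)
    have bm: "?b \<in> borel_measurable borel" unfolding b_lin[abs_def] by measurable
    have b_le: "(?b y)\<^sup>2 \<le> 2 * b0\<^sup>2 + 2 * b1\<^sup>2 * y\<^sup>2" for y
      unfolding b_lin using sum_squares_bound[of b0 "b1 * y"] by (simp add: power2_sum power_mult_distrib)
    have b_int: "integrable M (\<lambda>\<omega>. (?b (Y t \<omega>))\<^sup>2)" if "t \<ge> 0" for t
    proof (rule Bochner_Integration.integrable_bound)
      show "integrable M (\<lambda>\<omega>. 2 * b0\<^sup>2 + 2 * b1\<^sup>2 * (Y t \<omega>)\<^sup>2)" using second_moment(1)[OF that] by simp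
      show "(\<lambda>\<omega>. (?b (Y t \<omega>))\<^sup>2) \<in> borel_measurable M" using bm rv(1)[OF that] by measurable
      show "AE \<omega> in M. norm ((?b (Y t \<omega>))\<^sup>2) \<le> norm (2 * b0\<^sup>2 + 2 * b1\<^sup>2 * (Y t \<omega>)\<^sup>2)"
        unfolding real_norm_def abs_power2 by (intro AE_I2 order_trans[OF b_le abs_ge_self])
    qed
    \<comment> \<open>Grows with T, but only provides the finite L2 bound for
      \<open>dynkin_limit\<close>; the final constant is independent of it.\<close>
    define K where "K = 2 * b0\<^sup>2 + 2 * b1\<^sup>2 * (x\<^sup>2 + moment_rate * T)"
    have b_K: "expectation (\<lambda>\<omega>. (?b (Y t \<omega>))\<^sup>2) \<le> K" if "0 \<le> t" "t \<le> T" for t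
    proof -
      have "expectation (\<lambda>\<omega>. (?b (Y t \<omega>))\<^sup>2) \<le> expectation (\<lambda>\<omega>. 2 * b0\<^sup>2 + 2 * b1\<^sup>2 * (Y t \<omega>)\<^sup>2)"
        using second_moment(1)[OF that(1)] by (intro integral_mono b_int[OF that(1)] b_le) simp
      also have "\<dots> = 2 * b0\<^sup>2 + 2 * b1\<^sup>2 * expectation (\<lambda>\<omega>. (Y t \<omega>)\<^sup>2)"
        using second_moment(1)[OF that(1)] by (simp add: prob_space)
      also have "\<dots> \<le> 2 * b0\<^sup>2 + 2 * b1\<^sup>2 * (x\<^sup>2 + moment_rate * t)"
        using second_moment(2)[OF that(1)] by (intro add_left_mono mult_left_mono) auto
      also have "\<dots> \<le> K" unfolding K_def using that moment_rate_pos by (intro add_left_mono mult_left_mono) auto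
      finally show ?thesis .
    qed
    have bnds: "cmod (test_fun u y) \<le> ?b y" "cmod (test_fun' u y) * (1 + y) \<le> ?b y" "cmod (test_fun'' u y) \<le> ?b y" if "y \<ge> 0" for y
      by (rule test_fun_bounds[OF B(1) that B(2)[OF that] B(3)[OF that] B(4)[OF that] B(5)[OF that] B(6)[OF that] B(7)[OF that] B(9)[OF that]])+
    note lim = dynkin_limit[where a = ?a, OF T0 test_fun_deriv test_fun'_deriv test_fun''_cont test_fun_boundary bnds b_int b_K]
    let ?G = "\<lambda>y. ?a * test_fun u y + generator (test_fun' u) (test_fun'' u) y"
    have Gm: "?G \<in> borel_measurable borel"
    proof -
      have "continuous_on UNIV (test_fun u)" "continuous_on UNIV (test_fun' u)"
        using test_fun_deriv test_fun'_deriv by (auto intro!: continuous_at_imp_continuous_on has_vector_derivative_continuous)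
      then have [measurable]: "test_fun u \<in> borel_measurable borel" "test_fun' u \<in> borel_measurable borel" "test_fun'' u \<in> borel_measurable borel"
        using test_fun''_cont by (auto intro: borel_measurable_continuous_onI)
      show ?thesis unfolding generator_def by measurable
    qed
    \<comment> \<open>The real part of the exponent is nonnegative, so the bound is largest at t =
      T, where u^2 T = \<theta>^2 makes it free of T.\<close>
    have E1: "exp (Re ?a * t) \<le> E" if "t \<le> T" for t
    proof -
      have "Re ?a * t \<le> Re ?a * T" unfolding Re_drift_const using that OU.tau2_pos by (intro mult_left_mono) auto
      also have "\<dots> = \<theta>\<^sup>2 * OU.\<tau>2 / 2" unfolding Re_drift_const u2[symmetric] by simp
      finally show ?thesis by (simp add: E_def)
    qed
    have E0: "E > 0" by (simp add: E_def)
    let ?V = "\<lambda>t. expectation (\<lambda>\<omega>. weight ?a u t \<omega> * ?G (Y t \<omega>))"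
    let ?q = "u^4 * C1 * (rate * r) + \<bar>u\<bar>^3 * C2"
    have q0: "0 \<le> ?q" using C r rate_ge_1 by simp
    have term_le: "cmod (?V t) \<le> E * ?q" if t: "0 \<le> t" "t \<le> T" for t
    proof -
      note m = first_moment[OF t T]
      have "cmod (?V t) \<le> exp (Re ?a * t) * expectation (\<lambda>\<omega>. u^4 * C1 * Y t \<omega> + \<bar>u\<bar>^3 * C2)"
      proof (rule weight_expectation_bound[OF t(1) Gm])
        show "integrable M (\<lambda>\<omega>. u^4 * C1 * Y t \<omega> + \<bar>u\<bar>^3 * C2)" using m(1) by simp
        show "cmod (?G y) \<le> u^4 * C1 * y + \<bar>u\<bar>^3 * C2" if "y \<ge> 0" for y
          unfolding C1_def C2_def by (rule test_fun_generator_bound[OF B(1) that B(4)[OF that] B(5)[OF that] B(9)[OF that]])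
      qed
      also have "expectation (\<lambda>\<omega>. u^4 * C1 * Y t \<omega> + \<bar>u\<bar>^3 * C2) = u^4 * C1 * expectation (Y t) + \<bar>u\<bar>^3 * C2"
        using m(1) by (simp add: prob_space)
      also have "exp (Re ?a * t) * (u^4 * C1 * expectation (Y t) + \<bar>u\<bar>^3 * C2) \<le> exp (Re ?a * t) * ?q"
      proof (intro mult_left_mono add_right_mono)
        show "expectation (Y t) \<le> rate * r" using m(2) by (simp add: rate_def r_def)
      qed (use C in auto)
      also have "\<dots> \<le> E * ?q" by (rule mult_right_mono[OF E1[OF t(2)] q0])
      finally show ?thesis .
    qed
    have "cmod (expectation (\<lambda>\<omega>. weight ?a u T \<omega> * test_fun u (Y T \<omega>)) - test_fun u x) \<le> T * (E * ?q)"
    proof (rule Lim_norm_ubound[OF _ lim])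
      show "\<forall>\<^sub>F n in sequentially. cmod (\<Sum>i<2^n. ?V (grid T n i) * of_real (T / 2^n)) \<le> T * (E * ?q)"
      proof (intro always_eventually allI)
        fix n :: nat
        have "cmod (\<Sum>i<2^n. ?V (grid T n i) * of_real (T / 2^n))
           \<le> (\<Sum>i<(2::nat)^n. E * ?q * (T / 2^n))"
        proof (rule sum_norm_le)
          fix i :: nat assume i: "i \<in> {..<2^n}"
          have "cmod (?V (grid T n i)) \<le> E * ?q"
            by (rule term_le) (use grid_bounds(1)[OF T0, of n i] grid_bounds(3)[OF T0, of i n] i in auto)
          then have "cmod (?V (grid T n i)) * (T / 2^n) \<le> E * ?q * (T / 2^n)"
            by (rule mult_right_mono) (use T0 in simp)
          moreover have "cmod (of_real (T / 2^n)) = T / 2^n" using T0 unfolding norm_of_real by simp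
          ultimately show "cmod (?V (grid T n i) * of_real (T / 2^n)) \<le> E * ?q * (T / 2^n)"
            by (simp only: norm_mult)
        qed
        also have "\<dots> = T * (E * ?q)" by simp
        finally show "cmod (\<Sum>i<2^n. ?V (grid T n i) * of_real (T / 2^n)) \<le> T * (E * ?q)" .
      qed
    qed simp
    \<comment> \<open>Scaling with u = \<theta> / r and T = r^2: T u^4 r = \<theta>^4 / r and T
      |u|^3 = |\<theta>|^3 / r.\<close>
    also have "T * (E * ?q) = E * (\<theta>^4 * C1 * rate + \<bar>\<theta>\<bar>^3 * C2) / r"
    proof -
      have r0: "r \<noteq> 0" "\<bar>r\<bar> = r" using r by auto
      have "r * r * (\<theta> ^ 4 / r ^ 4 * r) = \<theta> ^ 4 / r" using r0(1) by (simp add: power4_eq_xxxx)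
      then have 4: "T * (u^4 * r) = \<theta>^4 / r" by (simp only: r(2) u_def power_divide)
      have "r * r * (\<bar>\<theta>\<bar> ^ 3 / r ^ 3) = \<bar>\<theta>\<bar> ^ 3 / r" using r0(1) by (simp add: power3_eq_cube)
      then have 3: "T * \<bar>u\<bar>^3 = \<bar>\<theta>\<bar>^3 / r" by (simp only: r(2) u_def power_divide abs_divide r0(2))
      have "T * ?q = (T * (u^4 * r)) * (C1 * rate) + (T * \<bar>u\<bar>^3) * C2" by (simp only: distrib_left mult_ac)
      also have "\<dots> = (\<theta>^4 * C1 * rate + \<bar>\<theta>\<bar>^3 * C2) / r" unfolding 3 4 by (simp add: add_divide_distrib)
      finally have "T * ?q = (\<theta>^4 * C1 * rate + \<bar>\<theta>\<bar>^3 * C2) / r" .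
      then show ?thesis by (metis mult.left_commute times_divide_eq_right)
    qed
    finally show "cmod (expectation (\<lambda>\<omega>. tilt \<theta> T \<omega> * test_fun (\<theta> / sqrt T) (Y T \<omega>)) - test_fun (\<theta> / sqrt T) x)
        \<le> E * (\<theta>^4 * C1 * rate + \<bar>\<theta>\<bar>^3 * C2) / sqrt T"
      unfolding u_def r_def .
  qed
qed

lemma weight_tendsto_1:
  fixes \<theta> :: real
  shows "((\<lambda>T. expectation (tilt \<theta> T)) \<longlongrightarrow> 1) at_top"
proof -
  obtain D where D: "\<And>T. T \<ge> 1 \<Longrightarrow>
    cmod (expectation (\<lambda>\<omega>. tilt \<theta> T \<omega> * test_fun (\<theta> / sqrt T) (Y T \<omega>)) - test_fun (\<theta> / sqrt T) x) \<le> D / sqrt T"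
    using perturbed_martingale_estimate by blast
  obtain B where B: "B \<ge> 1"
    "\<And>y. y \<ge> 0 \<Longrightarrow> \<bar>OU.h y\<bar> \<le> B * ln (1 + y)" "\<And>y. y \<ge> 0 \<Longrightarrow> \<bar>OU.k y\<bar> \<le> B * y"
    using OU.coefficient_bounds by metis
  define E where "E = exp (\<theta>\<^sup>2 * OU.\<tau>2 / 2)"
  define A1 where "A1 = B * (2 + rate) * \<bar>\<theta>\<bar> + B * rate * \<theta>\<^sup>2"
  define A2 where "A2 = \<bar>\<theta>\<bar> * (B * ln (1 + x)) + \<theta>\<^sup>2 * (B * x)"
  have est: "cmod (expectation (tilt \<theta> T) - 1) \<le> (E * A1) / sqrt (sqrt T) + (D + A2) / sqrt T" if T: "T \<ge> 1" for T
  proof -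
    have T0: "T \<ge> 0" using T by simp
    define r where "r = sqrt T"
    \<comment> \<open>s = T^(1/4) balances the two parts of \<open>ln_le_split\<close>, since E Y /
      s = O(r / s) = O(s).\<close>
    define s where "s = sqrt r"
    have r: "r \<ge> 1" "r * r = T" using T by (simp_all add: r_def)
    have s: "s \<ge> 1" "s * s = r" using r by (simp_all add: s_def)
    define u where "u = \<theta> / r"
    let ?w = "weight (drift_const u) u T"
    let ?X = "expectation (\<lambda>\<omega>. ?w \<omega> * test_fun u (Y T \<omega>))"
    let ?X1 = "expectation (\<lambda>\<omega>. ?w \<omega> * (test_fun u (Y T \<omega>) - 1))"
    have u2: "u\<^sup>2 * T = \<theta>\<^sup>2" using r T by (simp add: u_def power_divide power2_eq_square)
    have au: "\<bar>u\<bar> = \<bar>\<theta>\<bar> / r" using r by (simp add: u_def)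
    have u2': "u\<^sup>2 = \<theta>\<^sup>2 / (r * r)" by (simp add: u_def power_divide power2_eq_square)
    have RE: "exp (Re (drift_const u) * T) = E"
      unfolding Re_drift_const E_def u2[symmetric] by simp
    note m = first_moment[OF T0 order_refl T]
    note [measurable] = rv(1)[OF T0] weight_measurable[OF T0]
    have ct: "continuous_on UNIV (test_fun u)"
      using test_fun_deriv by (auto intro!: continuous_at_imp_continuous_on has_vector_derivative_continuous)
    then have [measurable]: "test_fun u \<in> borel_measurable borel" by (rule borel_measurable_continuous_onI)
    let ?q = "\<lambda>y. \<bar>u\<bar> * (B * (s + (1 + y) / s)) + u\<^sup>2 * (B * y)"
    have qb: "cmod (test_fun u y - 1) \<le> ?q y" if y: "y \<ge> 0" for y
    proof (rule norm_tf_minus_1)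
      show "\<bar>OU.k y\<bar> \<le> B * y" by (rule B(3)[OF y])
      have "B * ln (1 + y) \<le> B * (s + (1 + y) / s)" using B(1) s y by (intro mult_left_mono ln_le_split) auto
      then show "\<bar>OU.h y\<bar> \<le> B * (s + (1 + y) / s)" using B(2)[OF y] by linarith
    qed
    have qi: "integrable M (\<lambda>\<omega>. ?q (Y T \<omega>))" using m(1) by simp
    have diff: "cmod (?X1) \<le> E * expectation (\<lambda>\<omega>. ?q (Y T \<omega>))"
      using weight_expectation_bound[OF T0 _ qi qb, of "drift_const u" u] unfolding RE by simp
    have "expectation (\<lambda>\<omega>. ?q (Y T \<omega>)) = \<bar>u\<bar> * (B * (s + (1 + expectation (Y T)) / s)) + u\<^sup>2 * (B * expectation (Y T))"
      using m(1) by (simp add: prob_space)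
    also have "\<dots> \<le> \<bar>u\<bar> * (B * (s + (1 + rate * r) / s)) + u\<^sup>2 * (B * (rate * r))"
      using m(2) B(1) s by (intro add_mono mult_left_mono divide_right_mono) (auto simp: rate_def r_def)
    also have "\<dots> \<le> \<bar>u\<bar> * (B * (s + (r + rate * r) / s)) + u\<^sup>2 * (B * (rate * r))"
      using r B(1) s rate_ge_1 by (intro add_mono mult_left_mono divide_right_mono) auto
    also have "\<dots> = B * (2 + rate) * \<bar>\<theta>\<bar> / s + B * rate * \<theta>\<^sup>2 / r"
    proof -
      have nz: "s \<noteq> 0" "r \<noteq> 0" using s r by auto
      have "(r + rate * r) / s = (1 + rate) * s" unfolding s(2)[symmetric] using nz by (simp add: field_simps)
      then have "\<bar>u\<bar> * (B * (s + (r + rate * r) / s)) = \<bar>\<theta>\<bar> / (s * s) * (B * (s + (1 + rate) * s))" unfolding au s(2) by simp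
      also have "\<dots> = B * (2 + rate) * \<bar>\<theta>\<bar> / s" using nz by (simp add: field_simps)
      finally have 1: "\<bar>u\<bar> * (B * (s + (r + rate * r) / s)) = B * (2 + rate) * \<bar>\<theta>\<bar> / s" .
      have 2: "u\<^sup>2 * (B * (rate * r)) = B * rate * \<theta>\<^sup>2 / r" unfolding u2' using nz by (simp add: field_simps)
      show ?thesis unfolding 1 2 ..
    qed
    also have "\<dots> \<le> B * (2 + rate) * \<bar>\<theta>\<bar> / s + B * rate * \<theta>\<^sup>2 / s"
    proof -
      have "s * 1 \<le> s * s" using s by (intro mult_left_mono) auto
      then have "s \<le> r" using s by simp
      then show ?thesis using B(1) rate_ge_1 s r by (intro add_left_mono divide_left_mono) auto
    qed
    also have "\<dots> = A1 / s" by (simp add: A1_def add_divide_distrib)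
    finally have "expectation (\<lambda>\<omega>. ?q (Y T \<omega>)) \<le> A1 / s" .
    then have "E * expectation (\<lambda>\<omega>. ?q (Y T \<omega>)) \<le> E * (A1 / s)" by (rule mult_left_mono) (simp add: E_def)
    then have d1: "cmod (?X1) \<le> E * A1 / s" using diff by simp
    have wi: "integrable M ?w"
      by (rule integrable_const_bound[where B = E]) (use RE in \<open>auto simp: norm_weight\<close>)
    have di: "integrable M (\<lambda>\<omega>. ?w \<omega> * (test_fun u (Y T \<omega>) - 1))"
    proof (rule Bochner_Integration.integrable_bound)
      show "integrable M (\<lambda>\<omega>. E * ?q (Y T \<omega>))" using qi by (rule integrable_mult_right)
      show "AE \<omega> in M. norm (?w \<omega> * (test_fun u (Y T \<omega>) - 1)) \<le> norm (E * ?q (Y T \<omega>))"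
        using AE_Y_nonneg[OF T0]
      proof eventually_elim
        case (elim \<omega>)
        have "norm (?w \<omega> * (test_fun u (Y T \<omega>) - 1)) = E * cmod (test_fun u (Y T \<omega>) - 1)" by (simp add: norm_mult norm_weight RE)
        also have "\<dots> \<le> E * ?q (Y T \<omega>)" by (rule mult_left_mono[OF qb[OF elim]]) (simp add: E_def)
        finally show ?case using order_trans[OF _ abs_ge_self] by (simp only: real_norm_def)
      qed
    qed measurable
    have "?X = expectation (\<lambda>\<omega>. ?w \<omega> + ?w \<omega> * (test_fun u (Y T \<omega>) - 1))"
      by (simp add: algebra_simps)
    also have "\<dots> = expectation ?w + ?X1"
      by (rule Bochner_Integration.integral_add[OF wi di])
    \<comment> \<open>Three errors: the residual drift, the test function at the start, and the test
      function at time T.\<close>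
    finally have split: "expectation ?w - 1 = (?X - test_fun u x) + (test_fun u x - 1) - ?X1"
      by simp
    have d2: "cmod (?X - test_fun u x) \<le> D / r"
      using D[OF T] unfolding u_def r_def .
    have d3: "cmod (test_fun u x - 1) \<le> A2 / r"
    proof -
      have "cmod (test_fun u x - 1) \<le> \<bar>u\<bar> * (B * ln (1 + x)) + u\<^sup>2 * (B * x)"
        by (rule norm_tf_minus_1[OF B(2)[OF x_nonneg] B(3)[OF x_nonneg]])
      also have "\<dots> = \<bar>\<theta>\<bar> * (B * ln (1 + x)) / r + \<theta>\<^sup>2 * (B * x) / (r * r)" unfolding au u2' by simp
      also have "\<dots> \<le> \<bar>\<theta>\<bar> * (B * ln (1 + x)) / r + \<theta>\<^sup>2 * (B * x) / (r * 1)"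
        using r B(1) x_nonneg by (intro add_left_mono divide_left_mono mult_left_mono) auto
      also have "\<dots> = A2 / r" by (simp add: A2_def add_divide_distrib)
      finally show ?thesis .
    qed
    have "cmod (expectation ?w - 1) \<le> cmod (?X - test_fun u x) + cmod (test_fun u x - 1) + cmod (?X1)"
      unfolding split by (intro order_trans[OF norm_triangle_ineq4] add_right_mono norm_triangle_ineq)
    also have "\<dots> \<le> D / r + A2 / r + E * A1 / s" by (intro add_mono d1 d2 d3)
    finally show ?thesis unfolding u_def s_def r_def by (simp add: add_divide_distrib)
  qed
  have "((\<lambda>T. (E * A1) / sqrt (sqrt T) + (D + A2) / sqrt T) \<longlongrightarrow> 0 + 0) at_top"
    by (intro tendsto_add tendsto_divide_0[OF tendsto_const] filterlim_at_top_imp_at_infinity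
        filterlim_compose[OF sqrt_at_top] sqrt_at_top)
  then have z: "((\<lambda>T. (E * A1) / sqrt (sqrt T) + (D + A2) / sqrt T) \<longlongrightarrow> 0) at_top" by simp
  have "((\<lambda>T. expectation (tilt \<theta> T) - 1) \<longlongrightarrow> 0) at_top"
    by (rule Lim_null_comparison[OF _ z]) (rule eventually_mono[OF eventually_ge_at_top[of 1] est])
  then show ?thesis by (simp add: LIM_zero_iff)
qed

definition Z :: "real \<Rightarrow> 'a \<Rightarrow> real" where
  "Z t \<omega> = (L t \<omega> - OU.q * t) / sqrt t"

lemma Z_measurable: "t \<ge> 0 \<Longrightarrow> Z t \<in> borel_measurable M"
  unfolding Z_def[abs_def] using rv(2)[of t] by measurable

text \<open>With u = \<theta> / sqrt T one has u^2 T = \<theta>^2, so the tilted weight is exp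
  (\<theta>^2 \<tau>^2 / 2) times exp (i \<theta> Z), and its mean is the characteristic function up
  to a constant.\<close>

lemma char_Z_tendsto:
  "((\<lambda>t. char (distr M borel (Z t)) \<theta>) \<longlongrightarrow> of_real (exp (- (\<theta>\<^sup>2 * OU.\<tau>2 / 2)))) at_top"
proof -
  let ?E = "exp (- (\<theta>\<^sup>2 * OU.\<tau>2 / 2))"
  have eq: "of_real ?E * expectation (tilt \<theta> T) = char (distr M borel (Z T)) \<theta>" if T: "T \<ge> 1" for T
  proof -
    have T0: "T \<ge> 0" using T by simp
    have w: "of_real ?E * tilt \<theta> T \<omega> = iexp (\<theta> * Z T \<omega>)" for \<omega>
    proof -
      have "(\<theta> / sqrt T)\<^sup>2 * T = \<theta>\<^sup>2" using T by (simp add: power_divide)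
      then have 1: "(complex_of_real (\<theta> / sqrt T))\<^sup>2 * of_real T = of_real (\<theta>\<^sup>2)"
        by (simp only: of_real_power[symmetric] of_real_mult[symmetric])
      have 2: "\<theta> * Z T \<omega> = \<theta> / sqrt T * L T \<omega> - \<theta> / sqrt T * OU.q * T"
        by (simp add: Z_def algebra_simps diff_divide_distrib)
      have "complex_of_real (- (\<theta>\<^sup>2 * OU.\<tau>2 / 2)) + (drift_const (\<theta> / sqrt T) * of_real T + \<i> * of_real (\<theta> / sqrt T) * of_real (L T \<omega>))
          = complex_of_real (- (\<theta>\<^sup>2 * OU.\<tau>2 / 2)) + ((complex_of_real (\<theta> / sqrt T))\<^sup>2 * of_real T) * of_real OU.\<tau>2 / 2
            + \<i> * (of_real (\<theta> / sqrt T) * of_real (L T \<omega>) - of_real (\<theta> / sqrt T) * of_real OU.q * of_real T)"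
        unfolding drift_const_def by (simp add: algebra_simps)
      also have "\<dots> = \<i> * of_real (\<theta> * Z T \<omega>)"
        unfolding 1 2 by simp
      finally have "exp (complex_of_real (- (\<theta>\<^sup>2 * OU.\<tau>2 / 2)) + (drift_const (\<theta> / sqrt T) * of_real T + \<i> * of_real (\<theta> / sqrt T) * of_real (L T \<omega>))) = iexp (\<theta> * Z T \<omega>)"
        by (rule arg_cong)
      then show ?thesis unfolding weight_def exp_add by (simp only: exp_of_real)
    qed
    have "of_real ?E * expectation (tilt \<theta> T) = expectation (\<lambda>\<omega>. iexp (\<theta> * Z T \<omega>))"
      unfolding w[symmetric] by (rule integral_mult_right_zero[symmetric])
    also have "\<dots> = char (distr M borel (Z T)) \<theta>"
      unfolding char_def using Z_measurable[OF T0] by (subst integral_distr) auto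
    finally show ?thesis .
  qed
  have "((\<lambda>T. of_real ?E * expectation (tilt \<theta> T)) \<longlongrightarrow> of_real ?E * 1) at_top"
    by (intro tendsto_mult tendsto_const weight_tendsto_1)
  then have "((\<lambda>T. of_real ?E * expectation (tilt \<theta> T)) \<longlongrightarrow> of_real ?E) at_top"
    by simp
  then show ?thesis
    by (rule Lim_transform_eventually) (rule eventually_mono[OF eventually_ge_at_top[of 1] eq])
qed

end

section \<open>Normal characteristic functions and Levy continuity along real time\<close>

lemma normal_eq_distr:
  assumes "\<tau> > 0"
  shows "density lborel (normal_density 0 \<tau>) = distr std_normal_distribution borel (\<lambda>z. \<tau> * z)"
proof -
  interpret std: prob_space std_normal_distribution by (rule prob_space_normal_density) simp
  have "distributed std_normal_distribution lborel (\<lambda>z. z) std_normal_density"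
    unfolding distributed_def by (auto intro!: distr_id2)
  from std.normal_density_affine[OF this, of \<tau> 0] assms
  have "distributed std_normal_distribution lborel (\<lambda>z. \<tau> * z) (normal_density 0 \<tau>)" by simp
  then have "distr std_normal_distribution lborel (\<lambda>z. \<tau> * z) = density lborel (normal_density 0 \<tau>)"
    by (simp add: distributed_def)
  \<comment> \<open>\<open>distributed\<close> pushes forward to \<open>lborel\<close>, the claim to
    \<open>borel\<close>; the two have the same measurable sets.\<close>
  then show ?thesis by (metis distr_cong sets_lborel)
qed

lemma char_normal:
  assumes "\<tau> > 0"
  shows "char (density lborel (normal_density 0 \<tau>)) \<theta> = of_real (exp (- (\<theta>\<^sup>2 * \<tau>\<^sup>2 / 2)))"
proof -
  have "char (density lborel (normal_density 0 \<tau>)) \<theta> = (\<integral>z. iexp (\<theta> * (\<tau> * z)) \<partial>std_normal_distribution)"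
    unfolding normal_eq_distr[OF assms] char_def by (subst integral_distr) auto
  also have "\<dots> = char std_normal_distribution (\<theta> * \<tau>)" by (simp add: char_def mult.assoc)
  also have "\<dots> = of_real (exp (- (\<theta>\<^sup>2 * \<tau>\<^sup>2 / 2)))" by (simp add: char_std_normal_distribution power_mult_distrib)
  finally show ?thesis .
qed

text \<open>Levy's theorem concerns sequences; the limit along real t follows by testing every
  sequence that tends to infinity.\<close>

lemma weak_conv_at_top_of_char:
  fixes \<mu> :: "real \<Rightarrow> real measure"
  assumes \<mu>: "\<And>t. t \<ge> 0 \<Longrightarrow> real_distribution (\<mu> t)" and \<nu>: "real_distribution \<nu>"
    and char: "\<And>\<theta>. ((\<lambda>t. char (\<mu> t) \<theta>) \<longlongrightarrow> char \<nu> \<theta>) at_top"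
  shows "weak_conv_at_top \<mu> \<nu>"
  unfolding weak_conv_at_top_def
proof (intro allI impI)
  fix f :: "real \<Rightarrow> real" assume f: "continuous_on UNIV f" "bounded (range f)"
  obtain B where B: "\<And>y. norm (f y) \<le> B" using f(2) unfolding bounded_iff by auto
  show "((\<lambda>t. \<integral>y. f y \<partial>(\<mu> t)) \<longlongrightarrow> (\<integral>y. f y \<partial>\<nu>)) at_top"
  proof (rule tendsto_at_topI_sequentially)
    fix X :: "nat \<Rightarrow> real" assume X: "filterlim X at_top sequentially"
    \<comment> \<open>The measures are known to be distributions only for t >= 0; the cut at 0
      changes only finitely many terms.\<close>
    define X' where "X' n = max (X n) 0" for n
    have ev: "\<forall>\<^sub>F n in sequentially. X n = X' n"
    proof -
      have "\<forall>\<^sub>F n in sequentially. 0 \<le> X n" using X unfolding filterlim_at_top by blast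
      then show ?thesis by eventually_elim (simp add: X'_def)
    qed
    have X': "filterlim X' at_top sequentially" by (rule filterlim_cong[THEN iffD1, OF refl refl ev X])
    have rd: "real_distribution (\<mu> (X' n))" for n by (rule \<mu>) (simp add: X'_def)
    have "weak_conv_m (\<lambda>n. \<mu> (X' n)) \<nu>"
      by (rule levy_continuity[OF rd \<nu>]) (rule filterlim_compose[OF char X'])
    from weak_conv_imp_integral_bdd_continuous_conv[OF rd \<nu> this, of f B] f(1) B
    have "(\<lambda>n. \<integral>y. f y \<partial>(\<mu> (X' n))) \<longlonglongrightarrow> (\<integral>y. f y \<partial>\<nu>)"
      by (simp add: continuous_on_eq_continuous_at)
    then show "(\<lambda>n. \<integral>y. f y \<partial>(\<mu> (X n))) \<longlonglongrightarrow> (\<integral>y. f y \<partial>\<nu>)"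
      by (rule Lim_transform_eventually) (use ev in eventually_elim, simp)
  qed
qed

theorem theorem1:
  fixes M :: "'a measure" and F :: "real \<Rightarrow> 'a measure"
    and W Y L :: "real \<Rightarrow> 'a \<Rightarrow> real"
    and \<alpha> \<gamma> \<sigma> x :: real
  assumes "std_brownian_motion M F W"
    and "\<gamma> > 0" and "\<sigma> > 0" and "x \<ge> 0"
    and "reflected_OU M F W \<alpha> \<gamma> \<sigma> x Y L"
  shows "set_integrable lborel {0..} (\<lambda>y. (deriv (hfun \<alpha> \<gamma> \<sigma>) y)\<^sup>2 * pY \<alpha> \<gamma> \<sigma> y)
    \<and> weak_conv_at_top
        (\<lambda>t. distr M borel (\<lambda>\<omega>. (L t \<omega> - qL \<alpha> \<gamma> \<sigma> * t) / sqrt t))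
        (density lborel (normal_density 0 (sqrt (tau2 \<alpha> \<gamma> \<sigma>))))"
proof
  interpret reflected_OU_process M F W Y L \<alpha> \<gamma> \<sigma> x
    by unfold_locales (fact assms)+
  show "set_integrable lborel {0..} (\<lambda>y. (deriv (hfun \<alpha> \<gamma> \<sigma>) y)\<^sup>2 * pY \<alpha> \<gamma> \<sigma> y)"
    unfolding OU.deriv_h by (rule OU.h'_sq_integrable)
  have s: "sqrt OU.\<tau>2 > 0" "(sqrt OU.\<tau>2)\<^sup>2 = OU.\<tau>2" using OU.tau2_pos by simp_all
  have "weak_conv_at_top (\<lambda>t. distr M borel (Z t)) (density lborel (normal_density 0 (sqrt OU.\<tau>2)))"
  proof (rule weak_conv_at_top_of_char)
    show "real_distribution (distr M borel (Z t))" if "t \<ge> 0" for t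
      by (rule real_distribution_distr[OF Z_measurable[OF that]])
    show "real_distribution (density lborel (normal_density 0 (sqrt OU.\<tau>2)))"
      using prob_space_normal_density[OF s(1)] by (auto simp: real_distribution_def real_distribution_axioms_def)
    show "((\<lambda>t. char (distr M borel (Z t)) \<theta>) \<longlongrightarrow> char (density lborel (normal_density 0 (sqrt OU.\<tau>2))) \<theta>) at_top" for \<theta>
      unfolding char_normal[OF s(1)] s(2) by (rule char_Z_tendsto)
  qed
  then show "weak_conv_at_top
        (\<lambda>t. distr M borel (\<lambda>\<omega>. (L t \<omega> - qL \<alpha> \<gamma> \<sigma> * t) / sqrt t))
        (density lborel (normal_density 0 (sqrt (tau2 \<alpha> \<gamma> \<sigma>))))"
    unfolding Z_def[abs_def] .
qed

end
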